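(* Let $\gamma>0$ and let $\mathbb{S}$ be the circle of unit length. Let $u_0\in H^s(\mathbb{S})$, $s\ge2$, with $\int_{\mathbb{S}}u_0(x)\,dx=0$, and let $u(t,x)$ be the solution of the Cauchy problem $(u_t+uu_x)_x=\gamma u$, $t>0$, $u(0,x)=u_0(x)$ on $\mathbb{S}$. The solution blows up in a finite time $T\in(0,\infty)$, in the sense that $\lim_{t\uparrow T}\|u(t,\cdot)\|_{H^s}=\infty$, if and only if $$\lim_{t\uparrow T}\inf_{x\in\mathbb{S}}u_x(t,x)=-\infty.$$
   Context: All functions are real-valued. "The solution" is the unique solution $u\in C([0,T);H^s(\mathbb{S}))\cap C^1([0,T);H^{s-1}(\mathbb{S}))$ of the Cauchy problem on its maximal existence interval $[0,T)$, $T=T(u_0)>0$; it exists for every zero-mean $u_0\in H^s(\mathbb{S})$, $s\ge2$, depends continuously on the initial data, and satisfies $\int_{\mathbb{S}}u(t,x)\,dx=0$ and $\|u(t,\cdot)\|_{L^2}=\|u_0\|_{L^2}$ on $[0,T)$. The maximal time is independent of $s\ge2$: if $u_0\in H^s(\mathbb{S})\cap H^{s'}(\mathbb{S})$ with $s,s'\ge2$, the maximal times in $H^s$ and $H^{s'}$ coincide. *)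

theory Defs
  imports "HOL-Analysis.Analysis"
begin

text \<open>Functions on the circle of unit length are 1-periodic functions on the real line.\<close>

definition periodic1 :: "(real \<Rightarrow> real) \<Rightarrow> bool" where
  "periodic1 f \<longleftrightarrow> (\<forall>x. f (x + 1) = f x)"

definition fourier_coeff :: "(real \<Rightarrow> real) \<Rightarrow> int \<Rightarrow> complex" where
  "fourier_coeff f k = (LBINT x:{0..1}. cis (- 2 * pi * of_int k * x) * complex_of_real (f x))"

text \<open>
  The Sobolev space of real order \<open>s \<ge> 0\<close>.  Its elements are arbitrary representatives of
  classes modulo equality almost everywhere.  The weight is the symbol of
  \<open>(1 - \<partial>\<^sub>x\<^sup>2)\<^sup>s\<close> on the circle of unit length.
\<close>

definition sobolev :: "real \<Rightarrow> (real \<Rightarrow> real) set" where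
  "sobolev s = {f. periodic1 f \<and> f \<in> borel_measurable lborel \<and>
     set_integrable lborel {0..1} (\<lambda>x. (f x)\<^sup>2) \<and>
     (\<lambda>k::int. (1 + (2 * pi * of_int k)\<^sup>2) powr s * (cmod (fourier_coeff f k))\<^sup>2) summable_on UNIV}"

definition sobolev_norm :: "real \<Rightarrow> (real \<Rightarrow> real) \<Rightarrow> real" where
  "sobolev_norm s f =
     sqrt (\<Sum>\<^sub>\<infinity>k::int. (1 + (2 * pi * of_int k)\<^sup>2) powr s * (cmod (fourier_coeff f k))\<^sup>2)"

definition continuous_in_sobolev :: "real \<Rightarrow> real set \<Rightarrow> (real \<Rightarrow> real \<Rightarrow> real) \<Rightarrow> bool" where
  "continuous_in_sobolev s I u \<longleftrightarrow>
     (\<forall>t\<in>I. u t \<in> sobolev s) \<and>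
     (\<forall>t\<in>I. ((\<lambda>r. sobolev_norm s (\<lambda>x. u r x - u t x)) \<longlongrightarrow> 0) (at t within I))"

definition has_sobolev_time_derivative ::
  "real \<Rightarrow> real set \<Rightarrow> (real \<Rightarrow> real \<Rightarrow> real) \<Rightarrow> (real \<Rightarrow> real \<Rightarrow> real) \<Rightarrow> bool" where
  "has_sobolev_time_derivative s I u v \<longleftrightarrow>
     (\<forall>t\<in>I. u t \<in> sobolev s \<and> v t \<in> sobolev s \<and>
        ((\<lambda>r. sobolev_norm s (\<lambda>x. (u r x - u t x) / (r - t) - v t x)) \<longlongrightarrow> 0) (at t within I))"

definition smooth_test :: "(real \<Rightarrow> real) \<Rightarrow> bool" where
  "smooth_test \<phi> \<longleftrightarrow> periodic1 \<phi> \<and> (\<forall>n x. (deriv ^^ n) \<phi> differentiable (at x))"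

definition distributional_derivative :: "(real \<Rightarrow> real) \<Rightarrow> (real \<Rightarrow> real) \<Rightarrow> bool" where
  "distributional_derivative g h \<longleftrightarrow>
     (\<forall>\<phi>. smooth_test \<phi> \<longrightarrow>
        (LBINT x:{0..1}. g x * deriv \<phi> x) = - (LBINT x:{0..1}. h x * \<phi> x))"

definition time_interval :: "ereal \<Rightarrow> real set" where
  "time_interval T = {t. 0 \<le> t \<and> ereal t < T}"

text \<open>
  Solutions on \<open>[0,T)\<close>, \<open>T \<in> (0,\<infinity>]\<close>, in the class
  \<open>C([0,T); H\<^sup>s) \<inter> C\<^sup>1([0,T); H\<^sup>s\<^sup>-\<^sup>1)\<close>, where \<open>v\<close> is \<open>u\<^sub>t\<close>.  For \<open>s \<ge> 2\<close>
  every class in \<open>H\<^sup>s\<close> has a continuously differentiable representative; continuity in \<open>x\<close> selects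
  it, so that \<open>u\<^sub>x\<close> is the classical derivative.  Since \<open>u\<^sub>t\<close> and \<open>u u\<^sub>x\<close> are only in
  \<open>H\<^sup>s\<^sup>-\<^sup>1\<close>, the outer \<open>x\<close>-derivative in the equation is the distributional one.
\<close>

definition is_solution ::
  "real \<Rightarrow> real \<Rightarrow> (real \<Rightarrow> real) \<Rightarrow> ereal \<Rightarrow> (real \<Rightarrow> real \<Rightarrow> real) \<Rightarrow> bool" where
  "is_solution \<gamma> s u0 T u \<longleftrightarrow>
     0 < T \<and>
     (\<forall>t\<in>time_interval T. continuous_on UNIV (u t)) \<and>
     continuous_in_sobolev s (time_interval T) u \<and>
     (AE x in lborel. u 0 x = u0 x) \<and>
     (\<exists>v. has_sobolev_time_derivative (s - 1) (time_interval T) u v \<and>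
          continuous_in_sobolev (s - 1) (time_interval T) v \<and>
          (\<forall>t\<in>time_interval T. 0 < t \<longrightarrow>
             distributional_derivative (\<lambda>x. v t x + u t x * deriv (u t) x) (\<lambda>x. \<gamma> * u t x)))"

definition is_maximal_solution ::
  "real \<Rightarrow> real \<Rightarrow> (real \<Rightarrow> real) \<Rightarrow> ereal \<Rightarrow> (real \<Rightarrow> real \<Rightarrow> real) \<Rightarrow> bool" where
  "is_maximal_solution \<gamma> s u0 T u \<longleftrightarrow>
     is_solution \<gamma> s u0 T u \<and>
     \<not> (\<exists>T' w. T < T' \<and> is_solution \<gamma> s u0 T' w \<and> (\<forall>t\<in>time_interval T. w t = u t))"

end

theory Submission
  imports Defs
begin

text \<open>
  For \<open>s \<ge> 2\<close> the solution is \<open>C\<^sup>1\<close> in \<open>(t, x)\<close> and solves \<open>u\<^sub>t + u u\<^sub>x = \<gamma> P\<close> with \<open>P\<close> the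
  mean-zero primitive of \<open>u\<close>.  If \<open>inf u\<^sub>x \<rightarrow> -\<infinity>\<close>, the embedding of \<open>H\<^sup>s\<close> into \<open>C\<^sup>1\<close> makes the
  \<open>H\<^sup>s\<close> norm blow up and rules out that \<open>T\<close> is an interior time.
  Conversely, suppose \<open>u\<^sub>x(t\<^sub>0) \<ge> -M\<close> for times \<open>t\<^sub>0\<close> arbitrarily close to \<open>T\<close>.  The maximum principle bounds
  \<open>u\<close>, and the Riccati inequality for one-sided Lipschitz constants (argued on difference quotients,
  since \<open>u\<^sub>x\<close> need not be differentiable) keeps \<open>u\<^sub>x\<close> bounded on \<open>[t\<^sub>0, T)\<close> if \<open>T - t\<^sub>0\<close> is small.
  Then \<open>\<parallel>u\<^sub>x\<^sub>x\<parallel>\<close> grows at most exponentially; it controls the absolutely convergent Fourier series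
  of \<open>u\<^sub>x\<close>, and this in turn controls the growth of the \<open>H\<^sup>s\<close> norm for every real \<open>s\<close>.
\<close>

section \<open>Fourier series on the circle\<close>

text \<open>The obstacle is regularity in time. \<open>u\<close> is \<open>C^1\<close>, but in the
  case \<open>s = 2\<close> its second derivative in \<open>x\<close> is merely square integrable,
  so neither an energy identity for \<open>u_xx\<close> nor one for the \<open>H^s\<close> norm can
  be had by differentiating the equation. Each estimate is therefore carried by a quantity that
  involves only values of \<open>u\<close> or finitely many of its coefficients and so is
  differentiable in time: increments over an interval for the slope, symmetric second differences
  for \<open>H^2\<close>, sums with a compactly supported weight for \<open>H^s\<close>. The
  intermediate \<open>H^2\<close> stage has its own reason. The \<open>H^s\<close> commutator is
  estimated frequency by frequency in absolute values, where a supremum bound of \<open>u_x\<close>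
  is of no direct use. The bound on \<open>u_xx\<close> is obtained in physical space instead, where
  the supremum suffices. Since \<open>H^1\<close> embeds into the absolutely summable sequences,
  every series that is integrated or differentiated termwise converges uniformly.\<close>

definition fexp :: "int \<Rightarrow> real \<Rightarrow> complex" where
  "fexp k x = cis (2 * pi * of_int k * x)"

definition fser :: "(int \<Rightarrow> complex) \<Rightarrow> real \<Rightarrow> complex" where
  "fser c x = (\<Sum>\<^sub>\<infinity>k. c k * fexp k x)"

definition fint :: "(real \<Rightarrow> complex) \<Rightarrow> int \<Rightarrow> complex" where
  "fint F k = integral {0..1} (\<lambda>x. F x * fexp (- k) x)"

lemma norm_fexp [simp]: "norm (fexp k x) = 1"
  by (simp add: fexp_def)

lemma fexp_0 [simp]: "fexp 0 x = 1"
  by (simp add: fexp_def)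

lemma fexp_add: "fexp (k + l) x = fexp k x * fexp l x"
  by (simp add: fexp_def cis_mult algebra_simps)

lemma fexp_cnj: "cnj (fexp k x) = fexp (- k) x"
  by (simp add: fexp_def cis_cnj)

lemma fexp_shift: "fexp k (x + y) = fexp k x * fexp k y"
  by (simp add: fexp_def cis_mult algebra_simps)

lemma fexp_minus: "fexp k (- y) = fexp (- k) y"
  by (simp add: fexp_def)

lemma fexp_at_1 [simp]: "fexp k 1 = 1"
proof -
  have "cis (2 * pi * of_int k) = 1" by (rule cis_multiple_2pi) auto
  thus ?thesis by (simp add: fexp_def)
qed

lemma fexp_at_0 [simp]: "fexp k 0 = 1"
  by (simp add: fexp_def)

lemma continuous_on_fexp [continuous_intros]:
  assumes "continuous_on S g"
  shows "continuous_on S (\<lambda>x. fexp k (g x))"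
proof -
  have "continuous_on S (\<lambda>x. cis (2 * pi * of_int k * g x))"
    unfolding cis_conv_exp by (intro continuous_intros assms)
  thus ?thesis by (simp add: fexp_def)
qed

lemma has_vector_derivative_fexp [derivative_intros]:
  "(fexp k has_vector_derivative (2 * pi * \<i> * of_int k * fexp k x)) (at x within S)"
proof -
  have "((\<lambda>x. exp (\<i> * of_real (2 * pi * of_int k * x))) has_vector_derivative
     (2 * pi * \<i> * of_int k * exp (\<i> * of_real (2 * pi * of_int k * x)))) (at x within S)"
    by (auto intro!: derivative_eq_intros has_vector_derivative_real_field simp: algebra_simps)
  thus ?thesis unfolding fexp_def cis_conv_exp .
qed

lemma integral_fexp: "integral {0..1} (fexp k) = (if k = 0 then 1 else 0)"
proof (cases "k = 0")
  case True
  hence "fexp k = (\<lambda>_. 1)" by auto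
  with True show ?thesis by simp
next
  case False
  let ?c = "2 * pi * \<i> * of_int k :: complex"
  have "((\<lambda>x. ?c * fexp k x) has_integral (fexp k 1 - fexp k 0)) {0..1}"
    by (intro fundamental_theorem_of_calculus has_vector_derivative_fexp) auto
  from integral_unique[OF this] have "?c * integral {0..1} (fexp k) = 0" by simp
  with False show ?thesis by simp
qed

lemma integrable_cont:
  fixes f :: "real \<Rightarrow> 'a::euclidean_space"
  assumes "continuous_on UNIV f"
  shows "f integrable_on {a..b}"
  by (intro integrable_continuous_interval continuous_on_subset[OF assms]) auto

section \<open>Completeness of the trigonometric system\<close>

lemma periodic_int:
  fixes f :: "real \<Rightarrow> 'a"
  assumes "\<And>x. f (x + 1) = f x"
  shows "f (x + of_int n) = f x"
proof -
  have nat: "f (x + of_nat m) = f x" for m x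
  proof (induction m)
    case (Suc m)
    have "f (x + of_nat (Suc m)) = f ((x + of_nat m) + 1)" by (simp add: algebra_simps)
    with Suc assms show ?case by simp
  qed auto
  show ?thesis
  proof (cases "n \<ge> 0")
    case True
    then show ?thesis using nat[of x "nat n"] by simp
  next
    case False
    then show ?thesis using nat[of "x + of_int n" "nat (-n)"] by simp
  qed
qed

lemma periodic_frac:
  fixes f :: "real \<Rightarrow> 'a"
  assumes "\<And>x. f (x + 1) = f x"
  shows "f x = f (frac x)"
  using periodic_int[where f = f, OF assms, of "frac x" "\<lfloor>x\<rfloor>"] by (simp add: frac_def)

text \<open>Stone-Weierstrass needs a compact domain, so a periodic function is transported to the
  unit circle by the principal argument. Only continuity across the branch cut is at stake, and
  periodicity of \<open>f\<close> repairs it.\<close>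

lemma circle_function:
  fixes f :: "real \<Rightarrow> complex"
  assumes cont: "continuous_on UNIV f" and per: "\<And>x. f (x + 1) = f x"
  obtains F where "continuous_on (sphere 0 1) F" "\<And>x. F (fexp 1 x) = f x"
proof -
  define F where "F = (\<lambda>z. f (Arg z / (2 * pi)))"
  have F: "F (fexp 1 x) = f x" for x
  proof -
    define y where "y = Arg (fexp 1 x) / (2 * pi)"
    have "cis (2 * pi * y) = cis (2 * pi * x)"
      unfolding y_def using Arg_eq[of "fexp 1 x"]
      by (simp add: fexp_def cis_conv_exp mult.commute)
    hence "exp (\<i> * of_real (2 * pi * y)) = exp (\<i> * of_real (2 * pi * x))"
      by (simp add: cis_conv_exp)
    then obtain n :: int where "\<i> * of_real (2 * pi * y) = \<i> * of_real (2 * pi * x) + of_int (2 * n) * pi * \<i>"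
      unfolding exp_eq by blast
    hence "\<i> * of_real (2 * pi * y) = \<i> * of_real (2 * pi * (x + of_int n))"
      by (simp add: algebra_simps)
    hence "2 * pi * y = 2 * pi * (x + of_int n)"
      by (simp only: mult_cancel_left of_real_eq_iff) auto
    hence "y = x + of_int n" by simp
    thus ?thesis unfolding F_def y_def[symmetric] using periodic_int[where f = f, OF per, of x n] by simp
  qed
  \<comment> \<open>The same \<open>F\<close> written with the argument of \<open>- z\<close>: this
    branch is continuous on the negative real axis, where \<open>Arg z\<close> jumps, and the half
    period undoes the rotation.\<close>
  have alt: "F z = f (Arg (- z) / (2 * pi) + 1 / 2)" if "z \<in> sphere 0 1" for z
  proof -
    have nz: "z \<noteq> 0" using that by auto
    have "z = fexp 1 (Arg z / (2 * pi))" using Arg_eq[OF nz] that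
      by (simp add: fexp_def cis_conv_exp)
    have "- z = cis (Arg (- z))" using Arg_eq[of "- z"] nz that
      by (simp add: cis_conv_exp)
    hence "z = cis (Arg (- z)) * cis pi" by (simp add: minus_equation_iff)
    also have "\<dots> = fexp 1 (Arg (- z) / (2 * pi) + 1 / 2)"
    proof -
      have "2 * pi * of_int 1 * (Arg (- z) / (2 * pi) + 1 / 2) = Arg (- z) + pi"
        by (simp add: distrib_left)
      thus ?thesis unfolding fexp_def cis_mult by metis
    qed
    finally show ?thesis using F by metis
  qed
  have fc: "isCont f x" for x using cont by (simp add: continuous_on_eq_continuous_at)
  have "continuous (at z within sphere 0 1) F" if z: "z \<in> sphere 0 1" for z
  proof (cases "z \<in> \<real>\<^sub>\<le>\<^sub>0")
    case False
    have "isCont (\<lambda>z. Arg z / (2 * pi)) z" by (intro continuous_intros continuous_at_Arg False) auto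
    hence "isCont F z" unfolding F_def by (intro isCont_o2[OF _ fc])
    thus ?thesis by (rule continuous_at_imp_continuous_at_within)
  next
    case True
    have nz: "z \<noteq> 0" using z by auto
    have "- z \<notin> \<real>\<^sub>\<le>\<^sub>0"
      using True nz by (auto simp: complex_nonpos_Reals_iff complex_eq_iff)
    hence "isCont (\<lambda>z. Arg (- z) / (2 * pi) + 1 / 2) z"
      by (intro continuous_intros isCont_o2[OF _ continuous_at_Arg]) auto
    hence "isCont (\<lambda>z. f (Arg (- z) / (2 * pi) + 1 / 2)) z" by (intro isCont_o2[OF _ fc])
    hence "continuous (at z within sphere 0 1) (\<lambda>z. f (Arg (- z) / (2 * pi) + 1 / 2))"
      by (rule continuous_at_imp_continuous_at_within)
    thus ?thesis
      by (rule continuous_transform_within[of _ _ _ 1]) (use z alt in auto)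
  qed
  hence "continuous_on (sphere 0 1) F" by (simp add: continuous_on_eq_continuous_within)
  with F that show thesis by blast
qed

text \<open>All frequencies \<open>k\<close> are built in, so that the admissible \<open>g\<close>
  are stable under multiplication by exponentials; this is what lets an induction over polynomials
  on the circle go through.\<close>

definition fexp_orthogonal :: "(real \<Rightarrow> complex) \<Rightarrow> (real \<Rightarrow> complex) \<Rightarrow> bool" where
  "fexp_orthogonal f g \<longleftrightarrow> continuous_on UNIV g \<and> (\<forall>k. integral {0..1} (\<lambda>x. f x * fexp k x * g x) = 0)"

lemma fexp_orthogonal_linear:
  assumes f: "continuous_on UNIV f" and g: "fexp_orthogonal f g" and h: "fexp_orthogonal f h"
  shows "fexp_orthogonal f (\<lambda>x. c * g x + d * h x)"
proof -
  have gh: "continuous_on UNIV g" "continuous_on UNIV h" using g h by (auto simp: fexp_orthogonal_def)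
  have "integral {0..1} (\<lambda>x. f x * fexp k x * (c * g x + d * h x)) = 0" for k
  proof -
    have "integral {0..1} (\<lambda>x. c * (f x * fexp k x * g x) + d * (f x * fexp k x * h x)) =
        integral {0..1} (\<lambda>x. c * (f x * fexp k x * g x)) + integral {0..1} (\<lambda>x. d * (f x * fexp k x * h x))"
      by (intro integral_add integrable_cont continuous_intros f gh)
    thus ?thesis using g h by (simp add: fexp_orthogonal_def algebra_simps)
  qed
  thus ?thesis by (auto simp: fexp_orthogonal_def intro!: continuous_intros gh)
qed

lemma fexp_orthogonal_fexp:
  assumes "fexp_orthogonal f g"
  shows "fexp_orthogonal f (\<lambda>x. g x * fexp l x)"
proof -
  have "(\<lambda>x. f x * fexp k x * (g x * fexp l x)) = (\<lambda>x. f x * fexp (k + l) x * g x)" for k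
    by (simp add: fexp_add mult_ac)
  with assms show ?thesis by (auto simp: fexp_orthogonal_def intro!: continuous_intros)
qed

text \<open>\<open>g\<close> stays arbitrary in the induction because the product case applies the
  hypothesis for \<open>q\<close> to \<open>g\<close> already multiplied by \<open>p\<close>. The
  linear case is the one that uses the circle.\<close>

lemma fexp_orthogonal_polynomial:
  assumes "real_polynomial_function p" and f: "continuous_on UNIV f"
    and "fexp_orthogonal f g"
  shows "fexp_orthogonal f (\<lambda>x. g x * of_real (p (fexp 1 x)))"
  using assms(1,3)
proof (induction arbitrary: g rule: real_polynomial_function.induct)
  case (linear h)
  interpret h: bounded_linear h by fact
  have h_eq: "h z = h 1 * Re z + h \<i> * Im z" for z
  proof -
    have "z = Re z *\<^sub>R 1 + Im z *\<^sub>R \<i>" by (simp add: complex_eq_iff)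
    hence "h z = Re z *\<^sub>R h 1 + Im z *\<^sub>R h \<i>" by (metis h.add h.scaleR)
    thus ?thesis by simp
  qed
  \<comment> \<open>A real-linear functional on the plane has the form
    \<open>c * z + d * cnj z\<close>, and on the circle the conjugate of \<open>fexp 1 x\<close> is
    \<open>fexp (-1) x\<close>.\<close>
  define c d where "c = (of_real (h 1) - \<i> * of_real (h \<i>)) / 2" and "d = (of_real (h 1) + \<i> * of_real (h \<i>)) / 2"
  have "complex_of_real (h (fexp 1 x)) = c * fexp 1 x + d * fexp (-1) x" for x
    by (subst h_eq) (simp add: c_def d_def fexp_def complex_eq_iff field_simps)
  hence "(\<lambda>x. g x * of_real (h (fexp 1 x))) = (\<lambda>x. c * (g x * fexp 1 x) + d * (g x * fexp (-1) x))"
    by (simp add: algebra_simps)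
  thus ?case by (simp only:) (intro fexp_orthogonal_linear fexp_orthogonal_fexp f linear)
next
  case (const c)
  from fexp_orthogonal_linear[OF f const const, of "of_real c" 0] show ?case by (simp add: mult.commute)
next
  case (add p q)
  from fexp_orthogonal_linear[OF f add.IH(1)[OF add.prems] add.IH(2)[OF add.prems], of 1 1]
  show ?case by (simp add: distrib_left)
next
  case (mult p q)
  from mult.IH(2)[OF mult.IH(1)[OF mult.prems]] show ?case by (simp add: mult.assoc)
qed

text \<open>For a uniform \<open>e\<close>-approximation \<open>g\<close> of \<open>f\<close> by
  polynomials on the circle, the integral of \<open>f * cnj g\<close> vanishes. Hence the integral
  of the squared modulus of \<open>f\<close> equals that of \<open>f * cnj (f - g)\<close>, which is
  at most \<open>e\<close> times the \<open>L^1\<close> norm of \<open>f\<close>.\<close>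

lemma fint_eq_0_imp_eq_0:
  assumes cont: "continuous_on UNIV f" and per: "\<And>x. f (x + 1) = f x"
    and zero: "\<And>k. fint f k = 0"
  shows "f x = 0"
proof -
  obtain F where F: "continuous_on (sphere 0 1) F" "\<And>x. F (fexp 1 x) = f x"
    using circle_function[OF cont per] by blast
  have f0: "fexp_orthogonal f (\<lambda>_. 1)"
    using zero[of "- k" for k] by (auto simp: fexp_orthogonal_def fint_def)
  define B where "B = integral {0..1} (\<lambda>x. norm (f x))"
  have small: "integral {0..1} (\<lambda>x. (norm (f x))\<^sup>2) \<le> e * B" if "e > 0" for e
  proof -
    obtain G where G: "polynomial_function G" "\<And>z. z \<in> sphere 0 1 \<Longrightarrow> norm (F z - G z) < e"
      using Stone_Weierstrass_polynomial_function[OF compact_sphere F(1) \<open>e > 0\<close>] by blast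
    have rG: "real_polynomial_function (\<lambda>x. Re (G x))" "real_polynomial_function (\<lambda>x. Im (G x))"
      using G(1) unfolding polynomial_function_def o_def by (auto intro: bounded_linear_Re bounded_linear_Im)
    define g where "g = (\<lambda>x. G (fexp 1 x))"
    have "fexp_orthogonal f (\<lambda>x. 1 * (1 * of_real (Re (G (fexp 1 x)))) + (- \<i>) * (1 * of_real (Im (G (fexp 1 x)))))"
      by (intro fexp_orthogonal_linear fexp_orthogonal_polynomial[OF rG(1)] fexp_orthogonal_polynomial[OF rG(2)] cont f0)
    moreover have "(\<lambda>x. 1 * (1 * of_real (Re (G (fexp 1 x)))) + (- \<i>) * (1 * of_real (Im (G (fexp 1 x))))) = (\<lambda>x. cnj (g x))"
      by (auto simp: g_def complex_eq_iff)
    ultimately have orth: "fexp_orthogonal f (\<lambda>x. cnj (g x))" by simp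
    have cg: "continuous_on UNIV g"
      using continuous_on_cnj[of UNIV "\<lambda>x. cnj (g x)"] orth by (simp add: fexp_orthogonal_def)
    have close: "norm (f x - g x) \<le> e" for x
      using G(2)[of "fexp 1 x"] F(2)[of x] by (simp add: g_def less_imp_le)
    have z: "integral {0..1} (\<lambda>x. f x * cnj (g x)) = 0"
      using orth by (simp add: fexp_orthogonal_def) (metis (no_types, lifting) fexp_0 mult.right_neutral integral_cong)
    have "(\<lambda>x. complex_of_real ((norm (f x))\<^sup>2)) = (\<lambda>x. f x * cnj (f x - g x) + f x * cnj (g x))"
      by (auto simp: algebra_simps complex_norm_square simp del: of_real_power)
    moreover have "integral {0..1} (\<lambda>x. f x * cnj (f x - g x) + f x * cnj (g x)) =
       integral {0..1} (\<lambda>x. f x * cnj (f x - g x)) + integral {0..1} (\<lambda>x. f x * cnj (g x))"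
      by (intro integral_add integrable_cont continuous_intros cont cg)
    ultimately have "integral {0..1} (\<lambda>x. complex_of_real ((norm (f x))\<^sup>2)) = integral {0..1} (\<lambda>x. f x * cnj (f x - g x))"
      using z by simp
    moreover have "((\<lambda>x. complex_of_real ((norm (f x))\<^sup>2)) has_integral of_real (integral {0..1} (\<lambda>x. (norm (f x))\<^sup>2))) {0..1}"
      by (intro has_integral_of_real integrable_integral integrable_cont continuous_intros cont)
    ultimately have "of_real (integral {0..1} (\<lambda>x. (norm (f x))\<^sup>2)) = integral {0..1} (\<lambda>x. f x * cnj (f x - g x))"
      by (metis integral_unique)
    hence "integral {0..1} (\<lambda>x. (norm (f x))\<^sup>2) \<le> norm (integral {0..1} (\<lambda>x. f x * cnj (f x - g x)))"
      by (metis abs_ge_self norm_of_real)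
    also have "\<dots> \<le> integral {0..1} (\<lambda>x. e * norm (f x))"
    proof (intro integral_norm_bound_integral integrable_cont continuous_intros cont cg)
      fix x :: real
      show "norm (f x * cnj (f x - g x)) \<le> e * norm (f x)"
        using close[of x] unfolding norm_mult complex_mod_cnj by (subst mult.commute) (intro mult_right_mono, auto)
    qed
    finally show ?thesis by (simp add: B_def)
  qed
  have B0: "B \<ge> 0" unfolding B_def by (intro integral_nonneg integrable_cont continuous_intros cont) auto
  have I: "integral {0..1} (\<lambda>x. (norm (f x))\<^sup>2) = 0"
  proof (rule antisym)
    show "integral {0..1} (\<lambda>x. (norm (f x))\<^sup>2) \<le> 0"
    proof (rule field_le_epsilon)
      fix e :: real assume "e > 0"
      have "integral {0..1} (\<lambda>x. (norm (f x))\<^sup>2) \<le> e / (B + 1) * B"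
        using \<open>e > 0\<close> B0 by (intro small) auto
      also have "\<dots> \<le> e" using \<open>e > 0\<close> B0 by (simp add: field_simps)
      finally show "integral {0..1} (\<lambda>x. (norm (f x))\<^sup>2) \<le> 0 + e" by simp
    qed
  qed (intro integral_nonneg integrable_cont continuous_intros cont, auto)
  have "(norm (f y))\<^sup>2 = 0" if "y \<in> {0..1}" for y
  proof (rule has_integral_0_cbox_imp_0[where a = 0 and b = 1 and f = "\<lambda>x. (norm (f x))\<^sup>2"])
    show "((\<lambda>x. (norm (f x))\<^sup>2) has_integral 0) (cbox 0 1)"
    proof -
      have "continuous_on UNIV (\<lambda>x. (norm (f x))\<^sup>2)" by (intro continuous_intros cont)
      from integrable_integral[OF integrable_cont[OF this, of 0 1]] I show ?thesis by simp
    qed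
  qed (use that in \<open>auto intro!: continuous_intros continuous_on_subset[OF cont]\<close>)
  hence "f (frac x) = 0" by (simp add: frac_lt_1 less_imp_le)
  thus ?thesis using periodic_frac[where f = f and x = x, OF per] by simp
qed

section \<open>Cauchy-Schwarz and Minkowski inequalities for square-summable families\<close>

lemma l2_bound:
  fixes f :: "'a \<Rightarrow> real"
  assumes "(\<lambda>k. (f k)\<^sup>2) summable_on A" "finite F" "F \<subseteq> A"
  shows "L2_set f F \<le> sqrt (\<Sum>\<^sub>\<infinity>k\<in>A. (f k)\<^sup>2)"
  unfolding L2_set_def by (intro real_sqrt_le_mono finite_sum_le_infsum assms) auto

lemma l2_Cauchy_Schwarz:
  fixes f g :: "'a \<Rightarrow> real"
  assumes f: "(\<lambda>k. (f k)\<^sup>2) summable_on A" and g: "(\<lambda>k. (g k)\<^sup>2) summable_on A"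
  shows "(\<lambda>k. \<bar>f k * g k\<bar>) summable_on A"
    and "(\<Sum>\<^sub>\<infinity>k\<in>A. \<bar>f k * g k\<bar>) \<le> sqrt (\<Sum>\<^sub>\<infinity>k\<in>A. (f k)\<^sup>2) * sqrt (\<Sum>\<^sub>\<infinity>k\<in>A. (g k)\<^sup>2)"
proof -
  have fin: "(\<Sum>k\<in>F. \<bar>f k * g k\<bar>) \<le> sqrt (\<Sum>\<^sub>\<infinity>k\<in>A. (f k)\<^sup>2) * sqrt (\<Sum>\<^sub>\<infinity>k\<in>A. (g k)\<^sup>2)"
    if "finite F" "F \<subseteq> A" for F
  proof -
    have "(\<Sum>k\<in>F. \<bar>f k * g k\<bar>) \<le> L2_set f F * L2_set g F"
      using L2_set_mult_ineq[of f g F] by (simp add: abs_mult)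
    also have "\<dots> \<le> sqrt (\<Sum>\<^sub>\<infinity>k\<in>A. (f k)\<^sup>2) * sqrt (\<Sum>\<^sub>\<infinity>k\<in>A. (g k)\<^sup>2)"
      by (intro mult_mono l2_bound f g that L2_set_nonneg) (auto intro!: infsum_nonneg)
    finally show ?thesis .
  qed
  show s: "(\<lambda>k. \<bar>f k * g k\<bar>) summable_on A"
    by (rule nonneg_bdd_above_summable_on) (use fin in \<open>auto intro!: bdd_aboveI\<close>)
  show "(\<Sum>\<^sub>\<infinity>k\<in>A. \<bar>f k * g k\<bar>) \<le> sqrt (\<Sum>\<^sub>\<infinity>k\<in>A. (f k)\<^sup>2) * sqrt (\<Sum>\<^sub>\<infinity>k\<in>A. (g k)\<^sup>2)"
    by (rule infsum_le_finite_sums[OF s]) (use fin in auto)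
qed

text \<open>Minkowski's inequality with a pointwise bound on \<open>h\<close> instead of
  \<open>h = f + g\<close>, because the moduli of sums of complex coefficients satisfy an inequality
  only.\<close>

lemma l2_triangle:
  fixes f g h :: "'a \<Rightarrow> real"
  assumes f: "(\<lambda>k. (f k)\<^sup>2) summable_on A" and g: "(\<lambda>k. (g k)\<^sup>2) summable_on A"
    and h: "\<And>k. k \<in> A \<Longrightarrow> \<bar>h k\<bar> \<le> \<bar>f k\<bar> + \<bar>g k\<bar>"
  shows "(\<lambda>k. (h k)\<^sup>2) summable_on A"
    and "sqrt (\<Sum>\<^sub>\<infinity>k\<in>A. (h k)\<^sup>2) \<le> sqrt (\<Sum>\<^sub>\<infinity>k\<in>A. (f k)\<^sup>2) + sqrt (\<Sum>\<^sub>\<infinity>k\<in>A. (g k)\<^sup>2)"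
proof -
  let ?S = "sqrt (\<Sum>\<^sub>\<infinity>k\<in>A. (f k)\<^sup>2) + sqrt (\<Sum>\<^sub>\<infinity>k\<in>A. (g k)\<^sup>2)"
  have S0: "?S \<ge> 0" by (intro add_nonneg_nonneg real_sqrt_ge_zero infsum_nonneg) auto
  have fin: "(\<Sum>k\<in>F. (h k)\<^sup>2) \<le> ?S\<^sup>2" if "finite F" "F \<subseteq> A" for F
  proof -
    have "sqrt (\<Sum>k\<in>F. (h k)\<^sup>2) = L2_set (\<lambda>k. \<bar>h k\<bar>) F" by (simp add: L2_set_def)
    also have "\<dots> \<le> L2_set (\<lambda>k. \<bar>f k\<bar> + \<bar>g k\<bar>) F"
      by (intro L2_set_mono) (use h that in auto)
    also have "\<dots> \<le> L2_set (\<lambda>k. \<bar>f k\<bar>) F + L2_set (\<lambda>k. \<bar>g k\<bar>) F"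
      by (rule L2_set_triangle_ineq)
    also have "\<dots> = L2_set f F + L2_set g F" by (simp add: L2_set_def)
    also have "\<dots> \<le> ?S" by (intro add_mono l2_bound f g that)
    finally show ?thesis using S0 by (simp add: sqrt_le_D)
  qed
  show s: "(\<lambda>k. (h k)\<^sup>2) summable_on A"
    by (rule nonneg_bdd_above_summable_on) (use fin in \<open>auto intro!: bdd_aboveI\<close>)
  have "(\<Sum>\<^sub>\<infinity>k\<in>A. (h k)\<^sup>2) \<le> ?S\<^sup>2"
    by (rule infsum_le_finite_sums[OF s]) (use fin in auto)
  thus "sqrt (\<Sum>\<^sub>\<infinity>k\<in>A. (h k)\<^sup>2) \<le> ?S"
    using S0 by (intro real_le_lsqrt) auto
qed

section \<open>Absolutely convergent Fourier series\<close>

abbreviation abs_summable :: "(int \<Rightarrow> complex) \<Rightarrow> bool" where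
  "abs_summable c \<equiv> (\<lambda>k. norm (c k)) summable_on UNIV"

lemma fser_uniform_limit:
  assumes "abs_summable c"
  shows "uniform_limit S (\<lambda>X x. \<Sum>k\<in>X. c k * fexp k x) (fser c) (finite_subsets_at_top UNIV)"
  unfolding fser_def
  by (rule Weierstrass_m_test_general[OF _ assms]) (simp add: norm_mult)

lemma fser_has_sum:
  assumes "abs_summable c"
  shows "((\<lambda>k. c k * fexp k x) has_sum fser c x) UNIV"
  unfolding fser_def
  by (rule has_sum_infsum, rule abs_summable_summable) (use assms in \<open>simp add: norm_mult\<close>)

lemma continuous_on_fser:
  assumes "abs_summable c"
  shows "continuous_on S (fser c)"
  by (rule uniform_limit_theorem[OF _ fser_uniform_limit[OF assms]])
     (auto intro!: always_eventually continuous_intros)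

lemma fser_periodic: "fser c (x + 1) = fser c x"
  by (simp add: fser_def fexp_shift)

lemma norm_fser_le:
  assumes "abs_summable c"
  shows "norm (fser c x) \<le> (\<Sum>\<^sub>\<infinity>k. norm (c k))"
proof -
  have "norm (fser c x) \<le> (\<Sum>\<^sub>\<infinity>k. norm (c k * fexp k x))"
    unfolding fser_def by (rule norm_infsum_bound) (use assms in \<open>simp add: norm_mult\<close>)
  thus ?thesis by (simp add: norm_mult)
qed

lemma fser_linear:
  assumes "abs_summable c" "abs_summable d"
  shows "abs_summable (\<lambda>k. a * c k + b * d k)"
    and "fser (\<lambda>k. a * c k + b * d k) x = a * fser c x + b * fser d x"
proof -
  show s: "abs_summable (\<lambda>k. a * c k + b * d k)"
  proof (rule summable_on_comparison_test)
    show "(\<lambda>k. norm a * norm (c k) + norm b * norm (d k)) summable_on UNIV"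
      by (intro summable_on_add summable_on_cmult_right assms)
    show "norm (a * c k + b * d k) \<le> norm a * norm (c k) + norm b * norm (d k)" for k
      by (metis norm_mult norm_triangle_ineq)
  qed auto
  have "((\<lambda>k. a * (c k * fexp k x) + b * (d k * fexp k x)) has_sum (a * fser c x + b * fser d x)) UNIV"
    by (intro has_sum_add has_sum_cmult_right fser_has_sum assms)
  moreover have "(\<lambda>k. a * (c k * fexp k x) + b * (d k * fexp k x)) = (\<lambda>k. (a * c k + b * d k) * fexp k x)"
    by (simp add: algebra_simps)
  ultimately show "fser (\<lambda>k. a * c k + b * d k) x = a * fser c x + b * fser d x"
    unfolding fser_def by (simp add: infsumI)
qed

lemma fser_diff:
  assumes "abs_summable c" "abs_summable d"
  shows "abs_summable (\<lambda>k. c k - d k)"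
    and "fser (\<lambda>k. c k - d k) x = fser c x - fser d x"
  using fser_linear[OF assms, of 1 "-1"] by simp_all

text \<open>Uniform convergence permits termwise integration. The weight \<open>G\<close> is kept
  general: an exponential gives the coefficients, the conjugate series gives Parseval, the constant
  1 gives termwise differentiation, and \<open>u\<close> times an exponential gives the convolution
  formula.\<close>

lemma integral_fser:
  assumes c: "abs_summable c" and G: "continuous_on UNIV G"
  shows "((\<lambda>k. c k * integral {a..b} (\<lambda>x. G x * fexp k x)) has_sum
           integral {a..b} (\<lambda>x. G x * fser c x)) UNIV"
proof -
  obtain B where B: "\<And>x. x \<in> {a..b} \<Longrightarrow> norm (G x) \<le> B"
    using compact_imp_bounded[OF compact_continuous_image[OF continuous_on_subset[OF G] compact_Icc]]
    unfolding bounded_iff by (metis imageI subset_UNIV)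
  have u: "uniform_limit {a..b} (\<lambda>X x. \<Sum>k\<in>X. c k * (G x * fexp k x)) (\<lambda>x. G x * fser c x) (finite_subsets_at_top UNIV)"
  proof (rule Weierstrass_m_test_general')
    show "norm (c k * (G x * fexp k x)) \<le> norm (c k) * B" if "x \<in> {a..b}" for k x
      using B[OF that] by (simp add: norm_mult mult_left_mono)
    show "((\<lambda>k. c k * (G x * fexp k x)) has_sum G x * fser c x) UNIV" for x
      using has_sum_cmult_right[OF fser_has_sum[OF c, of x], of "G x"] by (simp add: algebra_simps)
    show "(\<lambda>k. norm (c k) * B) summable_on UNIV" by (intro summable_on_cmult_left c)
  qed
  obtain I J where I: "\<And>X. ((\<lambda>x. \<Sum>k\<in>X. c k * (G x * fexp k x)) has_integral I X) {a..b}"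
    and J: "((\<lambda>x. G x * fser c x) has_integral J) {a..b}" and lim: "(I \<longlongrightarrow> J) (finite_subsets_at_top UNIV)"
  proof (rule uniform_limit_integral[OF u])
    show "continuous_on {a..b} (\<lambda>x. \<Sum>k\<in>X. c k * (G x * fexp k x))" for X :: "int set"
      by (intro continuous_intros continuous_on_subset[OF G]) auto
  qed auto
  have "I X = (\<Sum>k\<in>X. c k * integral {a..b} (\<lambda>x. G x * fexp k x))" if "finite X" for X
  proof -
    have "((\<lambda>x. \<Sum>k\<in>X. c k * (G x * fexp k x)) has_integral (\<Sum>k\<in>X. c k * integral {a..b} (\<lambda>x. G x * fexp k x))) {a..b}"
      by (intro has_integral_sum that has_integral_mult_right integrable_integral integrable_cont continuous_intros G)
    with I show ?thesis using has_integral_unique by blast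
  qed
  hence "eventually (\<lambda>X. I X = (\<Sum>k\<in>X. c k * integral {a..b} (\<lambda>x. G x * fexp k x))) (finite_subsets_at_top UNIV)"
    by (intro eventually_finite_subsets_at_top_weakI) auto
  from Lim_transform_eventually[OF lim this] have "((\<lambda>k. c k * integral {a..b} (\<lambda>x. G x * fexp k x)) has_sum J) UNIV"
    by (simp add: has_sum_def)
  with J show ?thesis by (simp add: integral_unique)
qed

lemma integral_fexp_mult: "integral {0..1} (\<lambda>x. fexp k x * fexp l x) = (if l = - k then 1 else 0)"
proof -
  have "(\<lambda>x. fexp k x * fexp l x) = fexp (k + l)" by (simp add: fexp_add fun_eq_iff)
  thus ?thesis using integral_fexp[of "k + l"] by (simp add: eq_neg_iff_add_eq_0 add.commute)
qed

lemma has_sum_single: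
  fixes f :: "'a \<Rightarrow> 'b::{topological_comm_monoid_add,t2_space}"
  assumes "\<And>k. k \<noteq> m \<Longrightarrow> f k = 0"
  shows "(f has_sum f m) UNIV"
  using has_sum_finite_neutralI[of "{m}" UNIV f "f m"] assms by auto

lemma fint_fser:
  assumes "abs_summable c"
  shows "fint (fser c) k = c k"
proof -
  have "((\<lambda>l. c l * integral {0..1} (\<lambda>x. fexp (- k) x * fexp l x)) has_sum
           integral {0..1} (\<lambda>x. fexp (- k) x * fser c x)) UNIV"
    by (intro integral_fser assms continuous_intros)
  moreover have "((\<lambda>l. c l * integral {0..1} (\<lambda>x. fexp (- k) x * fexp l x)) has_sum
      (c k * integral {0..1} (\<lambda>x. fexp (- k) x * fexp k x))) UNIV"
    by (rule has_sum_single) (auto simp: integral_fexp_mult)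
  ultimately show ?thesis
    unfolding fint_def by (simp add: has_sum_unique[of _ _ _ "c k"] integral_fexp_mult mult.commute)
qed

text \<open>The series and \<open>f\<close> are continuous functions with the same coefficients, so
  completeness identifies them.\<close>

lemma fser_fint:
  assumes cont: "continuous_on UNIV f" and per: "\<And>x. f (x + 1) = f x"
    and summ: "abs_summable (fint f)"
  shows "fser (fint f) x = f x"
proof -
  have cf: "continuous_on UNIV (fser (fint f))" by (rule continuous_on_fser[OF summ])
  have "fser (fint f) x - f x = 0"
  proof (rule fint_eq_0_imp_eq_0[where f = "\<lambda>x. fser (fint f) x - f x"])
    show "fint (\<lambda>x. fser (fint f) x - f x) k = 0" for k
    proof -
      have "fint (\<lambda>x. fser (fint f) x - f x) k = fint (fser (fint f)) k - fint f k"
        unfolding fint_def left_diff_distrib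
        by (intro integral_diff integrable_cont continuous_intros cont)
           (auto simp: fint_def[symmetric] intro: cf)
      thus ?thesis using fint_fser[OF summ] by simp
    qed
  qed (use per fser_periodic cont cf in \<open>auto intro!: continuous_intros\<close>)
  thus ?thesis by simp
qed

lemma fser_cnj: 
  shows "cnj (fser c x) = fser (\<lambda>k. cnj (c (- k))) x"
proof -
  have "cnj (fser c x) = (\<Sum>\<^sub>\<infinity>k. cnj (c k) * fexp (- k) x)"
    unfolding fser_def infsum_cnj[symmetric] by (simp add: fexp_cnj)
  also have "\<dots> = fser (\<lambda>k. cnj (c (- k))) x"
    unfolding fser_def
    by (rule infsum_reindex_bij_witness[of _ uminus uminus]) auto
  finally show ?thesis .
qed

text \<open>The series is integrated termwise against its own conjugate; the integrals that arise
  are the conjugate coefficients.\<close>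

lemma fser_Parseval:
  assumes c: "abs_summable c"
  shows "((\<lambda>k. (norm (c k))\<^sup>2) has_sum integral {0..1} (\<lambda>x. (norm (fser c x))\<^sup>2)) UNIV"
proof -
  have cf: "continuous_on UNIV (fser c)" by (rule continuous_on_fser[OF c])
  have "((\<lambda>k. c k * integral {0..1} (\<lambda>x. cnj (fser c x) * fexp k x)) has_sum
           integral {0..1} (\<lambda>x. cnj (fser c x) * fser c x)) UNIV"
    by (intro integral_fser c continuous_intros cf)
  moreover have "integral {0..1} (\<lambda>x. cnj (fser c x) * fexp k x) = cnj (c k)" for k
  proof -
    have "(\<lambda>x. cnj (fser c x) * fexp k x) = (\<lambda>x. cnj (fser c x * fexp (- k) x))"
      by (simp add: fexp_cnj)
    hence "integral {0..1} (\<lambda>x. cnj (fser c x) * fexp k x) = cnj (fint (fser c) k)"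
      unfolding fint_def by (simp add: integral_cnj)
    thus ?thesis using fint_fser[OF c] by simp
  qed
  moreover have "integral {0..1} (\<lambda>x. cnj (fser c x) * fser c x) = of_real (integral {0..1} (\<lambda>x. (norm (fser c x))\<^sup>2))"
  proof -
    have "((\<lambda>x. complex_of_real ((norm (fser c x))\<^sup>2)) has_integral of_real (integral {0..1} (\<lambda>x. (norm (fser c x))\<^sup>2))) {0..1}"
      by (intro has_integral_of_real integrable_integral integrable_cont continuous_intros cf)
    moreover have "(\<lambda>x. complex_of_real ((norm (fser c x))\<^sup>2)) = (\<lambda>x. cnj (fser c x) * fser c x)"
      by (simp add: complex_norm_square mult.commute del: of_real_power)
    ultimately show ?thesis by (simp add: integral_unique)
  qed
  moreover have "c k * cnj (c k) = of_real ((norm (c k))\<^sup>2)" for k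
    by (simp add: complex_norm_square del: of_real_power)
  ultimately show ?thesis by (simp add: has_sum_of_real_iff del: of_real_power)
qed

lemma abs_summable_deriv:
  assumes "abs_summable (\<lambda>k. of_int k * c k)"
  shows "abs_summable c" and "abs_summable (\<lambda>k. 2 * pi * \<i> * of_int k * c k)"
proof -
  \<comment> \<open>Frequency 0 is invisible in \<open>of_int k * c k\<close>, so it is left out
    here and reinserted below.\<close>
  have "(\<lambda>k. norm (of_int k * c k)) summable_on (UNIV - {0})"
    by (rule summable_on_subset_banach[OF assms]) auto
  hence "(\<lambda>k. norm (c k)) summable_on (UNIV - {0})"
  proof (rule summable_on_comparison_test)
    show "norm (c k) \<le> norm (of_int k * c k)" if "k \<in> UNIV - {0}" for k
    proof -
      have "1 \<le> \<bar>real_of_int k\<bar>" using that by (cases "k > 0") auto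
      hence "1 * norm (c k) \<le> \<bar>real_of_int k\<bar> * norm (c k)" by (intro mult_right_mono) auto
      thus ?thesis by (simp add: norm_mult)
    qed
  qed auto
  hence "(\<lambda>k. norm (c k)) summable_on (insert 0 (UNIV - {0}))"
    by (subst summable_on_insert_iff) auto
  moreover have "insert 0 (UNIV - {0}) = (UNIV :: int set)" by auto
  ultimately show "abs_summable c" by simp
  show "abs_summable (\<lambda>k. 2 * pi * \<i> * of_int k * c k)"
    using summable_on_cmult_right[OF assms, of "2 * pi"] by (simp add: norm_mult mult.assoc)
qed

text \<open>The derived series is integrated termwise, and the fundamental theorem is applied to its
  integral. The integral starts at \<open>x - 1\<close>, so that \<open>x\<close> is an interior
  point and the derivative two-sided.\<close>

lemma has_vector_derivative_fser:
  assumes c: "abs_summable (\<lambda>k. of_int k * c k)"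
  shows "(fser c has_vector_derivative fser (\<lambda>k. 2 * pi * \<i> * of_int k * c k) x) (at x)"
proof -
  define d where "d = (\<lambda>k::int. 2 * pi * \<i> * of_int k * c k)"
  have c0: "abs_summable c" and d: "abs_summable d" unfolding d_def
    by (rule abs_summable_deriv[OF c])+
  have cd: "continuous_on S (fser d)" for S by (rule continuous_on_fser[OF d])
  have *: "integral {x - 1..y} (fser d) = fser c y - fser c (x - 1)" if "y \<ge> x - 1" for y
  proof -
    have "((\<lambda>k. d k * integral {x - 1..y} (\<lambda>x. 1 * fexp k x)) has_sum integral {x - 1..y} (\<lambda>x. 1 * fser d x)) UNIV"
      by (intro integral_fser d continuous_intros)
    moreover have "d k * integral {x - 1..y} (fexp k) = c k * fexp k y - c k * fexp k (x - 1)" for k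
    proof -
      have "((\<lambda>x. 2 * pi * \<i> * of_int k * fexp k x) has_integral (fexp k y - fexp k (x - 1))) {x - 1..y}"
        by (intro fundamental_theorem_of_calculus has_vector_derivative_fexp that)
      from integral_unique[OF this] have "2 * pi * \<i> * of_int k * integral {x - 1..y} (fexp k) = fexp k y - fexp k (x - 1)"
        by simp
      hence "c k * (2 * pi * \<i> * of_int k * integral {x - 1..y} (fexp k)) = c k * (fexp k y - fexp k (x - 1))" by simp
      thus ?thesis by (simp add: d_def algebra_simps)
    qed
    moreover have "((\<lambda>k. c k * fexp k y + - (c k * fexp k (x - 1))) has_sum (fser c y + - fser c (x - 1))) UNIV"
      by (intro has_sum_add has_sum_uminusI fser_has_sum c0)
    ultimately show ?thesis by (auto dest: has_sum_unique)
  qed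
  have "((\<lambda>y. integral {x - 1..y} (fser d)) has_vector_derivative fser d x) (at x within {x - 1..x + 1})"
    by (rule integral_has_vector_derivative) (auto intro: cd)
  hence "((\<lambda>y. fser c (x - 1) + integral {x - 1..y} (fser d)) has_vector_derivative fser d x) (at x within {x - 1..x + 1})"
    by (auto intro!: derivative_eq_intros)
  hence "(fser c has_vector_derivative fser d x) (at x within {x - 1..x + 1})"
    by (rule has_vector_derivative_transform[rotated 2]) (auto simp: *)
  thus ?thesis unfolding d_def[symmetric]
    by (simp add: at_within_Icc_at)
qed

section \<open>Series with time-dependent coefficients\<close>

lemma tendsto_0_bound_within:
  fixes f :: "'a::topological_space \<Rightarrow> 'b::real_normed_vector"
  assumes "(g \<longlongrightarrow> 0) (at t within I)" "\<And>r. r \<in> I \<Longrightarrow> norm (f r) \<le> g r"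
  shows "(f \<longlongrightarrow> 0) (at t within I)"
  by (rule Lim_null_comparison[OF _ assms(1)]) (use assms(2) in \<open>auto simp: eventually_at_filter\<close>)

text \<open>Convergence of the coefficients in l1 makes the series converge uniformly in
  \<open>x\<close>; continuity in \<open>t\<close> and continuity in \<open>x\<close> then combine
  to joint continuity.\<close>

lemma continuous_on_fser_param:
  fixes c :: "real \<Rightarrow> int \<Rightarrow> complex"
  assumes s: "\<And>t. t \<in> I \<Longrightarrow> abs_summable (c t)"
    and lim: "\<And>t. t \<in> I \<Longrightarrow> ((\<lambda>r. \<Sum>\<^sub>\<infinity>k. norm (c r k - c t k)) \<longlongrightarrow> 0) (at t within I)"
  shows "continuous_on (I \<times> UNIV) (\<lambda>(t, x). fser (c t) x)"
  unfolding continuous_on_def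
proof safe
  fix t x :: real assume t: "t \<in> I"
  define e where "e = (\<lambda>r. \<Sum>\<^sub>\<infinity>k. norm (c r k - c t k))"
  have e0: "e t = 0" by (simp add: e_def)
  have le: "(e \<longlongrightarrow> e t) (at t within I)" using lim[OF t] by (simp add: e0 e_def)
  have 1: "((\<lambda>p. e (fst p)) \<longlongrightarrow> 0) (at (t, x) within I \<times> UNIV)"
  proof -
    have "continuous (at t within I) e" using le by (simp add: continuous_within)
    moreover have "continuous (at (t, x) within I \<times> UNIV) fst" by (intro continuous_intros)
    moreover have "fst ` (I \<times> (UNIV::real set)) = I" by auto
    ultimately have "continuous (at (t, x) within I \<times> UNIV) (e \<circ> fst)"
      by (intro continuous_within_compose) auto
    thus ?thesis by (simp add: continuous_within e0 o_def)
  qed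
  have 2: "((\<lambda>p. fser (c t) (snd p)) \<longlongrightarrow> fser (c t) x) (at (t, x) within I \<times> UNIV)"
  proof -
    have "isCont (fser (c t)) x" using continuous_on_fser[OF s[OF t], of UNIV] by (simp add: continuous_on_eq_continuous_at)
    moreover have "((\<lambda>p. snd p) \<longlongrightarrow> x) (at (t, x) within I \<times> UNIV)"
      using tendsto_snd[OF tendsto_ident_at, of "(t, x)" "I \<times> UNIV"] by simp
    ultimately show ?thesis by (rule isCont_tendsto_compose)
  qed
  have 3: "((\<lambda>p. fser (c (fst p)) (snd p) - fser (c t) (snd p)) \<longlongrightarrow> 0) (at (t, x) within I \<times> UNIV)"
  proof (rule tendsto_0_bound_within[OF 1])
    show "norm (fser (c (fst p)) (snd p) - fser (c t) (snd p)) \<le> e (fst p)" if "p \<in> I \<times> UNIV" for p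
      using norm_fser_le[OF fser_diff(1)[OF s s[OF t]], of "fst p" "snd p"] fser_diff(2)[OF s s[OF t], of "fst p" "snd p"] that
      by (auto simp: e_def)
  qed
  from tendsto_add[OF 3 2]
  show "((\<lambda>(t, x). fser (c t) x) \<longlongrightarrow> fser (c t) x) (at (t, x) within I \<times> UNIV)"
    unfolding case_prod_beta by simp
qed

lemma has_vector_derivative_difference_quotient:
  fixes f :: "real \<Rightarrow> complex"
  assumes "((\<lambda>r. (f r - f t) / of_real (r - t) - D) \<longlongrightarrow> 0) (at t within I)"
  shows "(f has_vector_derivative D) (at t within I)"
proof -
  have lim': "((\<lambda>r. (f r - f t) /\<^sub>R (r - t) - D) \<longlongrightarrow> 0) (at t within I)"
    using assms by (simp add: divide_inverse scaleR_conv_of_real mult.commute)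
  have "((\<lambda>r. norm (f r - f t - (r - t) *\<^sub>R D) / norm (r - t)) \<longlongrightarrow> 0) (at t within I)"
  proof (rule Lim_transform_eventually[OF tendsto_norm_zero[OF lim']])
    have "norm ((f r - f t) /\<^sub>R (r - t) - D) = norm (f r - f t - (r - t) *\<^sub>R D) / norm (r - t)"
      if "r \<noteq> t" for r
    proof -
      have "(f r - f t) /\<^sub>R (r - t) - D = (f r - f t - (r - t) *\<^sub>R D) /\<^sub>R (r - t)"
        using that by (simp add: scaleR_diff_right)
      thus ?thesis by (simp add: divide_inverse mult.commute)
    qed
    thus "\<forall>\<^sub>F r in at t within I. norm ((f r - f t) /\<^sub>R (r - t) - D) = norm (f r - f t - (r - t) *\<^sub>R D) / norm (r - t)"
      by (auto simp: eventually_at_filter)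
  qed
  thus ?thesis
    unfolding has_vector_derivative_def has_derivative_iff_norm
    by (simp add: bounded_linear_scaleR_left)
qed

text \<open>The l1 norm of the coefficients dominates the series at every \<open>x\<close>, so
  convergence of the difference quotients in that norm is enough.\<close>

lemma has_vector_derivative_fser_param:
  fixes c :: "real \<Rightarrow> int \<Rightarrow> complex"
  assumes s: "\<And>t. t \<in> I \<Longrightarrow> abs_summable (c t)" and d: "abs_summable d" and t: "t \<in> I"
    and lim: "((\<lambda>r. \<Sum>\<^sub>\<infinity>k. norm ((c r k - c t k) / of_real (r - t) - d k)) \<longlongrightarrow> 0) (at t within I)"
  shows "((\<lambda>r. fser (c r) x) has_vector_derivative fser d x) (at t within I)"
proof -
  have "((\<lambda>r. (fser (c r) x - fser (c t) x) / of_real (r - t) - fser d x) \<longlongrightarrow> 0) (at t within I)"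
  proof (rule tendsto_0_bound_within[OF lim])
    show "norm ((fser (c r) x - fser (c t) x) / of_real (r - t) - fser d x) \<le> (\<Sum>\<^sub>\<infinity>k. norm ((c r k - c t k) / of_real (r - t) - d k))"
      if r: "r \<in> I" for r
    proof -
      have 1: "abs_summable (\<lambda>k. c r k - c t k)" "fser (\<lambda>k. c r k - c t k) x = fser (c r) x - fser (c t) x"
        using fser_diff[OF s[OF r] s[OF t]] by auto
      have 2: "abs_summable (\<lambda>k. inverse (of_real (r - t)) * (c r k - c t k) + (-1) * d k)"
        "fser (\<lambda>k. inverse (of_real (r - t)) * (c r k - c t k) + (-1) * d k) x = inverse (of_real (r - t)) * (fser (c r) x - fser (c t) x) + (-1) * fser d x"
        using fser_linear[OF 1(1) d] unfolding 1(2)[symmetric] by blast+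
      show ?thesis using norm_fser_le[OF 2(1), of x] 2(2) by (simp add: divide_inverse mult.commute)
    qed
  qed
  thus ?thesis by (rule has_vector_derivative_difference_quotient)
qed

section \<open>Sobolev spaces\<close>

definition bessel_weight :: "int \<Rightarrow> real" where
  "bessel_weight k = 1 + (2 * pi * of_int k)\<^sup>2"

lemma bessel_weight_ge_1: "1 \<le> bessel_weight k"
  by (simp add: bessel_weight_def)

lemma bessel_weight_pos [simp]: "0 < bessel_weight k" 
  by (simp add: bessel_weight_def add_pos_nonneg)

lemma bessel_weight_ge: "(of_int k)\<^sup>2 \<le> bessel_weight k"
proof -
  have "1 \<le> (2 * pi)\<^sup>2" using pi_ge_two by (intro one_le_power) auto
  hence "1 * (of_int k)\<^sup>2 \<le> (2 * pi)\<^sup>2 * (of_int k :: real)\<^sup>2" by (intro mult_right_mono) auto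
  thus ?thesis by (simp add: bessel_weight_def power_mult_distrib)
qed

lemma bessel_weight_summable: "(\<lambda>k. 1 / bessel_weight k) summable_on UNIV"
proof -
  have nat: "(\<lambda>n::nat. 1 / bessel_weight (int n)) summable_on UNIV"
  proof (rule summable_nonneg_imp_summable_on)
    show "summable (\<lambda>n. 1 / bessel_weight (int n))"
    proof (rule summable_comparison_test_ev)
      show "\<forall>\<^sub>F n in sequentially. norm (1 / bessel_weight (int n)) \<le> 1 / (real n)\<^sup>2"
        using eventually_gt_at_top[of 0]
      proof eventually_elim
        case (elim n)
        have "norm (1 / bessel_weight (int n)) = 1 / bessel_weight (int n)"
          using less_imp_le[OF bessel_weight_pos[of "int n"]] by simp
        also have "\<dots> \<le> 1 / (real n)\<^sup>2"
          using bessel_weight_ge[of "int n"] elim by (intro divide_left_mono mult_pos_pos) auto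
        finally show ?case .
      qed
      show "summable (\<lambda>n. 1 / (real n)\<^sup>2)"
        using inverse_power_summable[of 2, where ?'a = real] by (simp add: inverse_eq_divide)
    qed
  qed (simp add: less_imp_le)
  have "(\<lambda>k. 1 / bessel_weight k) summable_on range int"
    using nat by (subst summable_on_reindex) (auto simp: o_def)
  moreover have "(\<lambda>k. 1 / bessel_weight k) summable_on range (\<lambda>n. - int n)"
    using nat by (subst summable_on_reindex) (auto simp: o_def inj_on_def bessel_weight_def)
  ultimately have "(\<lambda>k. 1 / bessel_weight k) summable_on (range int \<union> range (\<lambda>n. - int n))"
    by (rule summable_on_union)
  moreover have "range int \<union> range (\<lambda>n. - int n) = UNIV"
    by (auto, metis int_cases2 rangeI)
  ultimately show ?thesis by simp
qed

text \<open>The constant of the embedding of \<open>H^1\<close> into the absolutely convergent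
  series: the l2 norm of \<open>bessel_weight k powr (- 1 / 2)\<close>.\<close>

definition sob_const :: real where
  "sob_const = sqrt (\<Sum>\<^sub>\<infinity>k. 1 / bessel_weight k)"

lemma sob_const_nonneg: "0 \<le> sob_const"
  unfolding sob_const_def by (intro real_sqrt_ge_zero infsum_nonneg) (simp add: less_imp_le)

lemma sobolev_iff:
  "f \<in> sobolev s \<longleftrightarrow> periodic1 f \<and> f \<in> borel_measurable lborel \<and>
     set_integrable lborel {0..1} (\<lambda>x. (f x)\<^sup>2) \<and>
     (\<lambda>k. bessel_weight k powr s * (cmod (fourier_coeff f k))\<^sup>2) summable_on UNIV"
  by (simp add: sobolev_def bessel_weight_def)

lemma sobolev_norm_eq:
  "sobolev_norm s f = sqrt (\<Sum>\<^sub>\<infinity>k. bessel_weight k powr s * (cmod (fourier_coeff f k))\<^sup>2)"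
  by (simp add: sobolev_norm_def bessel_weight_def)

lemma sobolev_mono:
  assumes "f \<in> sobolev s" "r \<le> s"
  shows "f \<in> sobolev r" "sobolev_norm r f \<le> sobolev_norm s f"
proof -
  have le: "bessel_weight k powr r * (cmod (fourier_coeff f k))\<^sup>2 \<le> bessel_weight k powr s * (cmod (fourier_coeff f k))\<^sup>2" for k
    by (intro mult_right_mono powr_mono assms bessel_weight_ge_1) auto
  have s: "(\<lambda>k. bessel_weight k powr s * (cmod (fourier_coeff f k))\<^sup>2) summable_on UNIV"
    using assms by (simp add: sobolev_iff)
  have r: "(\<lambda>k. bessel_weight k powr r * (cmod (fourier_coeff f k))\<^sup>2) summable_on UNIV"
    by (rule summable_on_comparison_test[OF s]) (use le in auto)
  show "f \<in> sobolev r" using assms r by (simp add: sobolev_iff)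
  show "sobolev_norm r f \<le> sobolev_norm s f"
    unfolding sobolev_norm_eq by (intro real_sqrt_le_mono infsum_mono r s le)
qed

text \<open>Cauchy-Schwarz against the square-summable sequence
  \<open>1 / sqrt (bessel_weight k)\<close>: the passage from l2 to l1 is paid for with one
  derivative. The cases \<open>s = 1\<close> and \<open>s = 2\<close> give absolute convergence of
  the series of a function and of its derivative.\<close>

lemma sobolev_l1:
  assumes "f \<in> sobolev s"
  shows "(\<lambda>k. bessel_weight k powr ((s - 1) / 2) * cmod (fourier_coeff f k)) summable_on UNIV"
    and "(\<Sum>\<^sub>\<infinity>k. bessel_weight k powr ((s - 1) / 2) * cmod (fourier_coeff f k)) \<le> sob_const * sobolev_norm s f"
proof -
  define p where "p = (\<lambda>k. 1 / sqrt (bessel_weight k))"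
  define q where "q = (\<lambda>k. bessel_weight k powr (s / 2) * cmod (fourier_coeff f k))"
  have p2: "(p k)\<^sup>2 = 1 / bessel_weight k" for k
    by (simp add: p_def power_divide less_imp_le)
  have q2: "(q k)\<^sup>2 = bessel_weight k powr s * (cmod (fourier_coeff f k))\<^sup>2" for k
  proof -
    have "(bessel_weight k powr (s / 2))\<^sup>2 = bessel_weight k powr s"
      by (simp add: power2_eq_square powr_add[symmetric])
    thus ?thesis by (simp add: q_def power_mult_distrib)
  qed
  have pq: "\<bar>p k * q k\<bar> = bessel_weight k powr ((s - 1) / 2) * cmod (fourier_coeff f k)" for k
  proof -
    have "p k * q k = (bessel_weight k powr (s / 2) / bessel_weight k powr (1 / 2)) * cmod (fourier_coeff f k)"
      by (simp add: p_def q_def powr_half_sqrt less_imp_le)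
    also have "bessel_weight k powr (s / 2) / bessel_weight k powr (1 / 2) = bessel_weight k powr ((s - 1) / 2)"
      by (simp add: powr_diff[symmetric] diff_divide_distrib)
    finally show ?thesis by simp
  qed
  have ps: "(\<lambda>k. (p k)\<^sup>2) summable_on UNIV" unfolding p2 by (rule bessel_weight_summable)
  have qs: "(\<lambda>k. (q k)\<^sup>2) summable_on UNIV" unfolding q2 using assms by (simp add: sobolev_iff)
  show "(\<lambda>k. bessel_weight k powr ((s - 1) / 2) * cmod (fourier_coeff f k)) summable_on UNIV"
    using l2_Cauchy_Schwarz(1)[OF ps qs] unfolding pq .
  show "(\<Sum>\<^sub>\<infinity>k. bessel_weight k powr ((s - 1) / 2) * cmod (fourier_coeff f k)) \<le> sob_const * sobolev_norm s f"
    using l2_Cauchy_Schwarz(2)[OF ps qs] unfolding pq unfolding p2 q2 sob_const_def sobolev_norm_eq .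
qed

lemma sobolev_1_l1:
  assumes "f \<in> sobolev 1"
  shows "abs_summable (fourier_coeff f)"
    and "(\<Sum>\<^sub>\<infinity>k. cmod (fourier_coeff f k)) \<le> sob_const * sobolev_norm 1 f"
  using sobolev_l1[OF assms] by (simp_all add: less_imp_neq[OF bessel_weight_pos, symmetric])

lemma sobolev_2_l1:
  assumes "f \<in> sobolev 2"
  shows "abs_summable (\<lambda>k. of_int k * fourier_coeff f k)"
    and "(\<Sum>\<^sub>\<infinity>k. cmod (of_int k * fourier_coeff f k)) \<le> sob_const * sobolev_norm 2 f"
proof -
  have le: "cmod (of_int k * fourier_coeff f k) \<le> bessel_weight k powr ((2 - 1) / 2) * cmod (fourier_coeff f k)" for k
  proof -
    have "\<bar>real_of_int k\<bar> \<le> sqrt (bessel_weight k)"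
      using bessel_weight_ge[of k] by (intro real_le_rsqrt) auto
    hence "\<bar>real_of_int k\<bar> * cmod (fourier_coeff f k) \<le> sqrt (bessel_weight k) * cmod (fourier_coeff f k)"
      by (intro mult_right_mono) auto
    thus ?thesis by (simp add: norm_mult powr_half_sqrt less_imp_le)
  qed
  show s: "abs_summable (\<lambda>k. of_int k * fourier_coeff f k)"
    by (rule summable_on_comparison_test[OF sobolev_l1(1)[OF assms]]) (use le in auto)
  have "(\<Sum>\<^sub>\<infinity>k. cmod (of_int k * fourier_coeff f k)) \<le> (\<Sum>\<^sub>\<infinity>k. bessel_weight k powr ((2 - 1) / 2) * cmod (fourier_coeff f k))"
    by (intro infsum_mono s sobolev_l1[OF assms] le)
  with sobolev_l1(2)[OF assms] show "(\<Sum>\<^sub>\<infinity>k. cmod (of_int k * fourier_coeff f k)) \<le> sob_const * sobolev_norm 2 f"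
    by linarith
qed

section \<open>Linear structure, Fourier inversion and classical derivatives\<close>

lemma set_integrable_bounded_mult:
  fixes f :: "real \<Rightarrow> real" and g :: "real \<Rightarrow> 'a::{banach, second_countable_topology}"
  assumes f: "set_integrable lborel S f" and g: "g \<in> borel_measurable lborel" "\<And>x. norm (g x) \<le> B"
  shows "set_integrable lborel S (\<lambda>x. f x *\<^sub>R g x)"
proof -
  have "integrable lborel (\<lambda>x. (indicator S x *\<^sub>R f x) *\<^sub>R g x)"
  proof (rule Bochner_Integration.integrable_bound)
    show "integrable lborel (\<lambda>x. B * (indicator S x *\<^sub>R f x))"
      using f unfolding set_integrable_def by (rule integrable_mult_right)
    have "(\<lambda>x. indicator S x *\<^sub>R f x) \<in> borel_measurable lborel"
      using f unfolding set_integrable_def by (rule borel_measurable_integrable)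
    thus "(\<lambda>x. (indicator S x *\<^sub>R f x) *\<^sub>R g x) \<in> borel_measurable lborel"
      using g(1) by (rule borel_measurable_scaleR)
    have "norm ((indicator S x *\<^sub>R f x) *\<^sub>R g x) \<le> norm (B * (indicator S x *\<^sub>R f x))" for x
      using mult_left_mono[OF order_trans[OF g(2) abs_ge_self[of B]], of "\<bar>indicator S x *\<^sub>R f x\<bar>" x]
      by (simp add: abs_mult mult.commute)
    thus "AE x in lborel. norm ((indicator S x *\<^sub>R f x) *\<^sub>R g x) \<le> norm (B * (indicator S x *\<^sub>R f x))" by simp
  qed
  thus ?thesis by (simp add: set_integrable_def)
qed

lemma sobolev_integrable:
  assumes "f \<in> sobolev s"
  shows "set_integrable lborel {0..1} f"
proof -
  have m: "f \<in> borel_measurable lborel" and i: "set_integrable lborel {0..1} (\<lambda>x. (f x)\<^sup>2)"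
    using assms by (auto simp: sobolev_def)
  have i2: "set_integrable lborel {0..1::real} (\<lambda>x. 1 + (f x)\<^sup>2)"
    by (intro set_integral_add i) (auto simp: set_integrable_def)
  have "integrable lborel (\<lambda>x. indicator {0..1::real} x *\<^sub>R f x)"
  proof (rule Bochner_Integration.integrable_bound[OF i2[unfolded set_integrable_def]])
    show "(\<lambda>x. indicator {0..1} x *\<^sub>R f x) \<in> borel_measurable lborel" using m by measurable
    have "\<bar>f x\<bar> \<le> 1 + (f x)\<^sup>2" for x
    proof -
      have "0 \<le> (\<bar>f x\<bar> - 1)\<^sup>2" "0 \<le> (f x)\<^sup>2" by auto
      thus ?thesis unfolding power2_diff by simp
    qed
    thus "AE x in lborel. norm (indicator {0..1} x *\<^sub>R f x) \<le> norm (indicator {0..1} x *\<^sub>R (1 + (f x)\<^sup>2))"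
      by (auto simp: indicator_def intro: order_trans)
  qed
  thus ?thesis by (simp add: set_integrable_def)
qed

lemma fourier_integrable:
  assumes "set_integrable lborel {0..1} f"
  shows "set_integrable lborel {0..1} (\<lambda>x. cis (- 2 * pi * of_int k * x) * complex_of_real (f x))"
proof -
  have "set_integrable lborel {0..1} (\<lambda>x. f x *\<^sub>R cis (- 2 * pi * of_int k * x))"
  proof (rule set_integrable_bounded_mult[OF assms])
    have "continuous_on UNIV (\<lambda>x. cis (- 2 * pi * of_int k * x))"
      unfolding cis_conv_exp by (intro continuous_intros)
    thus "(\<lambda>x. cis (- 2 * pi * of_int k * x)) \<in> borel_measurable lborel"
      by (simp add: borel_measurable_continuous_onI)
  qed auto
  thus ?thesis by (simp add: scaleR_conv_of_real mult.commute)
qed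

lemma fourier_coeff_linear:
  assumes "set_integrable lborel {0..1} f" "set_integrable lborel {0..1} g"
  shows "fourier_coeff (\<lambda>x. a * f x + b * g x) k = of_real a * fourier_coeff f k + of_real b * fourier_coeff g k"
proof -
  let ?c = "\<lambda>x. cis (- 2 * pi * of_int k * x)"
  have 1: "(\<lambda>x. ?c x * complex_of_real (a * f x + b * g x)) = (\<lambda>x. of_real a * (?c x * of_real (f x)) + of_real b * (?c x * of_real (g x)))"
    by (simp add: algebra_simps)
  have "(LBINT x:{0..1}. of_real a * (?c x * of_real (f x)) + of_real b * (?c x * of_real (g x))) =
    (LBINT x:{0..1}. of_real a * (?c x * of_real (f x))) + (LBINT x:{0..1}. of_real b * (?c x * of_real (g x)))"
    by (intro set_integral_add set_integrable_mult_right fourier_integrable assms)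
  thus ?thesis unfolding fourier_coeff_def 1 by simp
qed

lemma sobolev_linear:
  assumes f: "f \<in> sobolev s" and g: "g \<in> sobolev s"
  shows "(\<lambda>x. a * f x + b * g x) \<in> sobolev s"
proof -
  note i = sobolev_integrable[OF f] sobolev_integrable[OF g]
  have p: "periodic1 f" "periodic1 g" and m: "f \<in> borel_measurable lborel" "g \<in> borel_measurable lborel"
    and q: "set_integrable lborel {0..1} (\<lambda>x. (f x)\<^sup>2)" "set_integrable lborel {0..1} (\<lambda>x. (g x)\<^sup>2)"
    using f g by (auto simp: sobolev_def)
  have sq: "(a * x + b * y)\<^sup>2 \<le> 2 * a\<^sup>2 * x\<^sup>2 + 2 * b\<^sup>2 * y\<^sup>2" for x y :: real
    using zero_le_power2[of "a * x - b * y"] by (simp add: power2_sum power2_diff power_mult_distrib)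
  have dom: "set_integrable lborel {0..1} (\<lambda>x. 2 * a\<^sup>2 * (f x)\<^sup>2 + 2 * b\<^sup>2 * (g x)\<^sup>2)"
    by (intro set_integral_add set_integrable_mult_right q)
  have "integrable lborel (\<lambda>x. indicator {0..1::real} x *\<^sub>R (a * f x + b * g x)\<^sup>2)"
  proof (rule Bochner_Integration.integrable_bound[OF dom[unfolded set_integrable_def]])
    show "(\<lambda>x. indicator {0..1} x *\<^sub>R (a * f x + b * g x)\<^sup>2) \<in> borel_measurable lborel" using m by measurable
    show "AE x in lborel. norm (indicator {0..1} x *\<^sub>R (a * f x + b * g x)\<^sup>2) \<le> norm (indicator {0..1} x *\<^sub>R (2 * a\<^sup>2 * (f x)\<^sup>2 + 2 * b\<^sup>2 * (g x)\<^sup>2))"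
      using sq by (auto simp: indicator_def)
  qed
  moreover have "(\<lambda>k. (sqrt (bessel_weight k powr s) * cmod (fourier_coeff (\<lambda>x. a * f x + b * g x) k))\<^sup>2) summable_on UNIV"
  proof (rule l2_triangle(1))
    have h: "(sqrt (bessel_weight k powr s) * (\<bar>c\<bar> * cmod (fourier_coeff h k)))\<^sup>2 = c\<^sup>2 * (bessel_weight k powr s * (cmod (fourier_coeff h k))\<^sup>2)" for c h k
      by (simp add: power_mult_distrib)
    show "(\<lambda>k. (sqrt (bessel_weight k powr s) * (\<bar>a\<bar> * cmod (fourier_coeff f k)))\<^sup>2) summable_on UNIV"
      unfolding h using f by (intro summable_on_cmult_right) (simp add: sobolev_iff)
    show "(\<lambda>k. (sqrt (bessel_weight k powr s) * (\<bar>b\<bar> * cmod (fourier_coeff g k)))\<^sup>2) summable_on UNIV"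
      unfolding h using g by (intro summable_on_cmult_right) (simp add: sobolev_iff)
    have "cmod (fourier_coeff (\<lambda>x. a * f x + b * g x) k) \<le> \<bar>a\<bar> * cmod (fourier_coeff f k) + \<bar>b\<bar> * cmod (fourier_coeff g k)" for k
      unfolding fourier_coeff_linear[OF i] by (rule order_trans[OF norm_triangle_ineq]) (simp add: norm_mult)
    hence "sqrt (bessel_weight k powr s) * cmod (fourier_coeff (\<lambda>x. a * f x + b * g x) k) \<le> sqrt (bessel_weight k powr s) * (\<bar>a\<bar> * cmod (fourier_coeff f k) + \<bar>b\<bar> * cmod (fourier_coeff g k))" for k
      by (intro mult_left_mono) auto
    thus "\<bar>sqrt (bessel_weight k powr s) * cmod (fourier_coeff (\<lambda>x. a * f x + b * g x) k)\<bar>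
      \<le> \<bar>sqrt (bessel_weight k powr s) * (\<bar>a\<bar> * cmod (fourier_coeff f k))\<bar> + \<bar>sqrt (bessel_weight k powr s) * (\<bar>b\<bar> * cmod (fourier_coeff g k))\<bar>" for k
      by (simp add: abs_mult algebra_simps)
  qed
  ultimately show ?thesis
    using p m by (simp add: sobolev_iff periodic1_def set_integrable_def power_mult_distrib)
qed

lemma sobolev_diff:
  assumes "f \<in> sobolev s" "g \<in> sobolev s"
  shows "(\<lambda>x. f x - g x) \<in> sobolev s"
    and "fourier_coeff (\<lambda>x. f x - g x) k = fourier_coeff f k - fourier_coeff g k"
  using sobolev_linear[OF assms, of 1 "-1"] fourier_coeff_linear[OF assms[THEN sobolev_integrable], of 1 "-1" k] by simp_all

text \<open>Bridge between the Lebesgue integral that defines the coefficients and the gauge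
  integral on which the theory of \<open>fser\<close> is built.\<close>

lemma fourier_coeff_fint:
  assumes "continuous_on UNIV f"
  shows "fourier_coeff f k = fint (\<lambda>x. complex_of_real (f x)) k"
proof -
  have c: "continuous_on {0..1} (\<lambda>x. cis (- 2 * pi * of_int k * x) * complex_of_real (f x))"
    unfolding cis_conv_exp by (intro continuous_intros continuous_on_subset[OF assms]) auto
  show ?thesis unfolding fourier_coeff_def fint_def
    by (subst set_borel_integral_eq_integral(2)[OF borel_integrable_atLeastAtMost'[OF c]])
       (simp add: fexp_def mult.commute)
qed

lemma fser_fourier_coeff:
  assumes "f \<in> sobolev 1" "continuous_on UNIV f"
  shows "fser (fourier_coeff f) x = of_real (f x)"
proof -
  have e: "fourier_coeff f = fint (\<lambda>x. complex_of_real (f x))"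
    using fourier_coeff_fint[OF assms(2)] by auto
  show ?thesis using sobolev_1_l1(1)[OF assms(1)] assms unfolding e
    by (intro fser_fint) (auto intro!: continuous_intros simp: sobolev_def periodic1_def)
qed

lemma fourier_coeff_cnj: "fourier_coeff f (- k) = cnj (fourier_coeff f k)"
proof -
  have "cnj (fourier_coeff f k) = (LBINT x:{0..1}. cnj (cis (- 2 * pi * of_int k * x) * complex_of_real (f x)))"
    unfolding fourier_coeff_def set_lebesgue_integral_def
    by (subst Bochner_Integration.integral_cnj[symmetric]) simp
  thus ?thesis by (simp add: fourier_coeff_def cis_cnj)
qed

lemma continuous_sobolev_2_deriv:
  assumes "f \<in> sobolev 2" "continuous_on UNIV f"
  shows "(f has_real_derivative Re (fser (\<lambda>k. 2 * pi * \<i> * of_int k * fourier_coeff f k) x)) (at x)"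
    and "of_real (deriv f x) = fser (\<lambda>k. 2 * pi * \<i> * of_int k * fourier_coeff f k) x"
    and "\<bar>deriv f x\<bar> \<le> 2 * pi * sob_const * sobolev_norm 2 f"
proof -
  define d where "d = (\<lambda>k. 2 * pi * \<i> * of_int k * fourier_coeff f k)"
  have f1: "f \<in> sobolev 1" using sobolev_mono(1)[OF assms(1)] by simp
  have rep: "fser (fourier_coeff f) = (\<lambda>x. of_real (f x))"
    using fser_fourier_coeff[OF f1 assms(2)] by auto
  have "((\<lambda>x. complex_of_real (f x)) has_vector_derivative fser d x) (at x)"
    using has_vector_derivative_fser[OF sobolev_2_l1(1)[OF assms(1)], of x] by (simp add: rep d_def)
  from bounded_linear.has_vector_derivative[OF bounded_linear_Re this]
    bounded_linear.has_vector_derivative[OF bounded_linear_Im this]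
  have re: "(f has_real_derivative Re (fser d x)) (at x)" and im: "((\<lambda>x. 0) has_real_derivative Im (fser d x)) (at x)"
    by (simp_all add: has_real_derivative_iff_has_vector_derivative)
  from re show "(f has_real_derivative Re (fser (\<lambda>k. 2 * pi * \<i> * of_int k * fourier_coeff f k) x)) (at x)"
    by (simp add: d_def)
  \<comment> \<open>The imaginary part of the represented function is constantly 0, so the derived
    series is real.\<close>
  have "Im (fser d x) = 0" using im DERIV_unique[OF im DERIV_const] by simp
  moreover have de: "deriv f x = Re (fser d x)" using re by (rule DERIV_imp_deriv)
  ultimately show "of_real (deriv f x) = fser (\<lambda>k. 2 * pi * \<i> * of_int k * fourier_coeff f k) x"
    by (simp add: d_def complex_eq_iff)
  have dn: "norm (d k) = 2 * pi * norm (of_int k * fourier_coeff f k)" for k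
    by (simp add: d_def norm_mult)
  have "\<bar>deriv f x\<bar> \<le> norm (fser d x)" unfolding de by (rule abs_Re_le_cmod)
  also have "\<dots> \<le> (\<Sum>\<^sub>\<infinity>k. norm (d k))"
    unfolding d_def by (rule norm_fser_le, rule abs_summable_deriv(2), rule sobolev_2_l1(1), rule assms(1))
  also have "\<dots> = 2 * pi * (\<Sum>\<^sub>\<infinity>k. norm (of_int k * fourier_coeff f k))"
    unfolding dn by (rule infsum_cmult_right')
  also have "\<dots> \<le> 2 * pi * (sob_const * sobolev_norm 2 f)"
    by (intro mult_left_mono sobolev_2_l1 assms) auto
  finally show "\<bar>deriv f x\<bar> \<le> 2 * pi * sob_const * sobolev_norm 2 f" by (simp add: mult.assoc)
qed

section \<open>Distributional derivatives in terms of coefficients\<close>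

lemma smooth_test_trig:
  "smooth_test (\<lambda>x. A * cos (2 * pi * of_int k * x) + B * sin (2 * pi * of_int k * x))"
proof -
  let ?c = "2 * pi * real_of_int k"
  have d: "((\<lambda>x. A * cos (?c * x) + B * sin (?c * x)) has_real_derivative (?c * B) * cos (?c * x) + (- ?c * A) * sin (?c * x)) (at x)" for A B x
    by (auto intro!: derivative_eq_intros simp: algebra_simps)
  \<comment> \<open>The two-parameter family is closed under differentiation, so \<open>A\<close>
    and \<open>B\<close> vary in the induction.\<close>
  have "(deriv ^^ n) (\<lambda>x. A * cos (?c * x) + B * sin (?c * x)) differentiable (at x)" for n x
  proof (induction n arbitrary: A B)
    case 0
    show ?case using d[of A B x] by (auto simp: differentiable_def has_field_derivative_def)
  next
    case (Suc n)
    have "deriv (\<lambda>x. A * cos (?c * x) + B * sin (?c * x)) = (\<lambda>x. (?c * B) * cos (?c * x) + (- ?c * A) * sin (?c * x))"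
      using DERIV_imp_deriv[OF d] by (intro ext)
    thus ?case using Suc[of "?c * B" "- ?c * A"] by (simp only: funpow_Suc_right o_def)
  qed
  moreover have "?c * (x + 1) = ?c * x + ?c" for x by (simp add: algebra_simps)
  ultimately show ?thesis
    by (simp add: smooth_test_def periodic1_def sin_add cos_add cos_int_2pin sin_int_2pin)
qed

text \<open>Test functions are real valued. The complex exponential is therefore split into cosine
  and sine, which are tested separately and reassembled as real and imaginary part.\<close>

lemma distributional_derivative_fourier:
  assumes dd: "distributional_derivative g h"
    and g: "set_integrable lborel {0..1} g" and h: "set_integrable lborel {0..1} h"
  shows "2 * pi * \<i> * of_int k * fourier_coeff g k = fourier_coeff h k"
proof -
  let ?c = "2 * pi * real_of_int k"
  have split: "fourier_coeff f k = of_real (LBINT x:{0..1}. f x * cos (?c * x)) - \<i> * of_real (LBINT x:{0..1}. f x * sin (?c * x))"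
    if f: "set_integrable lborel {0..1} f" for f
  proof -
    have c: "set_integrable lborel {0..1} (\<lambda>x. complex_of_real (f x * cos (?c * x)))"
      using set_integrable_bounded_mult[OF f, of "\<lambda>x. complex_of_real (cos (?c * x))" 1]
      by (auto intro!: borel_measurable_continuous_onI continuous_intros simp: scaleR_conv_of_real)
    have s: "set_integrable lborel {0..1} (\<lambda>x. complex_of_real (f x * sin (?c * x)))"
      using set_integrable_bounded_mult[OF f, of "\<lambda>x. complex_of_real (sin (?c * x))" 1]
      by (auto intro!: borel_measurable_continuous_onI continuous_intros simp: scaleR_conv_of_real)
    have "(\<lambda>x. cis (- 2 * pi * of_int k * x) * complex_of_real (f x)) = (\<lambda>x. of_real (f x * cos (?c * x)) - \<i> * of_real (f x * sin (?c * x)))"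
      by (auto simp: complex_eq_iff)
    hence "fourier_coeff f k = (LBINT x:{0..1}. of_real (f x * cos (?c * x)) - \<i> * of_real (f x * sin (?c * x)))"
      by (simp only: fourier_coeff_def)
    also have "\<dots> = (LBINT x:{0..1}. complex_of_real (f x * cos (?c * x))) - (LBINT x:{0..1}. \<i> * complex_of_real (f x * sin (?c * x)))"
      by (intro set_integral_diff set_integrable_mult_right c s)
    also have "\<dots> = of_real (LBINT x:{0..1}. f x * cos (?c * x)) - \<i> * of_real (LBINT x:{0..1}. f x * sin (?c * x))"
      by (simp only: set_integral_complex_of_real set_integral_mult_right)
    finally show ?thesis .
  qed
  have d: "deriv (\<lambda>x. A * cos (?c * x) + B * sin (?c * x)) = (\<lambda>x. (?c * B) * cos (?c * x) + (- ?c * A) * sin (?c * x))" for A B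
    by (intro ext DERIV_imp_deriv) (auto intro!: derivative_eq_intros simp: algebra_simps)
  have key: "(LBINT x:{0..1}. g x * ((?c * B) * cos (?c * x) + (- ?c * A) * sin (?c * x))) =
      - (LBINT x:{0..1}. h x * (A * cos (?c * x) + B * sin (?c * x)))" for A B
    using dd[unfolded distributional_derivative_def, rule_format, OF smooth_test_trig[of A k B]] unfolding d .
  have 1: "- ?c * (LBINT x:{0..1}. g x * sin (?c * x)) = - (LBINT x:{0..1}. h x * cos (?c * x))"
  proof -
    have "(\<lambda>x. g x * ((?c * 0) * cos (?c * x) + (- ?c * 1) * sin (?c * x))) = (\<lambda>x. - ?c * (g x * sin (?c * x)))"
      by (simp add: algebra_simps)
    with key[where A=1 and B=0] show ?thesis by (simp only: set_integral_mult_right) simp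
  qed
  have 2: "?c * (LBINT x:{0..1}. g x * cos (?c * x)) = - (LBINT x:{0..1}. h x * sin (?c * x))"
  proof -
    have "(\<lambda>x. g x * ((?c * 1) * cos (?c * x) + (- ?c * 0) * sin (?c * x))) = (\<lambda>x. ?c * (g x * cos (?c * x)))"
      by (simp add: algebra_simps)
    with key[where A=0 and B=1] show ?thesis by (simp only: set_integral_mult_right) simp
  qed
  have "2 * pi * \<i> * of_int k * fourier_coeff g k = Complex (?c * (LBINT x:{0..1}. g x * sin (?c * x))) (?c * (LBINT x:{0..1}. g x * cos (?c * x)))"
    unfolding split[OF g] by (simp add: complex_eq_iff)
  also have "\<dots> = fourier_coeff h k"
    using 1 2 unfolding split[OF h] by (simp add: complex_eq_iff)
  finally show ?thesis .
qed

section \<open>Regularity of solutions\<close>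

lemma power_bessel_weight_le:
  assumes "0 \<le> p"
  shows "\<bar>of_int k\<bar> powr (2 * p) \<le> bessel_weight k powr p"
proof -
  have "\<bar>of_int k\<bar> powr (2 * p) = ((of_int k)\<^sup>2) powr p"
    by (cases "k = 0") (simp_all add: powr_powr[symmetric] powr_realpow[symmetric])
  also have "\<dots> \<le> bessel_weight k powr p"
    by (intro powr_mono2 assms bessel_weight_ge) auto
  finally show ?thesis .
qed

lemma sobolev_homogeneous:
  assumes f: "f \<in> sobolev s" and p: "0 \<le> p" "p \<le> s"
  shows "(\<lambda>k. \<bar>of_int k\<bar> powr (2 * p) * (cmod (fourier_coeff f k))\<^sup>2) summable_on UNIV"
    and "sqrt (\<Sum>\<^sub>\<infinity>k. \<bar>of_int k\<bar> powr (2 * p) * (cmod (fourier_coeff f k))\<^sup>2) \<le> sobolev_norm s f"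
proof -
  have le: "\<bar>of_int k\<bar> powr (2 * p) * (cmod (fourier_coeff f k))\<^sup>2 \<le> bessel_weight k powr s * (cmod (fourier_coeff f k))\<^sup>2" for k
    by (intro mult_right_mono order_trans[OF power_bessel_weight_le[OF p(1)] powr_mono] p bessel_weight_ge_1) auto
  have s: "(\<lambda>k. bessel_weight k powr s * (cmod (fourier_coeff f k))\<^sup>2) summable_on UNIV"
    using f by (simp add: sobolev_iff)
  show r: "(\<lambda>k. \<bar>of_int k\<bar> powr (2 * p) * (cmod (fourier_coeff f k))\<^sup>2) summable_on UNIV"
    by (rule summable_on_comparison_test[OF s]) (use le in auto)
  show "sqrt (\<Sum>\<^sub>\<infinity>k. \<bar>of_int k\<bar> powr (2 * p) * (cmod (fourier_coeff f k))\<^sup>2) \<le> sobolev_norm s f"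
    unfolding sobolev_norm_eq by (intro real_sqrt_le_mono infsum_mono r s le)
qed

text \<open>\<open>v\<close> stands for the time derivative of \<open>u\<close>. \<open>T\<close> is
  any finite time up to the maximal one, so the estimates live on a real interval even if the
  solution exists beyond it.\<close>

locale ostrovsky_hunter =
  fixes \<gamma> s T :: real and u v :: "real \<Rightarrow> real \<Rightarrow> real"
  assumes gamma_pos: "0 < \<gamma>" and s_ge_2: "2 \<le> s" and T_pos: "0 < T"
    and u_cont: "\<And>t. t \<in> {0..<T} \<Longrightarrow> continuous_on UNIV (u t)"
    and u_sob: "\<And>t. t \<in> {0..<T} \<Longrightarrow> u t \<in> sobolev s"
    and u_lim: "\<And>t. t \<in> {0..<T} \<Longrightarrow> ((\<lambda>r. sobolev_norm s (\<lambda>x. u r x - u t x)) \<longlongrightarrow> 0) (at t within {0..<T})"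
    and v_sob: "\<And>t. t \<in> {0..<T} \<Longrightarrow> v t \<in> sobolev (s - 1)"
    and v_lim: "\<And>t. t \<in> {0..<T} \<Longrightarrow>
      ((\<lambda>r. sobolev_norm (s - 1) (\<lambda>x. (u r x - u t x) / (r - t) - v t x)) \<longlongrightarrow> 0) (at t within {0..<T})"
    and equation: "\<And>t. t \<in> {0<..<T} \<Longrightarrow>
      distributional_derivative (\<lambda>x. v t x + u t x * deriv (u t) x) (\<lambda>x. \<gamma> * u t x)"
begin

definition a :: "real \<Rightarrow> int \<Rightarrow> complex" where "a t = fourier_coeff (u t)"

definition da :: "real \<Rightarrow> int \<Rightarrow> complex" where "da t = fourier_coeff (v t)"

text \<open>Fourier coefficients of the mean-zero primitive of \<open>u\<close>; division by zero gives the value 0 at \<open>k = 0\<close>.\<close>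

definition b :: "real \<Rightarrow> int \<Rightarrow> complex" where "b t k = a t k / (2 * pi * \<i> * of_int k)"

definition ux :: "real \<Rightarrow> real \<Rightarrow> real" where "ux t = deriv (u t)"

definition P :: "real \<Rightarrow> real \<Rightarrow> real" where "P t x = Re (fser (b t) x)"

text \<open>A homogeneous weight, since a pure power suits the commutator estimate. At
  \<open>k = 0\<close> the convention \<open>0 powr x = 0\<close> drops the mean, which is 0 for
  \<open>0 < t\<close> anyway.\<close>

definition energy :: "real \<Rightarrow> real \<Rightarrow> real" where
  "energy p t = (\<Sum>\<^sub>\<infinity>k. \<bar>of_int k\<bar> powr (2 * p) * (cmod (a t k))\<^sup>2)"

lemma u_sob2: "t \<in> {0..<T} \<Longrightarrow> u t \<in> sobolev 2"
  using u_sob s_ge_2 by (rule sobolev_mono)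

lemma u_sob1: "t \<in> {0..<T} \<Longrightarrow> u t \<in> sobolev 1"
  using u_sob2 by (rule sobolev_mono) auto

lemma v_sob1: "t \<in> {0..<T} \<Longrightarrow> v t \<in> sobolev 1"
  by (rule sobolev_mono(1)[OF v_sob]) (use s_ge_2 in auto)

lemma a_summable: "t \<in> {0..<T} \<Longrightarrow> abs_summable (a t)"
  unfolding a_def by (rule sobolev_1_l1(1)[OF u_sob1])

lemma ka_summable: "t \<in> {0..<T} \<Longrightarrow> abs_summable (\<lambda>k. of_int k * a t k)"
  unfolding a_def by (rule sobolev_2_l1(1)[OF u_sob2])

lemma da_summable: "t \<in> {0..<T} \<Longrightarrow> abs_summable (da t)"
  unfolding da_def by (rule sobolev_1_l1(1)[OF v_sob1])

lemma a_cnj: "a t (- k) = cnj (a t k)"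
  unfolding a_def by (rule fourier_coeff_cnj)

lemma b_cnj: "b t (- k) = cnj (b t k)"
  by (simp add: b_def a_cnj)

lemma norm_b_le: "cmod (b t k) \<le> cmod (a t k)"
proof (cases "k = 0")
  case False
  hence "1 \<le> \<bar>real_of_int k\<bar>" by (cases "k > 0") auto
  hence "1 * 1 \<le> (2 * pi) * \<bar>real_of_int k\<bar>" using pi_ge_two by (intro mult_mono) auto
  thus ?thesis by (simp add: b_def norm_divide norm_mult divide_le_eq mult_left_mono[of 1, simplified])
     (metis mult.commute mult_left_mono mult.right_neutral norm_ge_zero)
qed (simp add: b_def)

lemma b_summable: "t \<in> {0..<T} \<Longrightarrow> abs_summable (b t)"
  using summable_on_comparison_test[OF a_summable, of t] norm_b_le by simp

lemma kb_summable: "t \<in> {0..<T} \<Longrightarrow> abs_summable (\<lambda>k. of_int k * b t k)"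
proof (rule summable_on_comparison_test[OF a_summable])
  show "cmod (of_int k * b t k) \<le> cmod (a t k)" for k
  proof (cases "k = 0")
    case False
    hence "cmod (of_int k * b t k) = cmod (a t k) / (2 * pi)" by (simp add: b_def norm_divide norm_mult)
    also have "\<dots> \<le> cmod (a t k) / 1" using pi_ge_two by (intro divide_left_mono) auto
    finally show ?thesis by simp
  qed simp
qed auto

lemma u_series: "t \<in> {0..<T} \<Longrightarrow> fser (a t) x = of_real (u t x)"
  unfolding a_def by (intro fser_fourier_coeff u_sob1 u_cont)

lemma u_has_derivative: "t \<in> {0..<T} \<Longrightarrow> (u t has_real_derivative ux t x) (at x)"
  unfolding ux_def using continuous_sobolev_2_deriv(1)[OF u_sob2 u_cont, of t x] DERIV_imp_deriv by metis

lemma ux_series: "t \<in> {0..<T} \<Longrightarrow> fser (\<lambda>k. 2 * pi * \<i> * of_int k * a t k) x = of_real (ux t x)"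
  unfolding ux_def a_def using continuous_sobolev_2_deriv(2)[OF u_sob2 u_cont, of t x] by simp

lemma P_series: "fser (b t) x = of_real (P t x)"
proof -
  have "cnj (fser (b t) x) = fser (b t) x" unfolding fser_cnj by (simp add: b_cnj)
  thus ?thesis by (auto simp: P_def complex_eq_iff)
qed

lemma u_periodic: "t \<in> {0..<T} \<Longrightarrow> u t (x + 1) = u t x"
  using u_sob[of t] by (simp add: sobolev_def periodic1_def)

lemma ux_periodic: "t \<in> {0..<T} \<Longrightarrow> ux t (x + 1) = ux t x"
  using ux_series[of t "x + 1"] ux_series[of t x] fser_periodic by (metis of_real_eq_iff)

lemma P_periodic: "P t (x + 1) = P t x"
  by (simp add: P_def fser_periodic)

lemma a_diff:
  assumes "t \<in> {0..<T}" "r \<in> {0..<T}"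
  shows "fourier_coeff (\<lambda>x. u r x - u t x) k = a r k - a t k"
  unfolding a_def by (rule sobolev_diff(2)[OF u_sob u_sob]) (use assms in auto)

text \<open>Here convergence in \<open>H^s\<close> is converted into l1 convergence of the
  coefficients of \<open>u\<close> and \<open>ux\<close>; the joint continuity of \<open>u\<close>,
  \<open>ux\<close> and \<open>P\<close> rests on it.\<close>

lemma a_lim:
  assumes t: "t \<in> {0..<T}"
  shows "((\<lambda>r. \<Sum>\<^sub>\<infinity>k. norm (of_int k * (a r k - a t k))) \<longlongrightarrow> 0) (at t within {0..<T})"
    and "((\<lambda>r. \<Sum>\<^sub>\<infinity>k. norm (a r k - a t k)) \<longlongrightarrow> 0) (at t within {0..<T})"
proof -
  have "((\<lambda>r. sob_const * sobolev_norm s (\<lambda>x. u r x - u t x)) \<longlongrightarrow> sob_const * 0) (at t within {0..<T})"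
    by (intro tendsto_intros u_lim t)
  hence lim: "((\<lambda>r. sob_const * sobolev_norm s (\<lambda>x. u r x - u t x)) \<longlongrightarrow> 0) (at t within {0..<T})" by simp
  have 1: "(\<Sum>\<^sub>\<infinity>k. norm (of_int k * (a r k - a t k))) \<le> sob_const * sobolev_norm s (\<lambda>x. u r x - u t x)"
    and 2: "(\<Sum>\<^sub>\<infinity>k. norm (a r k - a t k)) \<le> sob_const * sobolev_norm s (\<lambda>x. u r x - u t x)"
    if r: "r \<in> {0..<T}" for r
  proof -
    have ds: "(\<lambda>x. u r x - u t x) \<in> sobolev s" by (intro sobolev_diff u_sob t r)
    have d2: "(\<lambda>x. u r x - u t x) \<in> sobolev 2" and d2n: "sobolev_norm 2 (\<lambda>x. u r x - u t x) \<le> sobolev_norm s (\<lambda>x. u r x - u t x)"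
      using sobolev_mono[OF ds s_ge_2] by auto
    have d1: "(\<lambda>x. u r x - u t x) \<in> sobolev 1" and d1n: "sobolev_norm 1 (\<lambda>x. u r x - u t x) \<le> sobolev_norm 2 (\<lambda>x. u r x - u t x)"
      using sobolev_mono[OF d2, of 1] by auto
    show "(\<Sum>\<^sub>\<infinity>k. norm (of_int k * (a r k - a t k))) \<le> sob_const * sobolev_norm s (\<lambda>x. u r x - u t x)"
      using sobolev_2_l1(2)[OF d2] mult_left_mono[OF d2n sob_const_nonneg] unfolding a_diff[OF t r] by linarith
    show "(\<Sum>\<^sub>\<infinity>k. norm (a r k - a t k)) \<le> sob_const * sobolev_norm s (\<lambda>x. u r x - u t x)"
      using sobolev_1_l1(2)[OF d1] mult_left_mono[OF order_trans[OF d1n d2n] sob_const_nonneg] unfolding a_diff[OF t r] by linarith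
  qed
  show "((\<lambda>r. \<Sum>\<^sub>\<infinity>k. norm (of_int k * (a r k - a t k))) \<longlongrightarrow> 0) (at t within {0..<T})"
    by (rule tendsto_0_bound_within[OF lim]) (use 1 in \<open>auto simp: infsum_nonneg\<close>)
  show "((\<lambda>r. \<Sum>\<^sub>\<infinity>k. norm (a r k - a t k)) \<longlongrightarrow> 0) (at t within {0..<T})"
    by (rule tendsto_0_bound_within[OF lim]) (use 2 in \<open>auto simp: infsum_nonneg\<close>)
qed

lemma continuous_u: "continuous_on ({0..<T} \<times> UNIV) (\<lambda>(t, x). u t x)"
proof -
  have "continuous_on ({0..<T} \<times> UNIV) (\<lambda>(t, x). fser (a t) x)"
    by (rule continuous_on_fser_param) (use a_summable a_lim in auto)
  hence "continuous_on ({0..<T} \<times> UNIV) (\<lambda>p. Re ((\<lambda>(t, x). fser (a t) x) p))"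
    by (intro continuous_intros)
  thus ?thesis by (rule continuous_on_eq) (auto simp: u_series)
qed

lemma continuous_ux: "continuous_on ({0..<T} \<times> UNIV) (\<lambda>(t, x). ux t x)"
proof -
  have "continuous_on ({0..<T} \<times> UNIV) (\<lambda>(t, x). fser (\<lambda>k. 2 * pi * \<i> * of_int k * a t k) x)"
  proof (rule continuous_on_fser_param)
    fix t assume t: "t \<in> {0..<T}"
    show "abs_summable (\<lambda>k. 2 * pi * \<i> * of_int k * a t k)"
      by (rule abs_summable_deriv(2)[OF ka_summable[OF t]])
    have "norm (2 * pi * \<i> * of_int k * a r k - 2 * pi * \<i> * of_int k * a t k) = 2 * pi * norm (of_int k * (a r k - a t k))" for r k
      unfolding right_diff_distrib[symmetric] by (simp add: norm_mult)
    hence e: "(\<Sum>\<^sub>\<infinity>k. norm (2 * pi * \<i> * of_int k * a r k - 2 * pi * \<i> * of_int k * a t k)) = 2 * pi * (\<Sum>\<^sub>\<infinity>k. norm (of_int k * (a r k - a t k)))" for r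
      by (simp only: infsum_cmult_right')
    have "((\<lambda>r. 2 * pi * (\<Sum>\<^sub>\<infinity>k. norm (of_int k * (a r k - a t k)))) \<longlongrightarrow> 2 * pi * 0) (at t within {0..<T})"
      by (intro tendsto_intros a_lim t)
    thus "((\<lambda>r. \<Sum>\<^sub>\<infinity>k. norm (2 * pi * \<i> * of_int k * a r k - 2 * pi * \<i> * of_int k * a t k)) \<longlongrightarrow> 0) (at t within {0..<T})"
      unfolding e by simp
  qed
  hence "continuous_on ({0..<T} \<times> UNIV) (\<lambda>p. Re ((\<lambda>(t, x). fser (\<lambda>k. 2 * pi * \<i> * of_int k * a t k) x) p))"
    by (intro continuous_intros)
  thus ?thesis by (rule continuous_on_eq) (use ux_series in auto)
qed

lemma continuous_P: "continuous_on ({0..<T} \<times> UNIV) (\<lambda>(t, x). P t x)"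
proof -
  have "continuous_on ({0..<T} \<times> UNIV) (\<lambda>(t, x). fser (b t) x)"
  proof (rule continuous_on_fser_param)
    fix t assume t: "t \<in> {0..<T}"
    show "abs_summable (b t)" by (rule b_summable[OF t])
    have le: "norm (b r k - b t k) \<le> norm (a r k - a t k)" for r k
    proof (cases "k = 0")
      case False
      hence "1 \<le> \<bar>real_of_int k\<bar>" by (cases "k > 0") auto
      hence ge: "1 * 1 \<le> (2 * pi) * \<bar>real_of_int k\<bar>" using pi_ge_two by (intro mult_mono) auto
      have "norm (b r k - b t k) = norm (a r k - a t k) / (2 * pi * \<bar>real_of_int k\<bar>)"
        by (simp add: b_def diff_divide_distrib[symmetric] norm_divide norm_mult)
      also have "\<dots> \<le> norm (a r k - a t k) / 1" using ge by (intro divide_left_mono) auto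
      finally show ?thesis by simp
    qed (simp add: b_def)
    have "(\<Sum>\<^sub>\<infinity>k. norm (b r k - b t k)) \<le> (\<Sum>\<^sub>\<infinity>k. norm (a r k - a t k))" if "r \<in> {0..<T}" for r
      by (intro infsum_mono le fser_diff(1) a_summable b_summable t that)
    thus "((\<lambda>r. \<Sum>\<^sub>\<infinity>k. norm (b r k - b t k)) \<longlongrightarrow> 0) (at t within {0..<T})"
      by (intro tendsto_0_bound_within[OF a_lim(2)[OF t]]) (auto simp: infsum_nonneg)
  qed
  hence "continuous_on ({0..<T} \<times> UNIV) (\<lambda>p. Re ((\<lambda>(t, x). fser (b t) x) p))"
    by (intro continuous_intros)
  thus ?thesis by (rule continuous_on_eq) (auto simp: P_series)
qed

lemma continuous_slice:
  assumes "continuous_on ({0..<T} \<times> UNIV) (\<lambda>(t, x). f t x)" "t \<in> {0..<T}"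
  shows "continuous_on S (f t :: real \<Rightarrow> real)"
proof -
  have "continuous_on S ((\<lambda>(t, x). f t x) \<circ> (\<lambda>x. (t, x)))"
    by (intro continuous_on_compose continuous_intros continuous_on_subset[OF assms(1)]) (use assms(2) in auto)
  thus ?thesis by (simp add: o_def)
qed

lemmas continuous_ux_slice = continuous_slice[OF continuous_ux]
lemmas continuous_u_slice = continuous_slice[OF continuous_u]
lemmas continuous_P_slice = continuous_slice[OF continuous_P]

section \<open>The equation for the coefficients and in pointwise form\<close>

lemma equation_fourier:
  assumes t: "t \<in> {0<..<T}"
  shows "2 * pi * \<i> * of_int k * (da t k + fourier_coeff (\<lambda>x. u t x * ux t x) k) = \<gamma> * a t k"
proof -
  have t': "t \<in> {0..<T}" using t by auto
  have "set_integrable lborel {0..1} (\<lambda>x. u t x * ux t x)"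
    by (intro borel_integrable_atLeastAtMost' continuous_intros continuous_u_slice continuous_ux_slice t')
  hence i1: "set_integrable lborel {0..1} (v t)" "set_integrable lborel {0..1} (\<lambda>x. u t x * ux t x)"
    using sobolev_integrable[OF v_sob[OF t']] by auto
  have i2: "set_integrable lborel {0..1} (u t)" by (rule sobolev_integrable[OF u_sob[OF t']])
  have "2 * pi * \<i> * of_int k * fourier_coeff (\<lambda>x. v t x + u t x * ux t x) k = fourier_coeff (\<lambda>x. \<gamma> * u t x) k"
    by (rule distributional_derivative_fourier)
       (use equation[OF t] i1 i2 in \<open>auto simp: ux_def[symmetric] intro: set_integral_add\<close>)
  moreover have "fourier_coeff (\<lambda>x. v t x + u t x * ux t x) k = da t k + fourier_coeff (\<lambda>x. u t x * ux t x) k"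
    using fourier_coeff_linear[OF i1, of 1 1 k] by (simp add: da_def)
  moreover have "fourier_coeff (\<lambda>x. \<gamma> * u t x) k = \<gamma> * a t k"
    using fourier_coeff_linear[OF i2 i2, of \<gamma> 0 k] by (simp add: a_def)
  ultimately show ?thesis by simp
qed

text \<open>At frequency 0 the outer derivative contributes nothing, and the equation reads
  \<open>\<gamma> * a t 0 = 0\<close>.\<close>

lemma a_0: "t \<in> {0<..<T} \<Longrightarrow> a t 0 = 0"
  using equation_fourier[of t 0] gamma_pos by simp

lemma at_within_time: "t \<in> {0<..<T} \<Longrightarrow> at t within {0..<T} = at t"
  by (rule at_within_open_subset[of _ "{0<..<T}"]) auto

text \<open>\<open>H^(s-1)\<close> embeds into \<open>H^1\<close> because \<open>2 \<le> s\<close>,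
  so the difference quotients converge in the l1 norm of the coefficients. This makes
  \<open>u\<close> differentiable in time at every single \<open>x\<close>.\<close>

lemma quotient_lim:
  assumes t: "t \<in> {0..<T}"
  shows "((\<lambda>r. \<Sum>\<^sub>\<infinity>k. norm ((a r k - a t k) / of_real (r - t) - da t k)) \<longlongrightarrow> 0) (at t within {0..<T})"
    and "r \<in> {0..<T} \<Longrightarrow> abs_summable (\<lambda>k. (a r k - a t k) / of_real (r - t) - da t k)"
proof -
  let ?q = "\<lambda>r x. (u r x - u t x) / (r - t) - v t x"
  have q: "?q r \<in> sobolev 1" "sobolev_norm 1 (?q r) \<le> sobolev_norm (s - 1) (?q r)"
     "\<And>k. fourier_coeff (?q r) k = (a r k - a t k) / of_real (r - t) - da t k" if r: "r \<in> {0..<T}" for r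
  proof -
    have d: "(\<lambda>x. u r x - u t x) \<in> sobolev (s - 1)"
      by (intro sobolev_diff sobolev_mono(1)[OF u_sob] t r) auto
    have e: "?q r = (\<lambda>x. inverse (r - t) * (u r x - u t x) + (-1) * v t x)"
      by (simp add: divide_inverse mult.commute)
    have "?q r \<in> sobolev (s - 1)" unfolding e by (intro sobolev_linear d v_sob t)
    thus "?q r \<in> sobolev 1" "sobolev_norm 1 (?q r) \<le> sobolev_norm (s - 1) (?q r)"
      using sobolev_mono[of "?q r" "s - 1" 1] s_ge_2 by auto
    show "fourier_coeff (?q r) k = (a r k - a t k) / of_real (r - t) - da t k" for k
      unfolding e fourier_coeff_linear[OF sobolev_integrable[OF d] sobolev_integrable[OF v_sob[OF t]]] a_diff[OF t r]
      by (simp add: da_def divide_inverse mult.commute)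
  qed
  show "r \<in> {0..<T} \<Longrightarrow> abs_summable (\<lambda>k. (a r k - a t k) / of_real (r - t) - da t k)"
    using sobolev_1_l1(1)[OF q(1), of r] q(3)[of r] by simp
  have "((\<lambda>r. sob_const * sobolev_norm (s - 1) (?q r)) \<longlongrightarrow> sob_const * 0) (at t within {0..<T})"
    by (intro tendsto_intros v_lim t)
  hence lim: "((\<lambda>r. sob_const * sobolev_norm (s - 1) (?q r)) \<longlongrightarrow> 0) (at t within {0..<T})" by simp
  have "(\<Sum>\<^sub>\<infinity>k. norm ((a r k - a t k) / of_real (r - t) - da t k)) \<le> sob_const * sobolev_norm (s - 1) (?q r)"
    if r: "r \<in> {0..<T}" for r
    using order_trans[OF sobolev_1_l1(2)[OF q(1)[OF r]] mult_left_mono[OF q(2)[OF r] sob_const_nonneg]]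
    unfolding q(3)[OF r] .
  thus "((\<lambda>r. \<Sum>\<^sub>\<infinity>k. norm ((a r k - a t k) / of_real (r - t) - da t k)) \<longlongrightarrow> 0) (at t within {0..<T})"
    by (intro tendsto_0_bound_within[OF lim]) (auto simp: infsum_nonneg)
qed

lemma a_has_derivative:
  assumes t: "t \<in> {0<..<T}"
  shows "((\<lambda>r. a r k) has_vector_derivative da t k) (at t)"
proof -
  have t': "t \<in> {0..<T}" using t by auto
  have "((\<lambda>r. (a r k - a t k) / of_real (r - t) - da t k) \<longlongrightarrow> 0) (at t within {0..<T})"
  proof (rule tendsto_0_bound_within[OF quotient_lim(1)[OF t']])
    show "norm ((a r k - a t k) / of_real (r - t) - da t k) \<le> (\<Sum>\<^sub>\<infinity>k. norm ((a r k - a t k) / of_real (r - t) - da t k))"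
      if "r \<in> {0..<T}" for r
      using finite_sum_le_infsum[OF quotient_lim(2)[OF t' that], of "{k}"] by simp
  qed
  from has_vector_derivative_difference_quotient[OF this] show ?thesis by (simp only: at_within_time[OF t])
qed

text \<open>For \<open>k \<noteq> 0\<close> the symbol of the outer derivative can be cancelled. At
  \<open>k = 0\<close> it carries no information; there \<open>da t 0 = 0\<close> because the mean
  stays 0, and \<open>u * ux\<close> has mean 0 as the derivative of a periodic function.\<close>

lemma da_eq:
  assumes t: "t \<in> {0<..<T}"
  shows "da t k = \<gamma> * b t k - fourier_coeff (\<lambda>x. u t x * ux t x) k"
proof (cases "k = 0")
  case False
  have "2 * pi * \<i> * of_int k * (da t k + fourier_coeff (\<lambda>x. u t x * ux t x) k) = 2 * pi * \<i> * of_int k * (\<gamma> * b t k)"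
    using equation_fourier[OF t, of k] False by (simp add: b_def)
  hence "da t k + fourier_coeff (\<lambda>x. u t x * ux t x) k = \<gamma> * b t k"
    using False by (simp only: mult_cancel_left) auto
  thus ?thesis by (simp add: eq_diff_eq)
next
  case True
  have t': "t \<in> {0..<T}" using t by auto
  have "((\<lambda>r. 0 :: complex) has_vector_derivative da t 0) (at t)"
    by (rule has_vector_derivative_transform_within_open[OF a_has_derivative[OF t, of 0], of "{0<..<T}"])
       (use t a_0 in auto)
  hence 1: "da t 0 = 0" using vector_derivative_unique_at[OF _ has_vector_derivative_const] by blast
  have c: "continuous_on UNIV (\<lambda>x. u t x * ux t x)"
    by (intro continuous_intros continuous_u_slice continuous_ux_slice t')
  have "((\<lambda>x. complex_of_real (u t x * ux t x)) has_integral
      (of_real ((u t 1)\<^sup>2 / 2) - of_real ((u t 0)\<^sup>2 / 2))) {0..1}"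
  proof (rule fundamental_theorem_of_calculus)
    fix x
    have "((\<lambda>x. (u t x)\<^sup>2 / 2) has_real_derivative u t x * ux t x) (at x)"
      by (auto intro!: derivative_eq_intros u_has_derivative t')
    hence "((\<lambda>x. complex_of_real ((u t x)\<^sup>2 / 2)) has_vector_derivative of_real (u t x * ux t x)) (at x)"
      by (intro has_vector_derivative_of_real) (simp add: has_real_derivative_iff_has_vector_derivative)
    thus "((\<lambda>x. complex_of_real ((u t x)\<^sup>2 / 2)) has_vector_derivative of_real (u t x * ux t x)) (at x within {0..1})"
      by (rule has_vector_derivative_at_within)
  qed auto
  moreover have "u t 1 = u t 0" using u_periodic[OF t', of 0] by simp
  ultimately have "fint (\<lambda>x. complex_of_real (u t x * ux t x)) 0 = 0"
    by (simp add: fint_def integral_unique)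
  with 1 show ?thesis using True by (simp add: fourier_coeff_fint[OF c] b_def)
qed

text \<open>Absolute summability of the coefficients of \<open>u * ux\<close> is read off from
  \<open>da_eq\<close>, which writes them as a combination of two absolutely summable sequences.
  Fourier inversion then turns the distributional equation into a pointwise one.\<close>

lemma u_time_derivative:
  assumes t: "t \<in> {0<..<T}"
  shows "((\<lambda>r. u r x) has_real_derivative (\<gamma> * P t x - u t x * ux t x)) (at t)"
proof -
  have t': "t \<in> {0..<T}" using t by auto
  define w where "w = fint (\<lambda>x. complex_of_real (u t x * ux t x))"
  have c: "continuous_on UNIV (\<lambda>x. u t x * ux t x)"
    by (intro continuous_intros continuous_u_slice continuous_ux_slice t')
  have da: "da t k = \<gamma> * b t k - w k" for k
    using da_eq[OF t, of k] fourier_coeff_fint[OF c] by (simp add: w_def)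
  have w: "w = (\<lambda>k. \<gamma> * b t k + (-1) * da t k)" by (simp add: da)
  have ws: "abs_summable w" unfolding w by (rule fser_linear(1)[OF b_summable[OF t'] da_summable[OF t']])
  have "fser w x = of_real (u t x * ux t x)"
    unfolding w_def
    by (rule fser_fint) (use c ws in \<open>auto simp: w_def[symmetric] u_periodic[OF t'] ux_periodic[OF t'] simp del: of_real_mult intro!: continuous_intros\<close>)
  moreover have "fser (\<lambda>k. \<gamma> * b t k + (-1) * w k) x = \<gamma> * fser (b t) x + (-1) * fser w x"
    by (rule fser_linear(2)[OF b_summable[OF t'] ws])
  moreover have "da t = (\<lambda>k. \<gamma> * b t k + (-1) * w k)" by (auto simp: da)
  ultimately have fda: "fser (da t) x = of_real (\<gamma> * P t x - u t x * ux t x)"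
    by (simp add: P_series)
  have "((\<lambda>r. fser (a r) x) has_vector_derivative fser (da t) x) (at t within {0..<T})"
    by (rule has_vector_derivative_fser_param[OF a_summable da_summable[OF t'] t' quotient_lim(1)[OF t']])
  hence "((\<lambda>r. fser (a r) x) has_vector_derivative of_real (\<gamma> * P t x - u t x * ux t x)) (at t)"
    by (simp only: at_within_time[OF t] fda)
  from bounded_linear.has_vector_derivative[OF bounded_linear_Re this]
  have "((\<lambda>r. Re (fser (a r) x)) has_vector_derivative (\<gamma> * P t x - u t x * ux t x)) (at t)" by simp
  hence "((\<lambda>r. u r x) has_vector_derivative (\<gamma> * P t x - u t x * ux t x)) (at t)"
    by (rule has_vector_derivative_transform_within_open[of _ _ _ "{0<..<T}"]) (use t u_series in auto)
  thus ?thesis by (simp add: has_real_derivative_iff_has_vector_derivative)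
qed

text \<open>Termwise differentiation of \<open>b\<close> returns \<open>a\<close> except at
  \<open>k = 0\<close>, where it returns 0; there \<open>a_0\<close> closes the gap.\<close>

lemma P_has_derivative:
  assumes t: "t \<in> {0<..<T}"
  shows "(P t has_real_derivative u t x) (at x)"
proof -
  have t': "t \<in> {0..<T}" using t by auto
  have "2 * pi * \<i> * of_int k * b t k = a t k" for k
    using a_0[OF t] by (cases "k = 0") (simp_all add: b_def)
  hence "(fser (b t) has_vector_derivative of_real (u t x)) (at x)"
    using has_vector_derivative_fser[OF kb_summable[OF t'], of x] by (simp add: u_series[OF t'])
  from bounded_linear.has_vector_derivative[OF bounded_linear_Re this]
  show ?thesis by (simp add: has_real_derivative_iff_has_vector_derivative P_def[abs_def])
qed

text \<open>A zero of \<open>P\<close> is what the mean-zero normalisation is needed for: together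
  with the Lipschitz bound it yields \<open>\<bar>P\<bar> \<le> sup \<bar>u\<bar>\<close> on a
  period.\<close>

lemma P_zero_mean:
  assumes t: "t \<in> {0<..<T}"
  obtains y where "0 \<le> y" "y \<le> 1" "P t y = 0"
proof -
  have t': "t \<in> {0..<T}" using t by auto
  have "fint (fser (b t)) 0 = 0" using fint_fser[OF b_summable[OF t'], of 0] by (simp add: b_def[of t 0])
  hence "integral {0..1} (\<lambda>x. complex_of_real (P t x)) = 0" by (simp add: fint_def P_series)
  moreover have i: "P t integrable_on {0..1}" by (intro integrable_cont continuous_P_slice t')
  ultimately have int0: "integral {0..1} (P t) = 0"
    using integral_unique[OF has_integral_of_real[OF integrable_integral[OF i], where ?'b = complex]] by simp
  have cP: "continuous_on {0..1} (P t)" by (rule continuous_P_slice[OF t'])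
  have nonneg: False if pos: "\<And>y. y \<in> {0..1} \<Longrightarrow> 0 < \<sigma> * P t y" for \<sigma>
  proof -
    have "integral {0..1} (\<lambda>y. \<sigma> * P t y) = 0" using int0 by simp
    moreover have "(\<lambda>y. \<sigma> * P t y) integrable_on cbox 0 1" using i by (simp add: integrable_on_mult_right)
    ultimately have h: "((\<lambda>y. \<sigma> * P t y) has_integral 0) (cbox 0 1)"
      by (simp add: has_integral_integrable_integral)
    have "\<sigma> * P t 0 = 0"
      by (rule has_integral_0_cbox_imp_0[OF _ _ h]) (use pos in \<open>auto intro!: continuous_intros cP less_imp_le\<close>)
    with pos[of 0] show False by simp
  qed
  have "\<exists>y\<in>{0..1}. P t y = 0"
  proof (rule ccontr)
    assume "\<not> ?thesis"
    hence nz: "P t y \<noteq> 0" if "y \<in> {0..1}" for y using that by blast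
    have conn: "connected (P t ` {0..1})" by (intro connected_continuous_image cP) auto
    have 0: "0 \<notin> P t ` {0..1}" using nz by (metis imageE)
    have same: "0 < P t 0 * P t y" if "y \<in> {0..1}" for y
    proof (rule ccontr)
      assume "\<not> ?thesis"
      hence "(P t 0 \<le> 0 \<and> 0 \<le> P t y) \<or> (P t y \<le> 0 \<and> 0 \<le> P t 0)" by (auto simp: not_less mult_le_0_iff)
      moreover have "P t 0 \<in> P t ` {0..1}" "P t y \<in> P t ` {0..1}" using that by auto
      ultimately have "0 \<in> P t ` {0..1}" using conn unfolding connected_iff_interval by blast
      with 0 show False by simp
    qed
    \<comment> \<open>Without a zero \<open>P t\<close> has the sign of \<open>P t 0\<close>
      throughout; multiplying by \<open>P t 0\<close> makes it positive, and a positive continuous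
      function cannot have integral 0.\<close>
    show False by (rule nonneg[of "P t 0"]) (use same in auto)
  qed
  thus thesis using that by auto
qed

section \<open>Energies\<close>

lemma energy_summable:
  assumes "t \<in> {0..<T}" "0 \<le> p" "p \<le> s"
  shows "(\<lambda>k. \<bar>of_int k\<bar> powr (2 * p) * (cmod (a t k))\<^sup>2) summable_on UNIV"
  unfolding a_def by (rule sobolev_homogeneous(1)[OF u_sob]) (use assms in auto)

lemma energy_nonneg: "0 \<le> energy p t"
  unfolding energy_def by (intro infsum_nonneg) auto

text \<open>The square root of the energy is a seminorm dominated by the \<open>H^s\<close> norm, so
  the reverse triangle inequality transfers the continuity of \<open>u\<close> in
  \<open>H^s\<close>.\<close>

lemma continuous_energy:
  assumes p: "0 \<le> p" "p \<le> s"
  shows "continuous_on {0..<T} (energy p)"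
proof -
  have tri: "sqrt (energy p q) \<le> sqrt (energy p t) + sobolev_norm s (\<lambda>x. u r x - u t x)"
    if tr: "t \<in> {0..<T}" "r \<in> {0..<T}" and q: "q = r" for t r q
  proof -
    let ?w = "\<lambda>k::int. \<bar>of_int k :: real\<bar> powr p"
    have w2: "(?w k * x)\<^sup>2 = \<bar>of_int k\<bar> powr (2 * p) * x\<^sup>2" for k x
      by (simp add: power_mult_distrib power2_eq_square powr_add[symmetric])
    have ds: "(\<lambda>x. u r x - u t x) \<in> sobolev s" by (intro sobolev_diff u_sob tr)
    have "sqrt (\<Sum>\<^sub>\<infinity>k. (?w k * cmod (a r k))\<^sup>2) \<le> sqrt (\<Sum>\<^sub>\<infinity>k. (?w k * cmod (a t k))\<^sup>2) + sqrt (\<Sum>\<^sub>\<infinity>k. (?w k * cmod (a r k - a t k))\<^sup>2)"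
    proof (rule l2_triangle(2))
      show "(\<lambda>k. (?w k * cmod (a t k))\<^sup>2) summable_on UNIV" unfolding w2 by (intro energy_summable tr p)
      show "(\<lambda>k. (?w k * cmod (a r k - a t k))\<^sup>2) summable_on UNIV" unfolding w2
        using sobolev_homogeneous(1)[OF ds p] unfolding a_diff[OF tr] .
      have "cmod (a r k) \<le> cmod (a t k) + cmod (a r k - a t k)" for k
        using norm_triangle_ineq[of "a t k" "a r k - a t k"] by simp
      from mult_left_mono[OF this] show "\<bar>?w k * cmod (a r k)\<bar> \<le> \<bar>?w k * cmod (a t k)\<bar> + \<bar>?w k * cmod (a r k - a t k)\<bar>" for k
        by (simp add: distrib_left abs_mult)
    qed
    moreover have "sqrt (\<Sum>\<^sub>\<infinity>k. (?w k * cmod (a r k - a t k))\<^sup>2) \<le> sobolev_norm s (\<lambda>x. u r x - u t x)"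
      unfolding w2 using sobolev_homogeneous(2)[OF ds p] unfolding a_diff[OF tr] .
    ultimately show ?thesis unfolding w2 energy_def q by linarith
  qed
  have sym: "sobolev_norm s (\<lambda>x. u r x - u t x) = sobolev_norm s (\<lambda>x. u t x - u r x)"
    if "t \<in> {0..<T}" "r \<in> {0..<T}" for r t
    unfolding sobolev_norm_eq a_diff[OF that] a_diff[OF that(2,1)] by (simp add: norm_minus_commute)
  have "continuous_on {0..<T} (\<lambda>t. sqrt (energy p t))"
    unfolding continuous_on_def
  proof
    fix t assume t: "t \<in> {0..<T}"
    have "((\<lambda>r. sqrt (energy p r) - sqrt (energy p t)) \<longlongrightarrow> 0) (at t within {0..<T})"
    proof (rule tendsto_0_bound_within[OF u_lim[OF t]])
      show "norm (sqrt (energy p r) - sqrt (energy p t)) \<le> sobolev_norm s (\<lambda>x. u r x - u t x)" if r: "r \<in> {0..<T}" for r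
        using tri[OF t r refl] tri[OF r t refl] sym[OF t r] by (simp add: abs_le_iff)
    qed
    thus "((\<lambda>t. sqrt (energy p t)) \<longlongrightarrow> sqrt (energy p t)) (at t within {0..<T})"
      by (simp add: LIM_zero_iff)
  qed
  hence "continuous_on {0..<T} (\<lambda>t. (sqrt (energy p t))\<^sup>2)" by (rule continuous_on_power)
  thus ?thesis by (simp add: energy_nonneg)
qed

end

section \<open>Propagation of slope bounds\<close>

text \<open>A maximum principle in abstract form. Compactness provides a first time at which
  positivity fails; the minimum over \<open>K\<close> is then exactly 0, and a positive time
  derivative would force negative values just before. That the touching point is a spatial minimum
  is handed to \<open>step\<close>, which in the applications turns it into first-order conditions
  in \<open>x\<close>.\<close>

lemma first_touching:
  fixes F :: "real \<Rightarrow> 'a::metric_space \<Rightarrow> real"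
  assumes K: "compact K"
    and cont: "continuous_on ({t0..t1} \<times> K) (\<lambda>(t, z). F t z)"
    and init: "\<And>z. z \<in> K \<Longrightarrow> 0 < F t0 z"
    and step: "\<And>t z. \<lbrakk>t \<in> {t0<..t1}; z \<in> K; F t z = 0; \<And>w. w \<in> K \<Longrightarrow> 0 \<le> F t w\<rbrakk>
      \<Longrightarrow> \<exists>D>0. ((\<lambda>r. F r z) has_real_derivative D) (at t)"
    and t: "t \<in> {t0..t1}" and z: "z \<in> K"
  shows "0 < F t z"
proof (rule ccontr)
  assume neg: "\<not> 0 < F t z"
  define S where "S = {p \<in> {t0..t1} \<times> K. (\<lambda>(t, z). F t z) p \<le> 0}"
  have cK: "compact ({t0..t1} \<times> K)" by (intro compact_Times K) auto
  have "closedin (top_of_set ({t0..t1} \<times> K)) S"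
    unfolding S_def using continuous_closedin_preimage[OF cont closed_atMost[of 0]]
    by (simp add: vimage_def Int_def)
  hence "compact S" using cK closedin_compact by blast
  hence cS: "compact (fst ` S)" by (intro compact_continuous_image continuous_intros)
  have "(t, z) \<in> S" using neg t z by (auto simp: S_def)
  hence "fst ` S \<noteq> {}" by auto
  from compact_attains_inf[OF cS this] obtain r where r: "r \<in> fst ` S" "\<And>q. q \<in> fst ` S \<Longrightarrow> r \<le> q" by blast
  then obtain w where w: "(r, w) \<in> S" by force
  hence rw: "r \<in> {t0..t1}" "w \<in> K" "F r w \<le> 0" by (auto simp: S_def)
  have "r \<noteq> t0" using init[OF rw(2)] rw(3) by auto
  hence r0: "t0 < r" using rw by auto
  have before: "0 < F q y" if "t0 \<le> q" "q < r" "y \<in> K" for q y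
  proof (rule ccontr)
    assume "\<not> 0 < F q y"
    hence "(q, y) \<in> S" using that rw by (auto simp: S_def)
    hence "q \<in> fst ` S" by force
    with r(2)[of q] that show False by auto
  qed
  have nonneg: "0 \<le> F r y" if y: "y \<in> K" for y
  proof -
    have "continuous_on {t0..r} ((\<lambda>(t, z). F t z) \<circ> (\<lambda>q. (q, y)))"
      by (intro continuous_on_compose continuous_intros continuous_on_subset[OF cont]) (use rw y in auto)
    hence "((\<lambda>q. F q y) \<longlongrightarrow> F r y) (at r within {t0..r})"
      using r0 by (auto simp: continuous_on_def o_def)
    hence lim: "((\<lambda>q. F q y) \<longlongrightarrow> F r y) (at_left r)"
      using r0 by (simp add: at_within_Icc_at_left)
    show ?thesis
    proof (rule tendsto_lowerbound[OF lim])
      show "\<forall>\<^sub>F q in at_left r. 0 \<le> F q y"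
        using eventually_at_left_real[OF r0] by eventually_elim (use before y in \<open>auto intro: less_imp_le\<close>)
    qed simp
  qed
  have "F r w = 0" using nonneg[OF rw(2)] rw(3) by simp
  then obtain D where "D > 0" "((\<lambda>r. F r w) has_real_derivative D) (at r)"
    using step[of r w] nonneg rw r0 by auto
  from DERIV_pos_inc_left[OF this(2,1)] obtain d where d: "d > 0" "\<And>h. h > 0 \<Longrightarrow> h < d \<Longrightarrow> F (r - h) w < F r w" by blast
  define h where "h = min (d / 2) (r - t0)"
  have "h > 0" "h < d" "t0 \<le> r - h" using d(1) r0 by (auto simp: h_def)
  thus False using d(2)[of h] before[of "r - h" w] \<open>F r w = 0\<close> rw(2) by auto
qed

context ostrovsky_hunter
begin

section \<open>Supremum bounds for the primitive and for the solution\<close>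

lemma P_bounds:
  assumes t: "t \<in> {0<..<T}" and M: "\<And>x. \<bar>u t x\<bar> \<le> M"
  shows "\<bar>P t y - P t x\<bar> \<le> M * \<bar>y - x\<bar>" and "x \<in> {0..1} \<Longrightarrow> \<bar>P t x\<bar> \<le> M"
proof -
  have lip: "\<bar>P t y - P t x\<bar> \<le> M * \<bar>y - x\<bar>" for x y
    using field_differentiable_bound[of UNIV "P t" "u t" M y x] P_has_derivative[OF t] M by auto
  thus "\<bar>P t y - P t x\<bar> \<le> M * \<bar>y - x\<bar>" .
  obtain z where z: "0 \<le> z" "z \<le> 1" "P t z = 0" using P_zero_mean[OF t] .
  assume "x \<in> {0..1}"
  hence "\<bar>x - z\<bar> \<le> 1" using z by auto
  moreover have "0 \<le> M" using M[of 0] by linarith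
  ultimately have "M * \<bar>x - z\<bar> \<le> M" by (simp add: mult_left_le)
  thus "\<bar>P t x\<bar> \<le> M" using lip[of x z] z by simp
qed

lemma continuous_on_compose_pair:
  assumes f: "continuous_on ({0..<T} \<times> UNIV) (\<lambda>(t, x). f t x)"
    and g: "continuous_on S g" and h: "continuous_on S h" and S: "\<And>p. p \<in> S \<Longrightarrow> g p \<in> {0..<T}"
  shows "continuous_on S (\<lambda>p. f (g p) (h p) :: real)"
proof -
  have "continuous_on S ((\<lambda>(t, x). f t x) \<circ> (\<lambda>p. (g p, h p)))"
    by (intro continuous_on_compose continuous_intros g h continuous_on_subset[OF f]) (use S in auto)
  thus ?thesis by (simp add: o_def)
qed

text \<open>At an extremum \<open>ux\<close> vanishes and only the source
  \<open>\<gamma> * P\<close> acts, which is at most \<open>\<gamma> * sup \<bar>u\<bar>\<close>.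
  The barrier grows at the rate \<open>2 * \<gamma>\<close>, so its derivative is strictly larger at
  the touching time.\<close>

lemma u_bounded_step:
  assumes t0: "0 < t0" and t1: "t1 < T" and B: "\<And>x. \<bar>u t0 x\<bar> < B"
    and t: "t \<in> {t0..t1}"
  shows "\<bar>u t x\<bar> < B * exp (2 * \<gamma> * (t - t0))"
proof -
  have B0: "0 < B" using B[of 0] by linarith
  \<comment> \<open>The second component of \<open>p\<close> is a sign: the upper and the lower
    bound become one statement about a function on a compact set.\<close>
  define F where "F = (\<lambda>t (p :: real \<times> real). B * exp (2 * \<gamma> * (t - t0)) - snd p * u t (fst p))"
  have "0 < F t p" if p: "p \<in> {0..1} \<times> {-1, 1}" for p
  proof (rule first_touching[where K = "{0..1} \<times> {-1, 1}" and F = F and ?t0.0 = t0 and ?t1.0 = t1])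
    show "compact ({0..1::real} \<times> {-1, 1::real})" by (intro compact_Times) auto
    show "continuous_on ({t0..t1} \<times> ({0..1} \<times> {-1, 1})) (\<lambda>(t, z). F t z)"
      unfolding F_def case_prod_beta
      by (intro continuous_intros continuous_on_compose_pair[OF continuous_u]) (use t0 t1 in auto)
    show "0 < F t0 z" if "z \<in> {0..1} \<times> {-1, 1}" for z
      using B[of "fst z"] that by (auto simp: F_def)
    fix r p assume r: "r \<in> {t0<..t1}" and p: "p \<in> {0..1::real} \<times> {-1, 1::real}" and z: "F r p = 0"
      and nn: "\<And>w. w \<in> {0..1} \<times> {-1, 1} \<Longrightarrow> 0 \<le> F r w"
    define M where "M = B * exp (2 * \<gamma> * (r - t0))"
    have M0: "0 < M" using B0 by (simp add: M_def)
    have r': "r \<in> {0<..<T}" "r \<in> {0..<T}" using r t0 t1 by auto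
    obtain x \<sigma> where p_eq: "p = (x, \<sigma>)" "x \<in> {0..1}" "\<sigma> = -1 \<or> \<sigma> = 1" using p by auto
    have um: "\<bar>u r y\<bar> \<le> M" for y
    proof -
      have "\<bar>u r (frac y)\<bar> \<le> M"
        using nn[of "(frac y, 1)"] nn[of "(frac y, -1)"] frac_lt_1[of y] by (auto simp: F_def M_def abs_le_iff)
      moreover have "u r y = u r (frac y)" using periodic_frac[where f = "u r" and x = y] u_periodic r' by blast
      ultimately show ?thesis by simp
    qed
    have sM: "\<sigma> * u r x = M" using z by (simp add: F_def M_def p_eq)
    have "((\<lambda>y. \<sigma> * u r y) has_real_derivative \<sigma> * ux r x) (at x)"
      by (intro DERIV_cmult u_has_derivative r')
    moreover have "\<sigma> * u r y \<le> \<sigma> * u r x" for y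
      using um[of y] p_eq(3) unfolding sM by auto
    ultimately have "\<sigma> * ux r x = 0" by (intro DERIV_local_max[of _ _ x 1]) auto
    hence ux0: "ux r x = 0" using p_eq(3) by auto
    have "((\<lambda>t. F t p) has_real_derivative (2 * \<gamma> * M - \<sigma> * (\<gamma> * P r x - u r x * ux r x))) (at r)"
      unfolding F_def p_eq fst_conv snd_conv M_def
      by (rule derivative_eq_intros u_time_derivative[OF r'(1)] refl)+ simp
    moreover have "\<sigma> * (\<gamma> * P r x) \<le> \<gamma> * M"
    proof -
      have "\<sigma> * P r x \<le> M" using P_bounds(2)[OF r'(1) um p_eq(2)] p_eq(3) by auto
      thus ?thesis using gamma_pos by (simp add: mult.left_commute)
    qed
    hence "2 * \<gamma> * M - \<sigma> * (\<gamma> * P r x - u r x * ux r x) > 0"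
      using gamma_pos M0 mult_pos_pos[OF gamma_pos M0] by (simp add: ux0)
    ultimately show "\<exists>D>0. ((\<lambda>t. F t p) has_real_derivative D) (at r)" by blast
  qed (use t p in auto)
  from this[of "(frac x, 1)"] this[of "(frac x, -1)"]
  have "\<bar>u t (frac x)\<bar> < B * exp (2 * \<gamma> * (t - t0))"
    using frac_lt_1[of x] by (auto simp: F_def less_imp_le)
  moreover have "u t x = u t (frac x)"
    using periodic_frac[where f = "u t" and x = x] u_periodic[of t] t t0 t1 by auto
  ultimately show ?thesis by simp
qed

lemma u_bounded:
  assumes t0: "0 < t0" "t0 < T"
  obtains A where "0 < A" "\<And>t x. t \<in> {t0..<T} \<Longrightarrow> \<bar>u t x\<bar> \<le> A"
proof -
  have t0': "t0 \<in> {0..<T}" using t0 by auto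
  have le: "\<bar>u t0 x\<bar> \<le> (\<Sum>\<^sub>\<infinity>k. cmod (a t0 k))" for x
    using norm_fser_le[OF a_summable[OF t0'], of x] by (simp add: u_series[OF t0'])
  define B where "B = (\<Sum>\<^sub>\<infinity>k. cmod (a t0 k)) + 1"
  have B: "\<bar>u t0 x\<bar> < B" for x using le[of x] by (simp add: B_def)
  have B0: "0 < B" using B[of 0] by linarith
  show thesis
  proof (rule that[of "B * exp (2 * \<gamma> * T)"])
    fix t x assume t: "t \<in> {t0..<T}"
    have "\<bar>u t x\<bar> < B * exp (2 * \<gamma> * (t - t0))"
      by (rule u_bounded_step[of _ t]) (use t t0 B in auto)
    also have "\<dots> \<le> B * exp (2 * \<gamma> * T)" using B0 t t0 gamma_pos by simp
    finally show "\<bar>u t x\<bar> \<le> B * exp (2 * \<gamma> * T)" by simp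
  qed (use B0 in auto)
qed

text \<open>Formally \<open>ux\<close> has the derivative \<open>\<gamma> * u - ux^2\<close> along
  characteristics, so a lower barrier \<open>- N\<close> for \<open>\<sigma> * ux\<close> with
  \<open>N' = \<kappa>\<close> persists as long as
  \<open>\<sigma> * N^2 + \<gamma> * A < \<kappa>\<close>. For \<open>\<sigma> = 1\<close>, a lower
  bound of the slope, the square is the dangerous term; for \<open>\<sigma> = -1\<close>, an upper
  bound, it helps. With increments over \<open>[x, x + h]\<close> in place of \<open>ux\<close>,
  both endpoints of a touching interval have slope exactly \<open>- \<sigma> * N\<close>, and the
  two transport terms combine to the Riccati square.\<close>

lemma slope_bound_propagates:
  assumes t0: "0 < t0" and t1: "t1 < T"
    and sgn: "\<sigma> = -1 \<or> \<sigma> = 1"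
    and A: "\<And>t x. t \<in> {t0..t1} \<Longrightarrow> \<bar>u t x\<bar> \<le> A"
    and N0: "0 < N0" and \<kappa>: "0 \<le> \<kappa>"
    and ineq: "\<And>t. t \<in> {t0..t1} \<Longrightarrow> \<sigma> * (N0 + \<kappa> * (t - t0))\<^sup>2 + \<gamma> * A < \<kappa>"
    and init: "\<And>x. - N0 \<le> \<sigma> * ux t0 x"
    and t: "t \<in> {t0..t1}"
  shows "- (N0 + \<kappa> * (t - t0)) \<le> \<sigma> * ux t x"
proof -
  define N where "N = (\<lambda>t. N0 + \<kappa> * (t - t0))"
  have Npos: "0 < N r" if "r \<in> {t0..t1}" for r
    using N0 \<kappa> that unfolding N_def by (intro add_pos_nonneg mult_nonneg_nonneg) auto
  \<comment> \<open>\<open>L\<close> exceeds \<open>\<sigma> * N\<close> on the whole interval, so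
    the growth of the \<open>\<epsilon>\<close>-term beats the error \<open>\<sigma> * N * e\<close>
    that this term causes in the Riccati square.\<close>
  define L where "L = N t1 + 1"
  have NL: "N r < L" if "r \<in> {t0..t1}" for r
    using mult_left_mono[of "r - t0" "t1 - t0" \<kappa>] that \<kappa> by (simp add: L_def N_def)
  have t0T: "t0 \<in> {0..<T}" and tT: "t \<in> {0..<T}" using t t0 t1 by auto
  have incr0: "- N0 * h \<le> \<sigma> * (u t0 (x + h) - u t0 x)" if "0 \<le> h" for x h
  proof -
    have "\<sigma> * u t0 x + N0 * x \<le> \<sigma> * u t0 (x + h) + N0 * (x + h)"
    proof (rule DERIV_nonneg_imp_nondecreasing[where f = "\<lambda>x. \<sigma> * u t0 x + N0 * x" and a = x and b = "x + h"])
      fix y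
      have "((\<lambda>x. \<sigma> * u t0 x + N0 * x) has_real_derivative \<sigma> * ux t0 y + N0) (at y)"
        by (auto intro!: derivative_eq_intros u_has_derivative t0T)
      thus "\<exists>d. ((\<lambda>x. \<sigma> * u t0 x + N0 * x) has_real_derivative d) (at y) \<and> 0 \<le> d"
        using init[of y] by (intro exI[of _ "\<sigma> * ux t0 y + N0"]) auto
    qed (use that in auto)
    thus ?thesis by (simp add: algebra_simps)
  qed
  have pos: "0 < \<sigma> * (u t (x + h) - u t x) + N t * h + \<epsilon> * exp (L * (t - t0))"
    if \<epsilon>: "0 < \<epsilon>" and xh: "x \<in> {0..1}" "h \<in> {0..1}" for \<epsilon> x h
  proof -
    \<comment> \<open>The \<open>\<epsilon>\<close>-term keeps \<open>F\<close> positive on the diagonal \<open>h = 0\<close>, where the bound degenerates.\<close>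
    define F where "F = (\<lambda>t p. \<sigma> * (u t (fst p + snd p) - u t (fst p)) + N t * snd p + \<epsilon> * exp (L * (t - t0)))"
    have "0 < F t (x, h)"
    proof (rule first_touching[where K = "{0..1} \<times> {0..1}" and F = F and ?t0.0 = t0 and ?t1.0 = t1])
      show "compact ({0..1::real} \<times> {0..1::real})" by (intro compact_Times) auto
      show "continuous_on ({t0..t1} \<times> ({0..1} \<times> {0..1})) (\<lambda>(t, z). F t z)"
        unfolding F_def N_def case_prod_beta
        by (intro continuous_intros continuous_on_compose_pair[OF continuous_u]) (use t0 t1 in auto)
      show "0 < F t0 z" if "z \<in> {0..1} \<times> {0..1}" for z
        using incr0[of "snd z" "fst z"] that \<epsilon> by (auto simp: F_def N_def)
      fix r p assume r: "r \<in> {t0<..t1}" and p: "p \<in> {0..1::real} \<times> {0..1::real}" and z: "F r p = 0"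
        and nn: "\<And>w. w \<in> {0..1} \<times> {0..1} \<Longrightarrow> 0 \<le> F r w"
      have r': "r \<in> {0<..<T}" "r \<in> {0..<T}" "r \<in> {t0..t1}" using r t0 t1 by auto
      define e where "e = \<epsilon> * exp (L * (r - t0))"
      have e0: "0 < e" using \<epsilon> by (simp add: e_def)
      have per: "u r (y + 1) = u r y" for y by (rule u_periodic[OF r'(2)])
      obtain x h where p_eq: "p = (x, h)" "x \<in> {0..1}" "h \<in> {0..1}" using p by auto
      have Fe: "F r (y, k) = \<sigma> * (u r (y + k) - u r y) + N r * k + e" for y k by (simp add: F_def e_def)
      have z': "\<sigma> * (u r (x + h) - u r x) + N r * h + e = 0" using z Fe by (simp add: p_eq)
      have nn': "0 \<le> \<sigma> * (u r (y + k) - u r y) + N r * k + e" if k: "k \<in> {0..1}" for y k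
      proof -
        have "0 \<le> F r (frac y, k)" using k frac_lt_1[of y] by (intro nn) (auto simp: less_imp_le)
        moreover have "u r y = u r (frac y)" using periodic_frac[where f = "u r" and x = y, OF per] .
        moreover have "u r (y + k) = u r (frac y + k)"
        proof (rule periodic_frac[where f = "\<lambda>y. u r (y + k)" and x = y])
          show "u r (z + 1 + k) = u r (z + k)" for z using per[of "z + k"] by (simp add: algebra_simps)
        qed
        ultimately show ?thesis by (simp add: Fe)
      qed
      \<comment> \<open>Touching happens only for \<open>0 < h < 1\<close>: at \<open>h = 0\<close>
        the value of \<open>F\<close> is \<open>e\<close>, and at \<open>h = 1\<close> periodicity
        makes it \<open>N r + e\<close>. Both endpoints can therefore be moved freely.\<close>
      have "h \<noteq> 0" using z' e0 by auto
      moreover have "h \<noteq> 1" using z' e0 Npos[OF r'(3)] per by auto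
      ultimately have h: "0 < h" "h < 1" using p_eq by auto
      \<comment> \<open>The variables are the two endpoints instead of position and length; at the
        minimum the derivative in each endpoint vanishes separately.\<close>
      let ?\<Phi> = "\<lambda>y z. \<sigma> * (u r z - u r y) + N r * (z - y) + e"
      have min: "?\<Phi> x (x + h) \<le> ?\<Phi> y z" if "z - y \<in> {0..1}" for y z
        using nn'[OF that, of y] z' by simp
      have "((\<lambda>y. ?\<Phi> x y) has_real_derivative \<sigma> * ux r (x + h) + N r) (at (x + h))"
        by (auto intro!: derivative_eq_intros u_has_derivative r')
      hence d1: "\<sigma> * ux r (x + h) + N r = 0"
        by (rule DERIV_local_min[where d = "min h (1 - h)"], use h in simp, intro allI impI min) auto
      have "((\<lambda>y. ?\<Phi> y (x + h)) has_real_derivative - (\<sigma> * ux r x) - N r) (at x)"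
        by (auto intro!: derivative_eq_intros u_has_derivative r')
      hence d2: "- (\<sigma> * ux r x) - N r = 0"
        by (rule DERIV_local_min[where d = "min h (1 - h)"], use h in simp, intro allI impI min) auto
      define D where "D = \<sigma> * ((\<gamma> * P r (x + h) - u r (x + h) * ux r (x + h)) - (\<gamma> * P r x - u r x * ux r x)) + \<kappa> * h + e * L"
      have der: "((\<lambda>t. F t p) has_real_derivative D) (at r)"
        unfolding F_def N_def p_eq fst_conv snd_conv e_def D_def
        by (auto intro!: derivative_eq_intros u_time_derivative[OF r'(1)])
      have s2: "\<sigma> * \<sigma> = 1" using sgn by auto
      have s_ux: "\<sigma> * ux r (x + h) = - N r" "\<sigma> * ux r x = - N r" using d1 d2 by auto
      have "D = \<sigma> * \<gamma> * (P r (x + h) - P r x) - u r (x + h) * (\<sigma> * ux r (x + h)) + u r x * (\<sigma> * ux r x) + \<kappa> * h + e * L"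
        by (simp add: D_def algebra_simps)
      also have "\<dots> = \<sigma> * \<gamma> * (P r (x + h) - P r x) + N r * ((\<sigma> * \<sigma>) * (u r (x + h) - u r x)) + \<kappa> * h + e * L"
        unfolding s_ux s2 by (simp add: algebra_simps)
      \<comment> \<open>At the touching point \<open>F = 0\<close> replaces the increment
        \<open>\<sigma> * (u r (x + h) - u r x)\<close> by \<open>- N r * h - e\<close>; this is
        where the square of \<open>N r\<close> comes from.\<close>
      also have "(\<sigma> * \<sigma>) * (u r (x + h) - u r x) = \<sigma> * (- N r * h - e)"
        using z' by (simp add: mult.assoc)
      also have "\<sigma> * \<gamma> * (P r (x + h) - P r x) + N r * (\<sigma> * (- N r * h - e)) + \<kappa> * h + e * L =
          \<sigma> * \<gamma> * (P r (x + h) - P r x) - \<sigma> * (N r)\<^sup>2 * h + \<kappa> * h + e * (L - \<sigma> * N r)"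
        by (simp add: algebra_simps power2_eq_square)
      finally have D_eq: "D = \<sigma> * \<gamma> * (P r (x + h) - P r x) - \<sigma> * (N r)\<^sup>2 * h + \<kappa> * h + e * (L - \<sigma> * N r)" .
      have "\<bar>\<gamma> * (P r (x + h) - P r x)\<bar> \<le> \<gamma> * (A * h)"
        using P_bounds(1)[OF r'(1) A[OF r'(3)], of "x + h" x] gamma_pos h by (simp add: abs_mult)
      hence "\<sigma> * (\<gamma> * (P r (x + h) - P r x)) \<ge> - (\<gamma> * A * h)"
        using sgn by (auto simp: abs_le_iff mult.assoc)
      moreover have "0 < (\<kappa> - \<sigma> * (N r)\<^sup>2 - \<gamma> * A) * h"
        using ineq[OF r'(3)] h by (intro mult_pos_pos) (auto simp: N_def)
      moreover have "0 < e * (L - \<sigma> * N r)"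
        using e0 NL[OF r'(3)] Npos[OF r'(3)] sgn by (intro mult_pos_pos) auto
      ultimately have "0 < D" unfolding D_eq by (simp add: algebra_simps)
      with der show "\<exists>D>0. ((\<lambda>t. F t p) has_real_derivative D) (at r)" by blast
    qed (use t xh in auto)
    thus ?thesis by (simp add: F_def)
  qed
  have incr: "0 \<le> \<sigma> * (u t (x + h) - u t x) + N t * h" if xh: "x \<in> {0..1}" "h \<in> {0..1}" for x h
  proof (rule field_le_epsilon)
    fix d :: real assume d: "0 < d"
    from pos[of "d / exp (L * (t - t0))", OF _ xh] d
    show "0 \<le> \<sigma> * (u t (x + h) - u t x) + N t * h + d" by simp
  qed
  show ?thesis
  proof (rule ccontr)
    assume "\<not> ?thesis"
    hence neg: "\<sigma> * ux t x + N t < 0" by (simp add: N_def)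
    have fx: "ux t x = ux t (frac x)" using periodic_frac[where f = "ux t" and x = x] ux_periodic[OF tT] by blast
    have "((\<lambda>y. \<sigma> * u t y + N t * y) has_real_derivative \<sigma> * ux t (frac x) + N t) (at (frac x))"
      by (auto intro!: derivative_eq_intros u_has_derivative tT)
    from DERIV_neg_dec_right[OF this] neg obtain d where d: "d > 0"
      "\<And>h. h > 0 \<Longrightarrow> h < d \<Longrightarrow> \<sigma> * u t (frac x + h) + N t * (frac x + h) < \<sigma> * u t (frac x) + N t * frac x"
      unfolding fx by blast
    define h where "h = min (d / 2) 1"
    have h: "h > 0" "h < d" "h \<in> {0..1}" using d(1) by (auto simp: h_def)
    show False using d(2)[OF h(1,2)] incr[of "frac x" h] h frac_lt_1[of x]
      by (auto simp: algebra_simps less_imp_le)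
  qed
qed

text \<open>How close to \<open>T\<close> the time \<open>t0\<close> has to be depends on
  \<open>\<kappa>\<close>, and \<open>\<kappa>\<close> depends on the bound \<open>A\<close> of
  \<open>u\<close>. So \<open>A\<close> is fixed on \<open>{T / 2..<T}\<close> before
  \<open>t0\<close> is chosen.\<close>

lemma slope_bounded:
  assumes freq: "\<exists>\<^sub>F t in at_left T. \<forall>x. - M \<le> ux t x"
  obtains t0 L where "0 < t0" "t0 < T" "\<And>t x. t \<in> {t0..<T} \<Longrightarrow> \<bar>ux t x\<bar> \<le> L"
proof -
  obtain A where A: "0 < A" "\<And>t x. t \<in> {T / 2..<T} \<Longrightarrow> \<bar>u t x\<bar> \<le> A"
    using u_bounded[of "T / 2"] T_pos by auto
  define M' where "M' = max M 1"
  have M': "M \<le> M'" "1 \<le> M'" by (auto simp: M'_def)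
  \<comment> \<open>While \<open>\<kappa> * (t - t0) \<le> M'\<close> the barrier stays below
    \<open>2 * M'\<close>. Then \<open>4 * M'^2\<close> covers the Riccati square,
    \<open>\<gamma> * A\<close> the source, and 1 makes the inequality strict.\<close>
  define \<kappa> where "\<kappa> = 4 * M'\<^sup>2 + \<gamma> * A + 1"
  have gA: "0 < \<gamma> * A" using gamma_pos A(1) by simp
  have \<kappa>: "0 < \<kappa>" using gA unfolding \<kappa>_def by (intro add_nonneg_pos add_nonneg_nonneg) auto
  define t' where "t' = max (T / 2) (T - M' / \<kappa>)"
  have "t' < T" using T_pos M' \<kappa> by (simp add: t'_def)
  hence "\<forall>\<^sub>F t in at_left T. t \<in> {t'<..<T}" by (rule eventually_at_left_real)
  from frequently_eventually_frequently[OF freq this]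
  obtain t0 where t0: "\<And>x. - M \<le> ux t0 x" "t' < t0" "t0 < T" by (auto dest!: frequently_ex)
  have t0h: "T / 2 < t0" "T - M' / \<kappa> < t0" using t0(2) by (auto simp: t'_def)
  have t0T: "t0 \<in> {0..<T}" "0 < t0" using t0h(1) t0(3) T_pos by auto
  have A': "\<bar>u t x\<bar> \<le> A" if "t \<in> {t0..<T}" for t x using A(2)[of t x] that t0h by auto
  have lower: "- (2 * M') \<le> ux t x" if t: "t \<in> {t0..<T}" for t x
  proof -
    have small: "\<kappa> * (r - t0) \<le> M'" if "r \<in> {t0..t}" for r
    proof -
      have "r - t0 \<le> M' / \<kappa>" using that t t0h(2) by auto
      thus ?thesis using \<kappa> by (simp add: field_simps)
    qed
    have "- (M' + \<kappa> * (t - t0)) \<le> 1 * ux t x"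
    proof (rule slope_bound_propagates[where A = A and ?t1.0 = t])
      show "1 * (M' + \<kappa> * (r - t0))\<^sup>2 + \<gamma> * A < \<kappa>" if r: "r \<in> {t0..t}" for r
      proof -
        have "0 \<le> \<kappa> * (r - t0)" using \<kappa> r by simp
        hence "(M' + \<kappa> * (r - t0))\<^sup>2 \<le> (2 * M')\<^sup>2" using small[OF r] M' by (intro power_mono) auto
        thus ?thesis by (simp add: \<kappa>_def power_mult_distrib)
      qed
      show "- M' \<le> 1 * ux t0 x" for x using t0(1)[of x] M' by simp
    qed (use t t0T t0 M' \<kappa> A' in auto)
    thus ?thesis using small[of t] t by auto
  qed
  define N0 where "N0 = 2 * pi * sob_const * sobolev_norm 2 (u t0) + 1"
  have N0: "\<bar>ux t0 x\<bar> \<le> N0" for x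
    using continuous_sobolev_2_deriv(3)[OF u_sob2[OF t0T(1)] u_cont[OF t0T(1)], of x] by (simp add: N0_def ux_def)
  have N0_pos: "0 < N0"
    using continuous_sobolev_2_deriv(3)[OF u_sob2[OF t0T(1)] u_cont[OF t0T(1)], of 0] by (simp add: N0_def)
  \<comment> \<open>For the upper bound the square has the favourable sign, so
    \<open>\<kappa> = \<gamma> * A + 1\<close> works whatever the size of \<open>N0\<close> and the
    distance to \<open>T\<close>.\<close>
  have upper: "ux t x \<le> N0 + (\<gamma> * A + 1) * T" if t: "t \<in> {t0..<T}" for t x
  proof -
    have "- (N0 + (\<gamma> * A + 1) * (t - t0)) \<le> (-1) * ux t x"
    proof (rule slope_bound_propagates[where A = A and ?t1.0 = t])
      show "-1 * (N0 + (\<gamma> * A + 1) * (r - t0))\<^sup>2 + \<gamma> * A < \<gamma> * A + 1" for r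
        using zero_le_power2[of "N0 + (\<gamma> * A + 1) * (r - t0)"] by linarith
      show "- N0 \<le> (-1) * ux t0 x" for x using N0[of x] by simp
    qed (use t t0T t0 N0_pos gA A' in auto)
    moreover have "(\<gamma> * A + 1) * (t - t0) \<le> (\<gamma> * A + 1) * T" using t t0T gA by (intro mult_left_mono) auto
    ultimately show ?thesis by simp
  qed
  show thesis
  proof (rule that[of t0 "max (2 * M') (N0 + (\<gamma> * A + 1) * T)"])
    show "\<bar>ux t x\<bar> \<le> max (2 * M') (N0 + (\<gamma> * A + 1) * T)" if "t \<in> {t0..<T}" for t x
      using lower[OF that, of x] upper[OF that, of x] by (auto simp: abs_le_iff)
  qed (use t0T t0 in auto)
qed

end

section \<open>The \<open>H\<^sup>2\<close> estimate\<close>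

text \<open>
  The energy \<open>E\<close> is only known to be continuous in time.  The inequality \<open>E' \<le> K E\<close> is replaced
  by \<open>F\<^sub>i' \<le> K E\<close> for differentiable approximations \<open>F\<^sub>i\<close> of \<open>E\<close> from below.
\<close>

lemma gronwall_from_below:
  fixes E :: "real \<Rightarrow> real" and F D :: "'i \<Rightarrow> real \<Rightarrow> real"
  assumes cont: "continuous_on {t0..t1} E" and K: "0 \<le> K" and E0: "0 \<le> E t0"
    and le: "\<And>i. i \<in> J \<Longrightarrow> F i t0 \<le> E t0"
    and approx: "\<And>t \<delta>. t \<in> {t0..t1} \<Longrightarrow> 0 < \<delta> \<Longrightarrow> \<exists>i\<in>J. E t - \<delta> < F i t"
    and der: "\<And>i t. i \<in> J \<Longrightarrow> t \<in> {t0..t1} \<Longrightarrow> (F i has_real_derivative D i t) (at t)"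
    and D: "\<And>i t. i \<in> J \<Longrightarrow> t \<in> {t0..t1} \<Longrightarrow> D i t \<le> K * E t"
    and t: "t \<in> {t0..t1}"
  shows "E t < (E t0 + 1) * exp ((K + 1) * (t - t0))"
proof (rule ccontr)
  assume neg: "\<not> ?thesis"
  define B where "B = (\<lambda>t. (E t0 + 1) * exp ((K + 1) * (t - t0)))"
  define S where "S = {r \<in> {t0..t1}. B r - E r \<le> 0}"
  have "continuous_on {t0..t1} (\<lambda>r. B r - E r)" unfolding B_def by (intro continuous_intros cont)
  from continuous_closedin_preimage[OF this closed_atMost[of 0]]
  have "closedin (top_of_set {t0..t1}) S" by (simp add: S_def vimage_def Int_def)
  hence cS: "compact S" using closedin_compact compact_Icc by blast
  have "t \<in> S" using neg t by (simp add: S_def B_def)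
  hence "S \<noteq> {}" by auto
  from compact_attains_inf[OF cS this] obtain r where r: "r \<in> S" "\<And>q. q \<in> S \<Longrightarrow> r \<le> q" by blast
  have r01: "r \<in> {t0..t1}" and Br: "B r \<le> E r" using r(1) by (auto simp: S_def)
  have before: "E q \<le> B q" if "q \<in> {t0..<r}" for q
    using r(2)[of q] that r01 by (force simp: S_def)
  have B0: "B t0 = E t0 + 1" by (simp add: B_def)
  have "F i r \<le> B r - 1" if i: "i \<in> J" for i
  proof -
    \<comment> \<open>With this factor \<open>\<kappa> * B\<close> has derivative
      \<open>K * B\<close>, which dominates \<open>D i\<close> up to time \<open>r\<close>. As
      \<open>\<kappa> \<le> 1\<close>, the increase of \<open>F i\<close> is at most
      \<open>B r - B t0\<close>, and the initial margin \<open>B t0 - E t0 = 1\<close> survives for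
      every approximation at once.\<close>
    define \<kappa> where "\<kappa> = K / (K + 1)"
    have \<kappa>: "0 \<le> \<kappa>" "\<kappa> \<le> 1" "\<kappa> * (K + 1) = K" using K by (auto simp: \<kappa>_def)
    have dB: "(B has_real_derivative (K + 1) * B q) (at q)" for q
      unfolding B_def by (auto intro!: derivative_eq_intros)
    have der': "((\<lambda>r. F i r - \<kappa> * B r) has_real_derivative (D i q - K * B q)) (at q)" if "q \<in> {t0..t1}" for q
      using DERIV_diff[OF der[OF i that] DERIV_cmult[OF dB[of q], of \<kappa>]] \<kappa>(3)
      by (simp add: mult.assoc[symmetric])
    have "F i r - \<kappa> * B r \<le> F i t0 - \<kappa> * B t0"
    proof (rule DERIV_nonpos_imp_decreasing_open[where f = "\<lambda>r. F i r - \<kappa> * B r"])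
      show "t0 \<le> r" using r01 by simp
      show "continuous_on {t0..r} (\<lambda>r. F i r - \<kappa> * B r)"
        by (rule continuous_at_imp_continuous_on, rule ballI, rule DERIV_isCont[OF der']) (use r01 in auto)
      fix q assume q: "t0 < q" "q < r"
      have "D i q \<le> K * E q" using D[OF i, of q] q r01 by auto
      also have "\<dots> \<le> K * B q" using before[of q] q K by (intro mult_left_mono) auto
      finally show "\<exists>d. ((\<lambda>r. F i r - \<kappa> * B r) has_real_derivative d) (at q) \<and> d \<le> 0"
        using der'[of q] q r01 by (intro exI[of _ "D i q - K * B q"]) auto
    qed
    moreover have "(1 - \<kappa>) * B t0 \<le> (1 - \<kappa>) * B r"
      using r01 K E0 \<kappa> unfolding B_def by (intro mult_left_mono) auto
    ultimately have "F i r \<le> B r - 1" using le[OF i] B0 by (simp add: algebra_simps)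
    thus ?thesis .
  qed
  moreover obtain i where "i \<in> J" "E r - 1 < F i r" using approx[OF r01, of 1] by auto
  ultimately show False using Br by force
qed

text \<open>Fatou's lemma for sums: a finite partial sum almost exhausts the limit sum, and on it
  convergence is termwise.\<close>

lemma infsum_approx_from_below:
  fixes f :: "'j \<Rightarrow> 'k \<Rightarrow> real"
  assumes lim: "\<And>k. ((\<lambda>j. f j k) \<longlongrightarrow> g k) X"
    and nonneg: "\<And>j k. 0 \<le> f j k" and f: "\<And>j. f j summable_on UNIV" and g: "g summable_on UNIV"
    and \<delta>: "0 < \<delta>"
  shows "\<forall>\<^sub>F j in X. (\<Sum>\<^sub>\<infinity>k. g k) - \<delta> < (\<Sum>\<^sub>\<infinity>k. f j k)"
proof -
  obtain S where S: "finite S" "dist (sum g S) (\<Sum>\<^sub>\<infinity>k. g k) \<le> \<delta> / 2"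
    using infsum_finite_approximation[OF g, of "\<delta> / 2"] \<delta> by auto
  have "((\<lambda>j. sum (f j) S) \<longlongrightarrow> sum g S) X" by (intro tendsto_sum lim)
  hence "\<forall>\<^sub>F j in X. sum g S - \<delta> / 2 < sum (f j) S" by (rule order_tendstoD) (use \<delta> in auto)
  thus ?thesis
  proof eventually_elim
    case (elim j)
    have "sum (f j) S \<le> (\<Sum>\<^sub>\<infinity>k. f j k)" by (intro finite_sum_le_infsum f S nonneg) auto
    moreover have "(\<Sum>\<^sub>\<infinity>k. g k) \<le> sum g S + \<delta> / 2" using S(2) unfolding dist_real_def by linarith
    ultimately show ?case using elim by linarith
  qed
qed

section \<open>Symbols of difference operators\<close>

lemma norm_fexp_minus_1_le: "norm (fexp k h - 1) \<le> 2 * pi * \<bar>of_int k\<bar> * \<bar>h\<bar>"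
proof -
  have "norm (fexp k h - 1) = 2 * \<bar>sin (2 * pi * of_int k * h / 2)\<bar>"
    unfolding fexp_def cis_conv_exp by (rule dist_exp_i_1)
  also have "\<dots> \<le> 2 * \<bar>2 * pi * of_int k * h / 2\<bar>" by (intro mult_left_mono abs_sin_x_le_abs_x) auto
  also have "\<dots> = 2 * pi * \<bar>of_int k\<bar> * \<bar>h\<bar>" by (simp add: abs_mult)
  finally show ?thesis .
qed

text \<open>The symbol of the symmetric second difference is minus the squared modulus of the symbol
  of the first difference, so the estimate and the limit of the latter serve both.\<close>

lemma fexp_second_difference:
  "fexp k h - 2 + fexp k (- h) = - of_real ((norm (fexp k h - 1))\<^sup>2)"
proof -
  have "fexp k (- h) = cnj (fexp k h)" by (simp add: fexp_minus fexp_cnj)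
  moreover have "fexp k h * cnj (fexp k h) = 1"
    using complex_norm_square[of "fexp k h"] by simp
  ultimately show ?thesis
    unfolding complex_norm_square by (simp add: algebra_simps)
qed

lemma norm_fexp_minus_1_limit:
  "((\<lambda>h. norm (fexp k h - 1) / h) \<longlongrightarrow> 2 * pi * \<bar>of_int k\<bar>) (at_right 0)"
proof -
  have "(fexp k has_vector_derivative (2 * pi * \<i> * of_int k * fexp k 0)) (at 0)"
    by (rule has_vector_derivative_fexp)
  hence "((\<lambda>h. norm (fexp k h - 1 - h *\<^sub>R (2 * pi * \<i> * of_int k)) / norm h) \<longlongrightarrow> 0) (at 0)"
    unfolding has_vector_derivative_def has_derivative_iff_norm by simp
  hence l: "((\<lambda>h. norm (fexp k h - 1 - h *\<^sub>R (2 * pi * \<i> * of_int k)) / norm h) \<longlongrightarrow> 0) (at_right 0)"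
    by (rule filterlim_mono) (auto simp: at_le)
  have "((\<lambda>h. norm (fexp k h - 1) / h - 2 * pi * \<bar>of_int k\<bar>) \<longlongrightarrow> 0) (at_right 0)"
  proof (rule Lim_null_comparison[OF _ l])
    show "\<forall>\<^sub>F h in at_right 0. norm (norm (fexp k h - 1) / h - 2 * pi * \<bar>of_int k\<bar>) \<le> norm (fexp k h - 1 - h *\<^sub>R (2 * pi * \<i> * of_int k)) / norm h"
      using eventually_at_right_less[of 0]
    proof eventually_elim
      case (elim h)
      have "\<bar>norm (fexp k h - 1) - norm (h *\<^sub>R (2 * pi * \<i> * of_int k))\<bar> \<le> norm (fexp k h - 1 - h *\<^sub>R (2 * pi * \<i> * of_int k))"
        by (rule norm_triangle_ineq3)
      moreover have "norm (h *\<^sub>R (2 * pi * \<i> * of_int k)) = h * (2 * pi * \<bar>of_int k\<bar>)"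
        using elim by (simp add: norm_mult)
      moreover have "norm (norm (fexp k h - 1) / h - 2 * pi * \<bar>of_int k\<bar>) = \<bar>norm (fexp k h - 1) - h * (2 * pi * \<bar>of_int k\<bar>)\<bar> / h"
      proof -
        have "norm (fexp k h - 1) / h - 2 * pi * \<bar>of_int k\<bar> = (norm (fexp k h - 1) - h * (2 * pi * \<bar>of_int k\<bar>)) / h"
          using elim by (simp add: field_simps)
        thus ?thesis using elim by (simp add: abs_divide)
      qed
      ultimately show ?case using elim by (simp add: divide_right_mono)
    qed
  qed
  thus ?thesis by (simp add: LIM_zero_iff)
qed

lemma integral_periodic_derivative:
  fixes Q q :: "real \<Rightarrow> real"
  assumes "\<And>x. (Q has_real_derivative q x) (at x)" "Q 1 = Q 0"
  shows "(q has_integral 0) {0..1}"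
proof -
  have "(q has_integral (Q 1 - Q 0)) {0..1}"
    by (intro fundamental_theorem_of_calculus)
       (auto simp: has_real_derivative_iff_has_vector_derivative[symmetric] intro: has_field_derivative_at_within assms)
  with assms(2) show ?thesis by simp
qed

text \<open>Stand-in for the second derivative that uses only values of \<open>f\<close>: for fixed
  \<open>h\<close> it inherits the \<open>C^1\<close> regularity of \<open>u\<close> in time and
  space.\<close>

definition second_difference :: "real \<Rightarrow> (real \<Rightarrow> real) \<Rightarrow> real \<Rightarrow> real" where
  "second_difference h f x = (f (x + h) - 2 * f x + f (x - h)) / h\<^sup>2"

lemma second_difference_has_derivative:
  assumes "\<And>x. (f has_real_derivative f' x) (at x)"
  shows "(second_difference h f has_real_derivative second_difference h f' x) (at x)"
proof -
  have "((\<lambda>x. f (x + c)) has_real_derivative f' (x + c)) (at x)" for c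
    using assms[of "x + c"] by (simp add: DERIV_shift)
  from this[of h] this[of "- h"]
  have "((\<lambda>x. f (x + h)) has_real_derivative f' (x + h)) (at x)" "((\<lambda>x. f (x - h)) has_real_derivative f' (x - h)) (at x)"
    by simp_all
  thus ?thesis unfolding second_difference_def[abs_def]
    by (intro DERIV_cdivide DERIV_add DERIV_diff DERIV_cmult assms)
qed

lemma second_difference_periodic:
  assumes "\<And>x. f (x + 1) = f x"
  shows "second_difference h f 1 = second_difference h f 0"
proof -
  have "f (1 + h) = f h" "f (1 - h) = f (- h)" "f 1 = f 0"
    using assms[of h] assms[of "- h"] assms[of 0] by (simp_all add: add.commute[of 1 h])
  thus ?thesis by (simp add: second_difference_def)
qed

lemma continuous_second_difference:
  assumes "continuous_on UNIV f"
  shows "continuous_on S (second_difference h f)"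
  unfolding second_difference_def[abs_def]
  by (auto intro!: continuous_intros continuous_on_compose2[OF assms] simp: divide_inverse)

text \<open>Discrete Leibniz rule; the cross term consists of products of first differences to
  either side. Only numerators are compared, so \<open>h\<close> may be arbitrary.\<close>

lemma second_difference_product:
  "second_difference h (\<lambda>x. f x * g x) x =
     f x * second_difference h g x + g x * second_difference h f x +
     ((f (x + h) - f x) * (g (x + h) - g x) + (f (x - h) - f x) * (g (x - h) - g x)) / h\<^sup>2"
proof -
  have *: "A / z = f * (B / z) + g * (C / z) + D / z" if "A = f * B + g * C + D" for A B C D f g z :: real
    using that by (simp add: add_divide_distrib)
  show ?thesis unfolding second_difference_def by (rule *) (simp add: algebra_simps)
qed

context ostrovsky_hunter
begin

text \<open>The squared \<open>L\<^sup>2\<close> norm of \<open>u\<^sub>x\<^sub>x\<close>.\<close>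

definition curvature :: "real \<Rightarrow> real" where
  "curvature t = (2 * pi) ^ 4 * energy 2 t"

lemma curvature_has_sum:
  assumes "t \<in> {0..<T}"
  shows "((\<lambda>k. ((2 * pi * of_int k)\<^sup>2 * cmod (a t k))\<^sup>2) has_sum curvature t) UNIV"
proof -
  have "\<bar>of_int k :: real\<bar> powr (2 * 2) = (of_int k) ^ 4" for k
  proof -
    have "\<bar>of_int k :: real\<bar> powr (2 * 2) = \<bar>of_int k\<bar> powr (real 4)" by simp
    also have "\<dots> = \<bar>of_int k\<bar> ^ 4"
    proof (cases "k = 0")
      case False
      thus ?thesis by (intro powr_realpow) simp
    qed simp
    finally show ?thesis by simp
  qed
  hence e: "((2 * pi * of_int k)\<^sup>2 * cmod (a t k))\<^sup>2 = (2 * pi) ^ 4 * (\<bar>of_int k\<bar> powr (2 * 2) * (cmod (a t k))\<^sup>2)" for k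
    by (simp add: power_mult_distrib power_mult[symmetric])
  show ?thesis unfolding e curvature_def energy_def
    by (intro has_sum_cmult_right has_sum_infsum energy_summable assms) (use s_ge_2 in auto)
qed

lemma integral_series_square_le:
  assumes t: "t \<in> {0..<T}" and c: "abs_summable c"
    and rep: "\<And>x. fser c x = of_real (f x)"
    and le: "\<And>k. cmod (c k) \<le> (2 * pi * of_int k)\<^sup>2 * cmod (a t k)"
  shows "integral {0..1} (\<lambda>x. (f x)\<^sup>2) \<le> curvature t"
proof -
  have "((\<lambda>k. (cmod (c k))\<^sup>2) has_sum integral {0..1} (\<lambda>x. (f x)\<^sup>2)) UNIV"
    using fser_Parseval[OF c] by (simp add: rep)
  thus ?thesis
    by (rule has_sum_mono[OF _ curvature_has_sum[OF t]]) (intro power_mono le, auto)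
qed

text \<open>The symbol \<open>(fexp k h - 1) / h\<close> has modulus at most
  \<open>2 * pi * \<bar>k\<bar>\<close>, so the difference quotients of \<open>ux\<close> are
  controlled in \<open>L^2\<close> uniformly in \<open>h\<close>.\<close>

lemma integral_slope_difference_le:
  assumes t: "t \<in> {0..<T}" and h: "h \<noteq> 0"
  shows "integral {0..1} (\<lambda>x. ((ux t (x + h) - ux t x) / h)\<^sup>2) \<le> curvature t"
proof (rule integral_series_square_le[OF t])
  let ?d = "\<lambda>k. 2 * pi * \<i> * of_int k * a t k"
  let ?c = "\<lambda>k. ?d k * ((fexp k h - 1) / of_real h)"
  have d: "abs_summable ?d" by (rule abs_summable_deriv(2)[OF ka_summable[OF t]])
  have le: "norm ((fexp k h - 1) / of_real h) \<le> 2 * pi * \<bar>of_int k\<bar>" for k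
    using norm_fexp_minus_1_le[of k h] h by (simp add: norm_divide divide_le_eq)
  show "cmod (?c k) \<le> (2 * pi * of_int k)\<^sup>2 * cmod (a t k)" for k
  proof -
    have "cmod (?c k) \<le> norm (?d k) * (2 * pi * \<bar>of_int k\<bar>)"
      unfolding norm_mult[of "?d k"] by (intro mult_left_mono le) auto
    thus ?thesis by (simp add: norm_mult power2_eq_square algebra_simps)
  qed
  show "abs_summable ?c"
  proof (rule summable_on_comparison_test)
    show "(\<lambda>k. norm (?d k) * (2 / \<bar>h\<bar>)) summable_on UNIV" by (intro summable_on_cmult_left d)
    have "norm (fexp k h - 1) \<le> 2" for k using norm_triangle_ineq4[of "fexp k h" 1] by simp
    hence "norm ((fexp k h - 1) / of_real h) \<le> 2 / \<bar>h\<bar>" for k using h by (simp add: norm_divide divide_right_mono)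
    thus "norm (?c k) \<le> norm (?d k) * (2 / \<bar>h\<bar>)" for k
      unfolding norm_mult[of "?d k"] by (intro mult_left_mono) auto
  qed auto
  show "fser ?c x = complex_of_real ((ux t (x + h) - ux t x) / h)" for x
  proof -
    have "((\<lambda>k. (?d k * fexp k (x + h) + - (?d k * fexp k x)) * inverse (of_real h)) has_sum (of_real (ux t (x + h)) + - of_real (ux t x)) * inverse (of_real h)) UNIV"
      unfolding ux_series[OF t, symmetric]
      by (intro has_sum_cmult_left has_sum_add has_sum_uminusI fser_has_sum d)
    moreover have "(?d k * fexp k (x + h) + - (?d k * fexp k x)) * inverse (of_real h) = ?c k * fexp k x" for k
      by (simp add: fexp_shift divide_inverse algebra_simps)
    ultimately have "((\<lambda>k. ?c k * fexp k x) has_sum (of_real (ux t (x + h)) + - of_real (ux t x)) * inverse (of_real h)) UNIV"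
      by (simp only:)
    from infsumI[OF this] show ?thesis unfolding fser_def by (simp add: divide_inverse)
  qed
qed

lemma second_difference_u:
  assumes t: "t \<in> {0..<T}" and h: "h \<noteq> 0"
  shows "((\<lambda>k. ((norm (fexp k h - 1) / h)\<^sup>2 * cmod (a t k))\<^sup>2) has_sum
           integral {0..1} (\<lambda>x. (second_difference h (u t) x)\<^sup>2)) UNIV"
proof -
  let ?c = "\<lambda>k. a t k * ((fexp k h - 2 + fexp k (- h)) / of_real (h\<^sup>2))"
  have c_norm: "norm (?c k) = (norm (fexp k h - 1) / h)\<^sup>2 * cmod (a t k)" for k
    unfolding fexp_second_difference by (simp add: norm_mult norm_divide norm_power power_divide)
  have c: "abs_summable ?c"
  proof (rule summable_on_comparison_test)
    show "(\<lambda>k. (2 / \<bar>h\<bar>)\<^sup>2 * norm (a t k)) summable_on UNIV" by (intro summable_on_cmult_right a_summable t)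
    have "norm (fexp k h - 1) \<le> 2" for k using norm_triangle_ineq4[of "fexp k h" 1] by simp
    hence "(norm (fexp k h - 1) / \<bar>h\<bar>)\<^sup>2 \<le> (2 / \<bar>h\<bar>)\<^sup>2" for k by (intro power_mono divide_right_mono) auto
    thus "norm (?c k) \<le> (2 / \<bar>h\<bar>)\<^sup>2 * norm (a t k)" for k
      unfolding c_norm by (intro mult_right_mono) (auto simp: power_divide)
  qed auto
  have "fser ?c x = complex_of_real (second_difference h (u t) x)" for x
  proof -
    have "((\<lambda>k. (a t k * fexp k (x + h) + (- 2) * (a t k * fexp k x) + a t k * fexp k (x + - h)) * inverse (of_real (h\<^sup>2))) has_sum (of_real (u t (x + h)) + (- 2) * of_real (u t x) + of_real (u t (x + - h))) * inverse (of_real (h\<^sup>2))) UNIV"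
      unfolding u_series[OF t, symmetric]
      by (intro has_sum_cmult_left has_sum_add has_sum_cmult_right fser_has_sum a_summable t)
    moreover have "(a t k * fexp k (x + h) + (- 2) * (a t k * fexp k x) + a t k * fexp k (x + - h)) * inverse (of_real (h\<^sup>2)) = ?c k * fexp k x" for k
      unfolding fexp_shift by (simp add: divide_inverse algebra_simps)
    ultimately have "((\<lambda>k. ?c k * fexp k x) has_sum (of_real (u t (x + h)) + (- 2) * of_real (u t x) + of_real (u t (x + - h))) * inverse (of_real (h\<^sup>2))) UNIV"
      by (simp only:)
    from infsumI[OF this] show ?thesis unfolding fser_def by (simp add: divide_inverse second_difference_def)
  qed
  with fser_Parseval[OF c] show ?thesis unfolding c_norm by simp
qed

lemma second_difference_le:
  assumes t: "t \<in> {0..<T}" and h: "h \<noteq> 0"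
  shows "integral {0..1} (\<lambda>x. (second_difference h (u t) x)\<^sup>2) \<le> curvature t"
proof (rule has_sum_mono[OF second_difference_u[OF t h] curvature_has_sum[OF t]])
  fix k
  have "norm (fexp k h - 1) / \<bar>h\<bar> \<le> 2 * pi * \<bar>of_int k\<bar>"
    using norm_fexp_minus_1_le[of k h] h by (simp add: divide_le_eq)
  hence "(norm (fexp k h - 1) / \<bar>h\<bar>)\<^sup>2 \<le> (2 * pi * \<bar>of_int k\<bar>)\<^sup>2" by (intro power_mono) auto
  hence "(norm (fexp k h - 1) / h)\<^sup>2 * cmod (a t k) \<le> (2 * pi * of_int k)\<^sup>2 * cmod (a t k)"
    by (intro mult_right_mono) (auto simp: power_divide power_mult_distrib)
  thus "((norm (fexp k h - 1) / h)\<^sup>2 * cmod (a t k))\<^sup>2 \<le> ((2 * pi * of_int k)\<^sup>2 * cmod (a t k))\<^sup>2"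
    by (intro power_mono) auto
qed

text \<open>Together with \<open>second_difference_le\<close> this makes the curvature the supremum
  over \<open>h > 0\<close>, which is the form that the Gronwall argument requires.\<close>

lemma second_difference_approx:
  assumes t: "t \<in> {0..<T}" and \<delta>: "0 < \<delta>"
  shows "\<exists>h\<in>{0<..}. curvature t - \<delta> < integral {0..1} (\<lambda>x. (second_difference h (u t) x)\<^sup>2)"
proof -
  \<comment> \<open>Set to 0 for \<open>h \<le> 0\<close>, because
    \<open>infsum_approx_from_below\<close> asks for summability at every index.\<close>
  define f where "f = (\<lambda>h k. if h > 0 then ((norm (fexp k h - 1) / h)\<^sup>2 * cmod (a t k))\<^sup>2 else 0)"
  have "\<forall>\<^sub>F h in at_right 0. (\<Sum>\<^sub>\<infinity>k. ((2 * pi * of_int k)\<^sup>2 * cmod (a t k))\<^sup>2) - \<delta> < (\<Sum>\<^sub>\<infinity>k. f h k)"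
  proof (rule infsum_approx_from_below[OF _ _ _ _ \<delta>])
    show "((\<lambda>h. f h k) \<longlongrightarrow> ((2 * pi * of_int k)\<^sup>2 * cmod (a t k))\<^sup>2) (at_right 0)" for k
    proof (rule Lim_transform_eventually)
      have "((\<lambda>h. ((norm (fexp k h - 1) / h)\<^sup>2 * cmod (a t k))\<^sup>2) \<longlongrightarrow> ((2 * pi * \<bar>of_int k\<bar>)\<^sup>2 * cmod (a t k))\<^sup>2) (at_right 0)"
        by (intro tendsto_intros norm_fexp_minus_1_limit)
      thus "((\<lambda>h. ((norm (fexp k h - 1) / h)\<^sup>2 * cmod (a t k))\<^sup>2) \<longlongrightarrow> ((2 * pi * of_int k)\<^sup>2 * cmod (a t k))\<^sup>2) (at_right 0)"
        by (simp add: power_mult_distrib)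
      show "\<forall>\<^sub>F h in at_right 0. ((norm (fexp k h - 1) / h)\<^sup>2 * cmod (a t k))\<^sup>2 = f h k"
        using eventually_at_right_less[of 0] by eventually_elim (simp add: f_def)
    qed
    show "f h summable_on UNIV" for h
      using has_sum_imp_summable[OF second_difference_u[OF t]] by (cases "h > 0") (auto simp: f_def)
    show "(\<lambda>k. ((2 * pi * of_int k)\<^sup>2 * cmod (a t k))\<^sup>2) summable_on UNIV"
      by (rule has_sum_imp_summable[OF curvature_has_sum[OF t]])
  qed (simp add: f_def)
  hence "\<forall>\<^sub>F h in at_right 0. h > 0 \<and> (\<Sum>\<^sub>\<infinity>k. ((2 * pi * of_int k)\<^sup>2 * cmod (a t k))\<^sup>2) - \<delta> < (\<Sum>\<^sub>\<infinity>k. f h k)"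
    using eventually_at_right_less[of 0] by eventually_elim auto
  then obtain h where h: "h > 0" "(\<Sum>\<^sub>\<infinity>k. ((2 * pi * of_int k)\<^sup>2 * cmod (a t k))\<^sup>2) - \<delta> < (\<Sum>\<^sub>\<infinity>k. f h k)"
    using eventually_happens'[OF trivial_limit_at_right_real] by blast
  have "(\<Sum>\<^sub>\<infinity>k. f h k) = integral {0..1} (\<lambda>x. (second_difference h (u t) x)\<^sup>2)"
    using h(1) infsumI[OF second_difference_u[OF t, of h]] by (simp add: f_def)
  thus ?thesis using h infsumI[OF curvature_has_sum[OF t]] by auto
qed

text \<open>For \<open>0 < t\<close> the time derivative of \<open>u\<close>, by
  \<open>u_time_derivative\<close>; as a formula in \<open>u\<close>, \<open>ux\<close> and
  \<open>P\<close> it is visibly jointly continuous.\<close>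

definition ut :: "real \<Rightarrow> real \<Rightarrow> real" where
  "ut t x = \<gamma> * P t x - u t x * ux t x"

lemma second_difference_integral_derivative:
  assumes t: "t \<in> {0<..<T}"
  shows "((\<lambda>t. integral {0..1} (\<lambda>x. (second_difference h (u t) x)\<^sup>2)) has_real_derivative
     integral {0..1} (\<lambda>x. 2 * second_difference h (u t) x * second_difference h (ut t) x)) (at t)"
proof -
  have "((\<lambda>t. integral (cbox 0 1) (\<lambda>x. (second_difference h (u t) x)\<^sup>2)) has_real_derivative
     integral (cbox 0 1) (\<lambda>x. 2 * second_difference h (u t) x * second_difference h (ut t) x)) (at t within {0<..<T})"
  proof (rule leibniz_rule_field_derivative[where U = "{0<..<T}"])
    fix r x assume r: "r \<in> {0<..<T}"
    have "((\<lambda>r. second_difference h (u r) x) has_real_derivative second_difference h (ut r) x) (at r)"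
      unfolding second_difference_def ut_def
      by (intro DERIV_cdivide DERIV_add DERIV_diff DERIV_cmult u_time_derivative r)
    hence "((\<lambda>r. (second_difference h (u r) x)\<^sup>2) has_real_derivative 2 * second_difference h (u r) x * second_difference h (ut r) x) (at r)"
      by (auto intro!: derivative_eq_intros)
    thus "((\<lambda>r. (second_difference h (u r) x)\<^sup>2) has_real_derivative 2 * second_difference h (u r) x * second_difference h (ut r) x) (at r within {0<..<T})"
      by (rule has_field_derivative_at_within)
  next
    fix r assume r: "r \<in> {0<..<T}"
    have "continuous_on UNIV (u r)" using r by (intro u_cont) auto
    hence "continuous_on {0..1} (\<lambda>x. (second_difference h (u r) x)\<^sup>2)"
      by (intro continuous_intros continuous_second_difference)
    thus "(\<lambda>x. (second_difference h (u r) x)\<^sup>2) integrable_on cbox 0 1"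
      by (simp add: integrable_continuous_interval)
  next
    show "continuous_on ({0<..<T} \<times> cbox 0 1) (\<lambda>(t, x). 2 * second_difference h (u t) x * second_difference h (ut t) x)"
      unfolding second_difference_def ut_def case_prod_beta divide_inverse
      by (intro continuous_intros continuous_on_compose_pair[OF continuous_u]
          continuous_on_compose_pair[OF continuous_ux] continuous_on_compose_pair[OF continuous_P]) auto
  qed (use t in auto)
  thus ?thesis using t by (simp add: at_within_open[of t "{0<..<T}"])
qed

text \<open>
  With \<open>w\<close> and \<open>p\<close> the second differences of \<open>u\<close> and \<open>P\<close>, the integrand is \<open>(\<gamma> p\<^sup>2 - u w\<^sup>2)\<^sub>x\<close> up to
  terms without derivatives of \<open>w\<close>; in particular \<open>\<gamma>\<close> does not contribute.
\<close>

lemma second_difference_integral_derivative_le: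
  assumes t: "t \<in> {0<..<T}" and h: "0 < h" and L: "\<And>x. \<bar>ux t x\<bar> \<le> L"
  shows "integral {0..1} (\<lambda>x. 2 * second_difference h (u t) x * second_difference h (ut t) x) \<le> 5 * L * curvature t"
proof -
  have t': "t \<in> {0..<T}" using t by auto
  have L0: "0 \<le> L" using L[of 0] by linarith
  define w where "w = second_difference h (u t)"
  define wx where "wx = second_difference h (ux t)"
  define p where "p = second_difference h (P t)"
  define D where "D = (\<lambda>h x. (ux t (x + h) - ux t x) / h)"
  have cu: "continuous_on UNIV (u t)" and cux: "continuous_on UNIV (ux t)" and cP: "continuous_on UNIV (P t)"
    by (intro continuous_u_slice continuous_ux_slice continuous_P_slice t')+
  have cw: "continuous_on S w" and cp: "continuous_on S p" and cwx: "continuous_on S wx" for S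
    unfolding w_def p_def wx_def by (intro continuous_second_difference cu cP cux)+
  have cD: "continuous_on S (D h)" for S h
    unfolding D_def divide_inverse
    by (intro continuous_intros continuous_on_compose2[OF cux]) auto
  have dw: "(w has_real_derivative wx x) (at x)" for x
    unfolding w_def wx_def by (intro second_difference_has_derivative u_has_derivative t')
  have dp: "(p has_real_derivative w x) (at x)" for x
    unfolding w_def p_def by (intro second_difference_has_derivative P_has_derivative t)
  define Q where "Q = (\<lambda>x. \<gamma> * (p x)\<^sup>2 - u t x * (w x)\<^sup>2)"
  define q where "q = (\<lambda>x. 2 * \<gamma> * p x * w x - (ux t x * (w x)\<^sup>2 + 2 * u t x * w x * wx x))"
  have q0: "(q has_integral 0) {0..1}"
  proof (rule integral_periodic_derivative)
    show "(Q has_real_derivative q x) (at x)" for x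
      unfolding Q_def q_def
      by (auto intro!: derivative_eq_intros dw dp u_has_derivative t' simp: algebra_simps)
    have "w 1 = w 0" "p 1 = p 0" "u t 1 = u t 0"
      unfolding w_def p_def using u_periodic[OF t', of 0] by (auto intro!: second_difference_periodic u_periodic P_periodic t')
    thus "Q 1 = Q 0" by (simp add: Q_def)
  qed
  \<comment> \<open>Origin of the factor 5: one \<open>L * w^2\<close> comes from
    \<open>ux * w^2\<close>, two more from the cross terms, and each of the two quotients
    \<open>D h\<close> and \<open>D (- h)\<close> adds one \<open>L * D^2\<close>. Every one of
    these integrals is at most the curvature.\<close>
  define R where "R = (\<lambda>x. 3 * L * (w x)\<^sup>2 + L * (D h x)\<^sup>2 + L * (D (- h) x)\<^sup>2)"
  have point: "2 * w x * second_difference h (ut t) x - q x \<le> R x" for x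
  proof -
    define S where "S = ((u t (x + h) - u t x) * (ux t (x + h) - ux t x) + (u t (x - h) - u t x) * (ux t (x - h) - ux t x)) / h\<^sup>2"
    have "second_difference h (ut t) x = \<gamma> * p x - second_difference h (\<lambda>x. u t x * ux t x) x"
      unfolding second_difference_def ut_def p_def by (simp add: diff_divide_distrib add_divide_distrib algebra_simps)
    also have "\<dots> = \<gamma> * p x - (u t x * wx x + ux t x * w x + S)"
      unfolding second_difference_product w_def wx_def S_def ..
    finally have "2 * w x * second_difference h (ut t) x - q x =
        2 * w x * (\<gamma> * p x - (u t x * wx x + ux t x * w x + S)) - q x" by simp
    also have "\<dots> = - (ux t x * (w x)\<^sup>2) - 2 * w x * S"
      by (simp add: q_def algebra_simps power2_eq_square)
    finally have "2 * w x * second_difference h (ut t) x - q x = - (ux t x * (w x)\<^sup>2) - 2 * w x * S" .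
    moreover have "- (ux t x * (w x)\<^sup>2) \<le> L * (w x)\<^sup>2"
      using mult_right_mono[of "- ux t x" L "(w x)\<^sup>2"] L[of x] by (auto simp: abs_le_iff)
    moreover have "- 2 * w x * S \<le> 2 * L * (w x)\<^sup>2 + L * (D h x)\<^sup>2 + L * (D (- h) x)\<^sup>2"
    proof -
      have lip: "\<bar>u t (x + k) - u t x\<bar> \<le> L * \<bar>k\<bar>" for k
        using field_differentiable_bound[of UNIV "u t" "ux t" L "x + k" x] u_has_derivative[OF t'] L by auto
      \<comment> \<open>In each product of first differences the factor from \<open>u\<close> is at
        most \<open>L * \<bar>k\<bar>\<close>, while the factor from \<open>ux\<close> stays a
        quotient \<open>D\<close> measured in \<open>L^2\<close>;
        \<open>2 * \<bar>w\<bar> * \<bar>D\<bar> \<le> w^2 + D^2\<close> separates it from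
        \<open>w\<close>.\<close>
      have summand: "- 2 * w x * ((u t (x + k) - u t x) * (ux t (x + k) - ux t x) / k\<^sup>2) \<le> L * (w x)\<^sup>2 + L * (D k x)\<^sup>2"
        if k: "k \<noteq> 0" for k
      proof -
        define m where "m = (u t (x + k) - u t x) / k"
        have m: "\<bar>m\<bar> \<le> L" using lip[of k] k by (simp add: m_def abs_divide divide_le_eq)
        have "(u t (x + k) - u t x) * (ux t (x + k) - ux t x) / k\<^sup>2 = m * D k x"
          using k by (simp add: m_def D_def power2_eq_square)
        moreover have "- 2 * w x * (m * D k x) \<le> \<bar>m\<bar> * ((w x)\<^sup>2 + (D k x)\<^sup>2)"
        proof -
          have "2 * \<bar>w x\<bar> * \<bar>D k x\<bar> \<le> (w x)\<^sup>2 + (D k x)\<^sup>2"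
            using zero_le_power2[of "\<bar>w x\<bar> - \<bar>D k x\<bar>"] by (simp add: power2_diff)
          hence "\<bar>m\<bar> * (2 * \<bar>w x\<bar> * \<bar>D k x\<bar>) \<le> \<bar>m\<bar> * ((w x)\<^sup>2 + (D k x)\<^sup>2)" by (intro mult_left_mono) auto
          moreover have "- 2 * w x * (m * D k x) \<le> \<bar>- 2 * w x * (m * D k x)\<bar>" by (rule abs_ge_self)
          moreover have "\<bar>- 2 * w x * (m * D k x)\<bar> = \<bar>m\<bar> * (2 * \<bar>w x\<bar> * \<bar>D k x\<bar>)" by (simp add: abs_mult)
          ultimately show ?thesis by linarith
        qed
        moreover have "\<bar>m\<bar> * ((w x)\<^sup>2 + (D k x)\<^sup>2) \<le> L * ((w x)\<^sup>2 + (D k x)\<^sup>2)"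
          by (intro mult_right_mono m) auto
        ultimately show ?thesis by (simp add: distrib_left)
      qed
      have "- 2 * w x * S = - 2 * w x * ((u t (x + h) - u t x) * (ux t (x + h) - ux t x) / h\<^sup>2)
          + - 2 * w x * ((u t (x + - h) - u t x) * (ux t (x + - h) - ux t x) / (- h)\<^sup>2)"
        unfolding S_def add_divide_distrib distrib_left by simp
      with summand[of h] summand[of "- h"] h show ?thesis by simp
    qed
    ultimately show ?thesis by (simp add: R_def)
  qed
  have int: "(\<lambda>x. 2 * w x * second_difference h (ut t) x) integrable_on {0..1}"
  proof -
    have "continuous_on UNIV (ut t)" unfolding ut_def[abs_def] by (intro continuous_intros cu cux cP)
    thus ?thesis by (intro integrable_continuous_interval continuous_intros cw continuous_second_difference)
  qed
  have R: "(R has_integral (3 * L * integral {0..1} (\<lambda>x. (w x)\<^sup>2) + L * integral {0..1} (\<lambda>x. (D h x)\<^sup>2) + L * integral {0..1} (\<lambda>x. (D (- h) x)\<^sup>2))) {0..1}"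
    unfolding R_def
    by (intro has_integral_add has_integral_mult_right integrable_integral integrable_continuous_interval continuous_intros cw cD)
  have "integral {0..1} (\<lambda>x. 2 * w x * second_difference h (ut t) x) - 0 \<le>
     3 * L * integral {0..1} (\<lambda>x. (w x)\<^sup>2) + L * integral {0..1} (\<lambda>x. (D h x)\<^sup>2) + L * integral {0..1} (\<lambda>x. (D (- h) x)\<^sup>2)"
    by (rule has_integral_le[OF has_integral_diff[OF integrable_integral[OF int] q0] R]) (rule point)
  also have "\<dots> \<le> 3 * L * curvature t + L * curvature t + L * curvature t"
    unfolding w_def D_def
    by (intro add_mono mult_left_mono second_difference_le integral_slope_difference_le t') (use h L0 in auto)
  finally show ?thesis by (simp add: w_def)
qed

text \<open>The approximations from below are indexed by all steps \<open>h > 0\<close>; their rate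
  \<open>5 * L\<close> does not depend on \<open>h\<close>.\<close>

lemma energy_2_bounded:
  assumes t0: "0 < t0" "t0 < T" and L: "\<And>t x. t \<in> {t0..<T} \<Longrightarrow> \<bar>ux t x\<bar> \<le> L"
  obtains C where "\<And>t. t \<in> {t0..<T} \<Longrightarrow> energy 2 t \<le> C"
proof -
  have L0: "0 \<le> L" using L[of t0 0] t0 by force
  define B where "B = (curvature t0 + 1) * exp ((5 * L + 1) * (T - t0))"
  have cn: "0 \<le> curvature r" for r by (simp add: curvature_def energy_nonneg)
  have bound: "curvature t \<le> B" if t: "t \<in> {t0..<T}" for t
  proof -
    have "curvature t < (curvature t0 + 1) * exp ((5 * L + 1) * (t - t0))"
    proof (rule gronwall_from_below[where J = "{0<..}" and ?t1.0 = t and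
          F = "\<lambda>h t. integral {0..1} (\<lambda>x. (second_difference h (u t) x)\<^sup>2)" and
          D = "\<lambda>h t. integral {0..1} (\<lambda>x. 2 * second_difference h (u t) x * second_difference h (ut t) x)"])
      show "continuous_on {t0..t} curvature"
        unfolding curvature_def using t t0 s_ge_2
        by (intro continuous_intros continuous_on_subset[OF continuous_energy]) auto
    qed (use t t0 L L0 cn in \<open>auto intro: second_difference_le second_difference_approx second_difference_integral_derivative second_difference_integral_derivative_le\<close>)
    also have "\<dots> \<le> B"
      unfolding B_def using t L0 cn[of t0] by (intro mult_left_mono) auto
    finally show ?thesis by simp
  qed
  have "energy 2 t \<le> B / (2 * pi) ^ 4" if "t \<in> {t0..<T}" for t
    using bound[OF that] by (simp add: curvature_def field_simps)
  thus thesis by (rule that)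
qed

end

section \<open>The \<open>H\<^sup>s\<close> estimate\<close>

lemma nonneg_summable_on_product_le:
  fixes f :: "'a \<times> 'b \<Rightarrow> real"
  assumes nonneg: "\<And>p. 0 \<le> f p"
    and p: "p summable_on UNIV" "\<And>i. 0 \<le> p i"
    and rows: "\<And>i B. finite B \<Longrightarrow> (\<Sum>j\<in>B. f (i, j)) \<le> p i * q"
    and q: "0 \<le> q"
  shows "f summable_on UNIV" and "infsum f UNIV \<le> infsum p UNIV * q"
proof -
  have fin: "sum f F \<le> infsum p UNIV * q" if "finite F" for F
  proof -
    have "sum f F \<le> sum f (fst ` F \<times> snd ` F)"
      by (rule sum_mono2[OF _ subset_fst_snd]) (use that nonneg in auto)
    also have "\<dots> = (\<Sum>i\<in>fst ` F. \<Sum>j\<in>snd ` F. f (i, j))" by (simp add: sum.cartesian_product)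
    also have "\<dots> \<le> (\<Sum>i\<in>fst ` F. p i * q)" by (intro sum_mono rows) (use that in auto)
    also have "\<dots> = (\<Sum>i\<in>fst ` F. p i) * q" by (simp add: sum_distrib_right)
    also have "\<dots> \<le> infsum p UNIV * q"
      by (intro mult_right_mono q finite_sum_le_infsum p) (use that in auto)
    finally show ?thesis .
  qed
  show s: "f summable_on UNIV"
    by (rule nonneg_bdd_above_summable_on) (use fin nonneg in \<open>auto intro!: bdd_aboveI\<close>)
  show "infsum f UNIV \<le> infsum p UNIV * q"
    by (rule infsum_le_finite_sums[OF s fin])
qed

text \<open>Young's inequality: for fixed \<open>i\<close> the sum over \<open>j\<close> is the
  inner product of \<open>c\<close> with a translate of itself, and Cauchy-Schwarz bounds it
  independently of \<open>i\<close>.\<close>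

lemma trilinear_convolution:
  fixes p c :: "int \<Rightarrow> real"
  assumes p: "p summable_on UNIV" "\<And>i. 0 \<le> p i"
    and c: "(\<lambda>i. (c i)\<^sup>2) summable_on UNIV" "\<And>i. 0 \<le> c i"
  shows "(\<lambda>(i, j). p i * c j * c (i + j)) summable_on UNIV"
    and "(\<Sum>\<^sub>\<infinity>(i, j). p i * c j * c (i + j)) \<le> (\<Sum>\<^sub>\<infinity>i. p i) * (\<Sum>\<^sub>\<infinity>i. (c i)\<^sup>2)"
proof -
  let ?S = "\<Sum>\<^sub>\<infinity>i. (c i)\<^sup>2"
  have S0: "0 \<le> ?S" by (intro infsum_nonneg) auto
  have row: "(\<Sum>j\<in>B. (\<lambda>(i, j). p i * c j * c (i + j)) (i, j)) \<le> p i * ?S" if B: "finite B" for i B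
  proof -
    have bij: "bij (\<lambda>j. i + j)" by (rule bij_betw_byWitness[where f' = "\<lambda>j. j - i"]) auto
    have s: "(\<lambda>j. (c (i + j))\<^sup>2) summable_on UNIV"
      using summable_on_reindex_bij_betw[OF bij, of "\<lambda>j. (c j)\<^sup>2"] c(1) by simp
    have e: "(\<Sum>\<^sub>\<infinity>j. (c (i + j))\<^sup>2) = ?S"
      using infsum_reindex_bij_betw[OF bij, of "\<lambda>j. (c j)\<^sup>2"] by simp
    have "(\<Sum>j\<in>B. \<bar>c j * c (i + j)\<bar>) \<le> (\<Sum>\<^sub>\<infinity>j. \<bar>c j * c (i + j)\<bar>)"
      by (intro finite_sum_le_infsum l2_Cauchy_Schwarz(1) c s B) auto
    also have "\<dots> \<le> sqrt ?S * sqrt ?S"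
      using l2_Cauchy_Schwarz(2)[OF c(1) s] unfolding e .
    also have "\<dots> = ?S" using S0 by simp
    finally have "p i * (\<Sum>j\<in>B. \<bar>c j * c (i + j)\<bar>) \<le> p i * ?S" by (intro mult_left_mono p)
    thus ?thesis using c(2) by (simp add: sum_distrib_left mult.assoc)
  qed
  show "(\<lambda>(i, j). p i * c j * c (i + j)) summable_on UNIV"
    by (rule nonneg_summable_on_product_le(1)[OF _ p row S0]) (use p c in auto)
  show "(\<Sum>\<^sub>\<infinity>(i, j). p i * c j * c (i + j)) \<le> (\<Sum>\<^sub>\<infinity>i. p i) * (\<Sum>\<^sub>\<infinity>i. (c i)\<^sup>2)"
    by (rule nonneg_summable_on_product_le(2)[OF _ p row S0]) (use p c in auto)
qed

text \<open>
  The cutoff makes the truncated energy a finite sum, hence differentiable in time.  It is Lipschitz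
  rather than sharp, so that the commutator bound below does not depend on \<open>N\<close>; the bound is in terms
  of the full weight \<open>\<bar>k\<bar>\<^sup>2\<^sup>s\<close> and not of the truncated one.
\<close>

definition cutoff_weight :: "real \<Rightarrow> real \<Rightarrow> int \<Rightarrow> real" where
  "cutoff_weight s N k = \<bar>of_int k\<bar> powr (2 * s) * max 0 (1 - \<bar>of_int k\<bar> / N)"

section \<open>Commutator of the truncated weight\<close>

lemma cutoff_powr_Lipschitz:
  fixes x y p N :: real
  assumes y: "0 < y" "y \<le> x" and p: "1 \<le> p" and N: "0 < N"
  shows "\<bar>x powr p * max 0 (1 - x / N) - y powr p * max 0 (1 - y / N)\<bar> \<le> (p + 1) * x powr (p - 1) * (x - y)"
proof -
  define \<theta> where "\<theta> = (\<lambda>x. max 0 (1 - x / N))"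
  have \<theta>: "0 \<le> \<theta> x" "\<theta> x \<le> 1" using y N by (auto simp: \<theta>_def)
  have pow: "x powr p - y powr p \<le> p * x powr (p - 1) * (x - y)"
  proof (cases "x = y")
    case False
    have "\<exists>z. y < z \<and> z < x \<and> x powr p - y powr p = (x - y) * (p * z powr (p - 1))"
      using y False by (intro MVT2) (auto intro!: derivative_eq_intros)
    then obtain z where z: "y < z" "z < x" "x powr p - y powr p = (x - y) * (p * z powr (p - 1))" by blast
    have "z powr (p - 1) \<le> x powr (p - 1)" using z y p by (intro powr_mono2) auto
    hence "(x - y) * (p * z powr (p - 1)) \<le> (x - y) * (p * x powr (p - 1))"
      using y p by (intro mult_left_mono) auto
    thus ?thesis unfolding z(3) by (simp add: mult_ac)
  qed simp
  have mono: "y powr p \<le> x powr p" using y p by (intro powr_mono2) auto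
  \<comment> \<open>The cutoff has slope \<open>1 / N\<close> and varies only below
    \<open>N\<close>, where \<open>y / N \<le> 1\<close>; the bound is therefore free of
    \<open>N\<close>.\<close>
  have second: "y powr p * \<bar>\<theta> x - \<theta> y\<bar> \<le> x powr (p - 1) * (x - y)"
  proof (cases "y < N")
    case True
    have "\<bar>\<theta> x - \<theta> y\<bar> \<le> (x - y) / N"
      using y N True by (auto simp: \<theta>_def max_def field_simps)
    hence "y powr p * \<bar>\<theta> x - \<theta> y\<bar> \<le> y powr p * ((x - y) / N)" by (intro mult_left_mono) auto
    also have "\<dots> = y powr (p - 1) * (x - y) * (y / N)"
      using y by (simp add: powr_diff)
    also have "\<dots> \<le> y powr (p - 1) * (x - y) * 1" using True y N by (intro mult_left_mono) auto
    also have "\<dots> \<le> x powr (p - 1) * (x - y) * 1" using y p by (intro mult_right_mono powr_mono2) auto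
    finally show ?thesis by simp
  next
    case False
    hence "\<theta> x = 0" "\<theta> y = 0" using y N by (auto simp: \<theta>_def)
    thus ?thesis using y by simp
  qed
  have "x powr p * \<theta> x - y powr p * \<theta> y = (x powr p - y powr p) * \<theta> x + y powr p * (\<theta> x - \<theta> y)"
    by (simp add: algebra_simps)
  hence "\<bar>x powr p * \<theta> x - y powr p * \<theta> y\<bar> \<le> \<bar>(x powr p - y powr p) * \<theta> x\<bar> + \<bar>y powr p * (\<theta> x - \<theta> y)\<bar>"
    by (metis abs_triangle_ineq)
  also have "\<bar>(x powr p - y powr p) * \<theta> x\<bar> \<le> p * x powr (p - 1) * (x - y)"
    using pow mono \<theta> mult_left_le[of "\<theta> x" "x powr p - y powr p"] by (simp add: abs_mult)
  also have "\<bar>y powr p * (\<theta> x - \<theta> y)\<bar> \<le> x powr (p - 1) * (x - y)"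
    using second by (simp add: abs_mult)
  finally show ?thesis unfolding \<theta>_def by (simp add: algebra_simps)
qed

text \<open>\<open>\<psi>\<close> is the truncated weight divided by the frequency; \<open>x\<close>
  and \<open>y\<close> are the larger and the smaller of \<open>\<bar>k\<bar>\<close> and
  \<open>\<bar>l\<bar>\<close>, \<open>\<sigma>\<close> is their relative sign and
  \<open>z = \<bar>k - l\<bar>\<close>. If \<open>\<sigma> = 1\<close> and
  \<open>x \<le> 2 * y\<close>, the Lipschitz bound produces the factor \<open>z\<close> and thereby
  the first summand. Otherwise \<open>x \<le> 2 * z\<close>, and the size of \<open>\<psi>\<close>
  alone yields the second. The third summand makes the bound symmetric in \<open>x\<close> and
  \<open>y\<close>. The power of 2 stems from these two comparisons.\<close>

lemma cutoff_weight_commutator_real: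
  fixes x y z s N :: real
  assumes y: "0 < y" "y \<le> x" and s: "2 \<le> s" and N: "0 < N"
    and z: "\<sigma> = 1 \<and> z = x - y \<or> \<sigma> = -1 \<and> z = x + y"
  defines "\<psi> \<equiv> \<lambda>x. x powr (2 * s - 1) * max 0 (1 - x / N)"
  shows "x * y * \<bar>\<psi> x - \<sigma> * \<psi> y\<bar> \<le> s * 2 powr s *
    (z * x powr s * y powr s + y * x powr s * z powr s + x * y powr s * z powr s)"
proof -
  have x0: "0 < x" and z0: "0 \<le> z" using y z by auto
  have C0: "0 \<le> s * 2 powr s" using s by simp
  show ?thesis
  proof (cases "\<sigma> = 1 \<and> x \<le> 2 * y")
    case True
    hence z': "z = x - y" using z by auto
    have "\<bar>\<psi> x - \<psi> y\<bar> \<le> (2 * s - 1 + 1) * x powr (2 * s - 1 - 1) * (x - y)"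
      unfolding \<psi>_def by (rule cutoff_powr_Lipschitz[OF y _ N]) (use s in auto)
    hence "x * y * \<bar>\<psi> x - \<sigma> * \<psi> y\<bar> \<le> x * y * (2 * s * x powr (2 * s - 2) * z)"
      using True x0 y z' by (intro mult_left_mono) auto
    also have "\<dots> = 2 * s * z * y * (x * x powr (2 * s - 2))" by (simp add: mult_ac)
    also have "x * x powr (2 * s - 2) = x powr s * x powr (s - 1)"
      using x0 powr_add[of x 1 "2 * s - 2"] powr_add[of x s "s - 1"] by simp
    also have "2 * s * z * y * (x powr s * x powr (s - 1)) \<le> 2 * s * z * y * (x powr s * (2 * y) powr (s - 1))"
      using True y s z0 x0 by (intro mult_left_mono powr_mono2) auto
    also have "\<dots> = s * (2 * 2 powr (s - 1)) * (z * x powr s * (y * y powr (s - 1)))"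
      using y by (simp add: powr_mult mult_ac)
    also have "2 * 2 powr (s - 1) = 2 powr s" by (simp add: powr_diff)
    also have "y * y powr (s - 1) = y powr s" using y by (simp add: powr_diff)
    also have "s * 2 powr s * (z * x powr s * y powr s) \<le> s * 2 powr s *
       (z * x powr s * y powr s + y * x powr s * z powr s + x * y powr s * z powr s)"
      using C0 y x0 z0 by (intro mult_left_mono) auto
    finally show ?thesis .
  next
    case False
    hence xz: "x \<le> 2 * z" using z y by auto
    have pm: "y powr (2 * s - 1) \<le> x powr (2 * s - 1)" using y s by (intro powr_mono2) auto
    have ps: "0 \<le> \<psi> w \<and> \<psi> w \<le> w powr (2 * s - 1)" if "0 < w" for w
      using that N mult_left_le[of "max 0 (1 - w / N)" "w powr (2 * s - 1)"] by (auto simp: \<psi>_def)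
    have "\<bar>\<psi> x - \<sigma> * \<psi> y\<bar> \<le> 2 * x powr (2 * s - 1)"
      using ps[OF x0] ps[OF y(1)] pm z by auto
    hence "x * y * \<bar>\<psi> x - \<sigma> * \<psi> y\<bar> \<le> x * y * (2 * x powr (2 * s - 1))"
      using x0 y by (intro mult_left_mono) auto
    also have "\<dots> = 2 * y * (x * x powr (2 * s - 1))" by (simp add: mult_ac)
    also have "x * x powr (2 * s - 1) = x powr s * x powr s"
      using x0 powr_add[of x 1 "2 * s - 1"] powr_add[of x s s] by simp
    also have "2 * y * (x powr s * x powr s) \<le> 2 * y * (x powr s * (2 * z) powr s)"
      using xz y s x0 by (intro mult_left_mono powr_mono2) auto
    also have "\<dots> = 2 * 2 powr s * (y * x powr s * z powr s)"
      using z0 by (simp add: powr_mult mult_ac)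
    also have "\<dots> \<le> s * 2 powr s * (y * x powr s * z powr s)"
      using s y by (intro mult_right_mono) auto
    also have "\<dots> \<le> s * 2 powr s *
       (z * x powr s * y powr s + y * x powr s * z powr s + x * y powr s * z powr s)"
      using C0 y x0 z0 by (intro mult_left_mono) auto
    finally show ?thesis .
  qed
qed

lemma cutoff_weight_commutator:
  assumes k: "k \<noteq> 0" and l: "l \<noteq> 0" and s: "2 \<le> s" and N: "0 < N"
  shows "\<bar>cutoff_weight s N k * of_int l - cutoff_weight s N l * of_int k\<bar> \<le> s * 2 powr s *
    (\<bar>of_int (k - l)\<bar> * \<bar>of_int k\<bar> powr s * \<bar>of_int l\<bar> powr s
     + \<bar>of_int l\<bar> * \<bar>of_int k\<bar> powr s * \<bar>of_int (k - l)\<bar> powr s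
     + \<bar>of_int k\<bar> * \<bar>of_int l\<bar> powr s * \<bar>of_int (k - l)\<bar> powr s)"
proof -
  define \<psi> where "\<psi> = (\<lambda>x::real. x powr (2 * s - 1) * max 0 (1 - x / N))"
  have W: "cutoff_weight s N m = \<bar>of_int m\<bar> * \<psi> \<bar>of_int m\<bar>" if "m \<noteq> 0" for m
  proof -
    have "\<bar>real_of_int m\<bar> powr (2 * s) = \<bar>of_int m\<bar> * \<bar>of_int m\<bar> powr (2 * s - 1)"
      using powr_add[of "\<bar>real_of_int m\<bar>" 1 "2 * s - 1"] that by simp
    thus ?thesis by (simp add: cutoff_weight_def \<psi>_def)
  qed
  have main: "\<bar>cutoff_weight s N k * of_int l - cutoff_weight s N l * of_int k\<bar> \<le> s * 2 powr s *
    (\<bar>of_int (k - l)\<bar> * \<bar>of_int k\<bar> powr s * \<bar>of_int l\<bar> powr s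
     + \<bar>of_int l\<bar> * \<bar>of_int k\<bar> powr s * \<bar>of_int (k - l)\<bar> powr s
     + \<bar>of_int k\<bar> * \<bar>of_int l\<bar> powr s * \<bar>of_int (k - l)\<bar> powr s)"
    if k: "k \<noteq> 0" and l: "l \<noteq> 0" and le: "\<bar>l\<bar> \<le> \<bar>k\<bar>" for k l :: int
  proof -
    define x y z \<sigma> where "x = \<bar>real_of_int k\<bar>" and "y = \<bar>real_of_int l\<bar>" and "z = \<bar>real_of_int (k - l)\<bar>"
      and "\<sigma> = (if 0 < k \<longleftrightarrow> 0 < l then 1 else -1 :: real)"
    have y: "0 < y" "y \<le> x" using k l le unfolding x_def y_def by auto
    have z: "\<sigma> = 1 \<and> z = x - y \<or> \<sigma> = -1 \<and> z = x + y"
      using k l le unfolding x_def y_def z_def \<sigma>_def by (auto simp: abs_if)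
    have "\<bar>cutoff_weight s N k * of_int l - cutoff_weight s N l * of_int k\<bar> = x * y * \<bar>\<psi> x - \<sigma> * \<psi> y\<bar>"
    proof -
      define sk sl where "sk = sgn (real_of_int k)" and "sl = sgn (real_of_int l)"
      have eqs: "real_of_int l = sl * y" "real_of_int k = sk * x" "sk * sl = \<sigma>" "\<bar>sl\<bar> = 1" "sl * sl = 1"
        using k l by (auto simp: x_def y_def \<sigma>_def sk_def sl_def abs_if sgn_if)
      have sl_\<sigma>: "sl * \<sigma> = sk" using eqs(3,5) by (metis mult.assoc mult.commute mult.right_neutral)
      have "cutoff_weight s N k * of_int l - cutoff_weight s N l * of_int k = x * \<psi> x * (sl * y) - y * \<psi> y * (sk * x)"
      proof -
        have "cutoff_weight s N k = x * \<psi> x" "cutoff_weight s N l = y * \<psi> y"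
          unfolding x_def y_def by (rule W[OF k], rule W[OF l])
        thus ?thesis by (simp only: eqs(1,2))
      qed
      also have "\<dots> = sl * (x * y * \<psi> x) - (sl * \<sigma>) * (x * y * \<psi> y)"
        unfolding sl_\<sigma> by (simp add: mult_ac)
      also have "\<dots> = sl * (x * y * (\<psi> x - \<sigma> * \<psi> y))" by (simp add: algebra_simps)
      finally show ?thesis using y eqs(4) by (simp add: abs_mult)
    qed
    also have "\<dots> \<le> s * 2 powr s * (z * x powr s * y powr s + y * x powr s * z powr s + x * y powr s * z powr s)"
      unfolding \<psi>_def by (rule cutoff_weight_commutator_real[OF y s N z])
    finally show ?thesis unfolding x_def y_def z_def .
  qed
  show ?thesis
  proof (cases "\<bar>l\<bar> \<le> \<bar>k\<bar>")
    case True
    thus ?thesis by (rule main[OF k l])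
  next
    \<comment> \<open>Exchanging \<open>k\<close> and \<open>l\<close> swaps the second and the
      third summand and leaves the bound unchanged.\<close>
    case False
    hence "\<bar>k\<bar> \<le> \<bar>l\<bar>" by simp
    have e1: "\<bar>real_of_int (l - k)\<bar> = \<bar>real_of_int (k - l)\<bar>" by (simp add: abs_minus_commute)
    have e2: "\<bar>cutoff_weight s N l * of_int k - cutoff_weight s N k * of_int l\<bar> = \<bar>cutoff_weight s N k * of_int l - cutoff_weight s N l * of_int k\<bar>"
      by (rule abs_minus_commute)
    from main[OF l k \<open>\<bar>k\<bar> \<le> \<bar>l\<bar>\<close>, unfolded e1 e2] show ?thesis by (simp only: mult_ac add_ac)
  qed
qed

lemma bessel_weight_le:
  assumes "k \<noteq> 0"
  shows "bessel_weight k \<le> (1 + (2 * pi)\<^sup>2) * (of_int k)\<^sup>2"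
proof -
  have "1 \<le> \<bar>real_of_int k\<bar>" using assms by (cases "0 < k") auto
  hence "1 \<le> (real_of_int k)\<^sup>2" using one_le_power[of "\<bar>real_of_int k\<bar>" 2] by simp
  thus ?thesis by (simp add: bessel_weight_def power_mult_distrib algebra_simps)
qed

context ostrovsky_hunter
begin

text \<open>Up to the factor \<open>2 * pi\<close> the norm of \<open>ux\<close> in the algebra of
  absolutely convergent Fourier series. It takes the place of the supremum of
  \<open>\<bar>ux\<bar>\<close>, because estimating each triad by its modulus discards the
  phases.\<close>

definition slope_l1 :: "real \<Rightarrow> real" where
  "slope_l1 t = (\<Sum>\<^sub>\<infinity>k. \<bar>of_int k\<bar> * cmod (a t k))"

lemma slope_l1_summable: "t \<in> {0..<T} \<Longrightarrow> (\<lambda>k. \<bar>of_int k\<bar> * cmod (a t k)) summable_on UNIV"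
  using ka_summable[of t] by (simp add: norm_mult)

text \<open>Zero mean removes \<open>k = 0\<close>, and at the other integers the inhomogeneous
  symbol is at most \<open>1 + (2 * pi)^2\<close> times the homogeneous one.\<close>

lemma sobolev_norm_le_energy:
  assumes t: "t \<in> {0<..<T}" and r: "0 \<le> r" "r \<le> s"
  shows "sobolev_norm r (u t) \<le> sqrt ((1 + (2 * pi)\<^sup>2) powr r * energy r t)"
proof -
  have t': "t \<in> {0..<T}" using t by auto
  have le: "bessel_weight k powr r * (cmod (a t k))\<^sup>2 \<le> (1 + (2 * pi)\<^sup>2) powr r * (\<bar>of_int k\<bar> powr (2 * r) * (cmod (a t k))\<^sup>2)" for k
  proof (cases "k = 0")
    case False
    have "bessel_weight k powr r \<le> ((1 + (2 * pi)\<^sup>2) * (real_of_int k)\<^sup>2) powr r"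
      using r by (intro powr_mono2 bessel_weight_le False) (auto simp: less_imp_le)
    also have "\<dots> = (1 + (2 * pi)\<^sup>2) powr r * ((real_of_int k)\<^sup>2) powr r"
      by (rule powr_mult)
    also have "((real_of_int k)\<^sup>2) powr r = \<bar>of_int k\<bar> powr (2 * r)"
      using False by (simp add: powr_powr[symmetric] powr_realpow[symmetric])
    finally have "bessel_weight k powr r * (cmod (a t k))\<^sup>2 \<le> ((1 + (2 * pi)\<^sup>2) powr r * \<bar>of_int k\<bar> powr (2 * r)) * (cmod (a t k))\<^sup>2"
      by (intro mult_right_mono) auto
    thus ?thesis by (simp add: mult.assoc)
  qed (simp add: a_0[OF t])
  have "(\<lambda>k. bessel_weight k powr r * (cmod (a t k))\<^sup>2) summable_on UNIV"
    unfolding a_def using sobolev_mono(1)[OF u_sob[OF t'] r(2)] by (simp add: sobolev_iff)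
  moreover have "(\<lambda>k. (1 + (2 * pi)\<^sup>2) powr r * (\<bar>of_int k\<bar> powr (2 * r) * (cmod (a t k))\<^sup>2)) summable_on UNIV"
    by (intro summable_on_cmult_right energy_summable t' r)
  ultimately have "(\<Sum>\<^sub>\<infinity>k. bessel_weight k powr r * (cmod (a t k))\<^sup>2) \<le> (\<Sum>\<^sub>\<infinity>k. (1 + (2 * pi)\<^sup>2) powr r * (\<bar>of_int k\<bar> powr (2 * r) * (cmod (a t k))\<^sup>2))"
    by (intro infsum_mono le)
  also have "\<dots> = (1 + (2 * pi)\<^sup>2) powr r * energy r t"
    unfolding energy_def by (rule infsum_cmult_right')
  finally show ?thesis unfolding sobolev_norm_eq a_def by (rule real_sqrt_le_mono)
qed

lemma slope_l1_le:
  assumes t: "t \<in> {0<..<T}"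
  shows "slope_l1 t \<le> sob_const * sqrt ((1 + (2 * pi)\<^sup>2) powr 2 * energy 2 t)"
proof -
  have t': "t \<in> {0..<T}" using t by auto
  have "slope_l1 t \<le> sob_const * sobolev_norm 2 (u t)"
    using sobolev_2_l1(2)[OF u_sob2[OF t']] by (simp add: slope_l1_def a_def norm_mult)
  also have "\<dots> \<le> sob_const * sqrt ((1 + (2 * pi)\<^sup>2) powr 2 * energy 2 t)"
    using s_ge_2 by (intro mult_left_mono sobolev_norm_le_energy t sob_const_nonneg) auto
  finally show ?thesis .
qed

section \<open>Triad sums of the nonlinearity\<close>

lemma nonlinearity_has_sum:
  assumes t: "t \<in> {0..<T}"
  shows "((\<lambda>l. 2 * pi * \<i> * of_int l * a t l * a t (k - l)) has_sum fourier_coeff (\<lambda>x. u t x * ux t x) k) UNIV"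
proof -
  let ?d = "\<lambda>l. 2 * pi * \<i> * of_int l * a t l"
  have cu: "continuous_on UNIV (u t)" and cux: "continuous_on UNIV (ux t)"
    by (intro continuous_u_slice continuous_ux_slice t)+
  have "((\<lambda>l. ?d l * integral {0..1} (\<lambda>x. (of_real (u t x) * fexp (- k) x) * fexp l x)) has_sum
      integral {0..1} (\<lambda>x. (of_real (u t x) * fexp (- k) x) * fser ?d x)) UNIV"
    by (rule integral_fser[OF abs_summable_deriv(2)[OF ka_summable[OF t]]]) (intro continuous_intros cu)
  moreover have "integral {0..1} (\<lambda>x. (complex_of_real (u t x) * fexp (- k) x) * fexp l x) = a t (k - l)" for l
  proof -
    have "(\<lambda>x. (complex_of_real (u t x) * fexp (- k) x) * fexp l x) = (\<lambda>x. of_real (u t x) * fexp (- (k - l)) x)"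
      using fexp_add[of "- k" l] by (simp add: mult.assoc)
    thus ?thesis unfolding a_def fourier_coeff_fint[OF cu] fint_def by simp
  qed
  moreover have "integral {0..1} (\<lambda>x. (complex_of_real (u t x) * fexp (- k) x) * fser ?d x) = fourier_coeff (\<lambda>x. u t x * ux t x) k"
    unfolding ux_series[OF t] fourier_coeff_fint[OF continuous_on_mult[OF cu cux]] fint_def by (simp add: mult_ac)
  ultimately show ?thesis by simp
qed

text \<open>Summed over \<open>l\<close>, the term is \<open>W k * cnj (a t k)\<close> times
  coefficient \<open>k\<close> of \<open>u * ux\<close>; summed over both indices, it is the
  weighted inner product of the nonlinearity with \<open>u\<close>.\<close>

definition triad :: "(int \<Rightarrow> real) \<Rightarrow> real \<Rightarrow> int \<times> int \<Rightarrow> complex" where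
  "triad W t = (\<lambda>(k, l). of_real (W k) * cnj (a t k) * (2 * pi * \<i> * of_int l * a t l * a t (k - l)))"

text \<open>Only the real part of the sum over all triads enters; exchanging \<open>k\<close> and \<open>l\<close> turns it into a commutator of the weight.\<close>

lemma triad_symmetric:
  "triad W t (k, l) + cnj (triad W t (l, k)) =
     2 * pi * \<i> * of_real (W k * of_int l - W l * of_int k) * cnj (a t k) * a t l * a t (k - l)"
  using a_cnj[of t "k - l"] by (simp add: triad_def algebra_simps)

text \<open>A qualitative bound that depends on the size of \<open>W\<close>; it serves to justify
  rearranging the double sum, whereas the uniform estimate comes from
  \<open>triad_bound\<close>.\<close>

lemma triad_summable:
  assumes t: "t \<in> {0..<T}" and W: "finite {k. W k \<noteq> 0}"
  shows "triad W t summable_on UNIV"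
proof -
  define A where "A = (\<Sum>\<^sub>\<infinity>k. cmod (a t k))"
  have A: "cmod (a t k) \<le> A" for k
    using finite_sum_le_infsum[OF a_summable[OF t], of "{k}"] by (simp add: A_def)
  have A0: "0 \<le> A" using A[of 0] norm_ge_zero order_trans by blast
  let ?p = "\<lambda>k. \<bar>W k\<bar> * cmod (a t k) * (2 * pi)"
  have "(\<lambda>q. cmod (triad W t q)) summable_on UNIV"
  proof (rule nonneg_summable_on_product_le(1))
    show "?p summable_on UNIV"
      by (rule finite_nonzero_values_imp_summable_on) (rule finite_subset[OF _ W], auto)
    show "0 \<le> slope_l1 t * A" unfolding slope_l1_def by (intro mult_nonneg_nonneg A0 infsum_nonneg) auto
    show "(\<Sum>l\<in>B. cmod (triad W t (k, l))) \<le> ?p k * (slope_l1 t * A)" if B: "finite B" for k B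
    proof -
      have "cmod (triad W t (k, l)) \<le> ?p k * ((\<bar>of_int l\<bar> * cmod (a t l)) * A)" for l
      proof -
        have "cmod (triad W t (k, l)) = ?p k * ((\<bar>of_int l\<bar> * cmod (a t l)) * cmod (a t (k - l)))"
          by (simp add: triad_def norm_mult)
        also have "\<dots> \<le> ?p k * ((\<bar>of_int l\<bar> * cmod (a t l)) * A)" by (intro mult_left_mono A) auto
        finally show ?thesis .
      qed
      hence "(\<Sum>l\<in>B. cmod (triad W t (k, l))) \<le> (\<Sum>l\<in>B. ?p k * ((\<bar>of_int l\<bar> * cmod (a t l)) * A))" by (intro sum_mono)
      also have "\<dots> = ?p k * ((\<Sum>l\<in>B. \<bar>of_int l\<bar> * cmod (a t l)) * A)"
        by (simp add: sum_distrib_left sum_distrib_right)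
      also have "\<dots> \<le> ?p k * (slope_l1 t * A)"
        unfolding slope_l1_def
        by (intro mult_left_mono mult_right_mono A0 finite_sum_le_infsum slope_l1_summable t B) auto
      finally show ?thesis .
    qed
  qed auto
  thus ?thesis by (rule abs_summable_summable)
qed

text \<open>Merging the pairs \<open>(k, l)\<close> and \<open>(l, k)\<close> into \<open>G\<close>
  gives a series whose sum is twice the real part. Each of the three summands of the commutator
  bound, multiplied by the coefficients, is the form \<open>\<Theta>\<close> after a bijective
  change of indices, so the majorant sums to \<open>2 * pi * C * 3 * S\<close>.\<close>

lemma triad_bound:
  assumes t: "t \<in> {0<..<T}" and N: "0 < N" and W: "W = cutoff_weight s N" "finite {k. W k \<noteq> 0}"
  shows "\<bar>2 * Re (infsum (triad W t) UNIV)\<bar> \<le> 6 * pi * (s * 2 powr s) * (slope_l1 t * energy s t)"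
proof -
  have t': "t \<in> {0..<T}" using t by auto
  define p where "p = (\<lambda>k. \<bar>of_int k\<bar> * cmod (a t k))"
  define c where "c = (\<lambda>k. \<bar>of_int k\<bar> powr s * cmod (a t k))"
  have c2: "(c k)\<^sup>2 = \<bar>of_int k\<bar> powr (2 * s) * (cmod (a t k))\<^sup>2" for k
  proof -
    have "(\<bar>real_of_int k\<bar> powr s)\<^sup>2 = \<bar>of_int k\<bar> powr (2 * s)" by (simp add: power2_eq_square powr_add[symmetric])
    thus ?thesis by (simp add: c_def power_mult_distrib)
  qed
  \<comment> \<open>\<open>u\<close> is real valued, hence these moduli are even; the reflection of
    indices in \<open>T3\<close> depends on it.\<close>
  have even: "p (- k) = p k" "c (- k) = c k" for k by (simp_all add: p_def c_def a_cnj)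
  have even_diff: "c (l - k) = c (k - l)" for k l using even(2)[of "k - l"] by simp
  have ps: "p summable_on UNIV" unfolding p_def by (rule slope_l1_summable[OF t'])
  have cs: "(\<lambda>k. (c k)\<^sup>2) summable_on UNIV" unfolding c2 by (intro energy_summable t') (use s_ge_2 in auto)
  have p0: "0 \<le> p k" and c0: "0 \<le> c k" for k by (auto simp: p_def c_def)
  define \<Theta> where "\<Theta> = (\<lambda>(i, j). p i * c j * c (i + j))"
  define S where "S = infsum \<Theta> UNIV"
  have \<Theta>s: "\<Theta> summable_on UNIV" and S_le: "S \<le> slope_l1 t * energy s t"
    using trilinear_convolution[OF ps p0 cs c0] unfolding S_def \<Theta>_def slope_l1_def energy_def c2 by (simp_all add: p_def)
  have re: "((\<lambda>q. \<Theta> (\<phi> q)) has_sum S) UNIV" if "bij \<phi>" for \<phi>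
    using has_sum_reindex_bij_betw[OF that, of \<Theta> S] has_sum_infsum[OF \<Theta>s] by (simp add: S_def)
  have T1: "((\<lambda>q. p (fst q - snd q) * c (fst q) * c (snd q)) has_sum S) UNIV"
  proof -
    have "bij (\<lambda>(k, l). (k - l, l :: int))" by (rule bij_betw_byWitness[where f' = "\<lambda>(i, j). (i + j, j)"]) auto
    from re[OF this] show ?thesis by (simp add: \<Theta>_def case_prod_beta mult_ac)
  qed
  have T2: "((\<lambda>q. p (snd q) * c (fst q) * c (fst q - snd q)) has_sum S) UNIV"
  proof -
    have "bij (\<lambda>(k, l). (l, k - l :: int))" by (rule bij_betw_byWitness[where f' = "\<lambda>(i, j). (i + j, i)"]) auto
    from re[OF this] show ?thesis by (simp add: \<Theta>_def case_prod_beta mult_ac)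
  qed
  have T3: "((\<lambda>q. p (fst q) * c (snd q) * c (fst q - snd q)) has_sum S) UNIV"
  proof -
    have "bij (\<lambda>(k, l). (- k, l) :: int \<times> int)" by (rule bij_betw_byWitness[where f' = "\<lambda>(i, j). (- i, j)"]) auto
    from re[OF this] show ?thesis by (simp add: \<Theta>_def case_prod_beta even even_diff)
  qed
  define C where "C = s * 2 powr s"
  have C0: "0 \<le> C" using s_ge_2 by (simp add: C_def)
  define M where "M = (\<lambda>q. 2 * pi * C * (p (fst q - snd q) * c (fst q) * c (snd q) + p (snd q) * c (fst q) * c (fst q - snd q) + p (fst q) * c (snd q) * c (fst q - snd q)))"
  have M: "(M has_sum 2 * pi * C * (S + S + S)) UNIV"
    unfolding M_def by (intro has_sum_cmult_right has_sum_add T1 T2 T3)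
  define G where "G = (\<lambda>q. triad W t q + cnj (triad W t (prod.swap q)))"
  have G_le: "norm (G q) \<le> M q" for q
  proof (cases q)
    case (Pair k l)
    have "norm (G q) = 2 * pi * (\<bar>W k * of_int l - W l * of_int k\<bar> * (cmod (a t k) * cmod (a t l) * cmod (a t (k - l))))"
      unfolding G_def Pair prod.swap_def fst_conv snd_conv triad_symmetric norm_mult norm_of_real by simp
    also have "\<dots> \<le> M q"
    proof (cases "k = 0 \<or> l = 0")
      case True
      hence "cmod (a t k) * cmod (a t l) = 0" using a_0[OF t] by auto
      moreover have "0 \<le> M q" unfolding M_def Pair using C0 p0 c0 by (auto intro!: mult_nonneg_nonneg add_nonneg_nonneg)
      ultimately show ?thesis by auto
    next
      case False
      let ?B = "\<bar>of_int (k - l)\<bar> * \<bar>of_int k\<bar> powr s * \<bar>of_int l\<bar> powr s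
         + \<bar>of_int l\<bar> * \<bar>of_int k\<bar> powr s * \<bar>of_int (k - l)\<bar> powr s
         + \<bar>of_int k\<bar> * \<bar>of_int l\<bar> powr s * \<bar>of_int (k - l)\<bar> powr s :: real"
      have "\<bar>W k * of_int l - W l * of_int k\<bar> \<le> C * ?B"
        unfolding W C_def by (rule cutoff_weight_commutator) (use False s_ge_2 N in auto)
      hence "2 * pi * (\<bar>W k * of_int l - W l * of_int k\<bar> * (cmod (a t k) * cmod (a t l) * cmod (a t (k - l))))
         \<le> 2 * pi * ((C * ?B) * (cmod (a t k) * cmod (a t l) * cmod (a t (k - l))))"
        by (intro mult_left_mono mult_right_mono) auto
      also have "\<dots> = M q" unfolding M_def Pair p_def c_def by (simp add: algebra_simps)
      finally show ?thesis .
    qed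
    finally show ?thesis .
  qed
  have Fs: "triad W t summable_on UNIV" by (rule triad_summable[OF t' W(2)])
  have "((\<lambda>q. triad W t (prod.swap q)) has_sum infsum (triad W t) UNIV) UNIV"
    using has_sum_reindex_bij_betw[OF bij_swap, of "triad W t"] has_sum_infsum[OF Fs] by simp
  hence "(G has_sum (infsum (triad W t) UNIV + cnj (infsum (triad W t) UNIV))) UNIV"
    unfolding G_def by (intro has_sum_add has_sum_infsum Fs) simp
  hence "norm (infsum (triad W t) UNIV + cnj (infsum (triad W t) UNIV)) \<le> 2 * pi * C * (S + S + S)"
    by (rule norm_infsum_le[OF _ M G_le])
  moreover have "infsum (triad W t) UNIV + cnj (infsum (triad W t) UNIV) = of_real (2 * Re (infsum (triad W t) UNIV))"
    by (simp add: complex_eq_iff)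
  ultimately have "\<bar>2 * Re (infsum (triad W t) UNIV)\<bar> \<le> 2 * pi * C * (S + S + S)" by (simp only: norm_of_real)
  also have "\<dots> = 6 * pi * C * S" by simp
  also have "\<dots> \<le> 6 * pi * C * (slope_l1 t * energy s t)"
    by (intro mult_left_mono S_le) (use C0 in auto)
  finally show ?thesis by (simp add: C_def)
qed

lemma cutoff_weight_support: "N > 0 \<Longrightarrow> {k. cutoff_weight s (real N) k \<noteq> 0} \<subseteq> {- int N..int N}"
proof
  fix k assume N: "N > 0" and "k \<in> {k. cutoff_weight s (real N) k \<noteq> 0}"
  hence "0 < 1 - \<bar>real_of_int k\<bar> / real N" by (auto simp: cutoff_weight_def max_def split: if_splits)
  hence "\<bar>real_of_int k\<bar> < real N" using N by (simp add: divide_less_eq)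
  thus "k \<in> {- int N..int N}" by (auto simp: abs_less_iff)
qed

text \<open>A finite sum may be differentiated termwise. The source drops out because
  \<open>b\<close> is \<open>a\<close> divided by an imaginary number, so that
  \<open>cnj (a t k) * b t k\<close> has real part 0; only the triads remain.\<close>

lemma cutoff_energy_derivative:
  assumes t: "t \<in> {0<..<T}" and F: "finite F" "{k. W k \<noteq> 0} \<subseteq> F"
  shows "((\<lambda>t. \<Sum>k\<in>F. W k * (cmod (a t k))\<^sup>2) has_real_derivative - (2 * Re (infsum (triad W t) UNIV))) (at t)"
proof -
  have t': "t \<in> {0..<T}" using t by auto
  let ?n = "\<lambda>k. fourier_coeff (\<lambda>x. u t x * ux t x) k"
  have Wf: "finite {k. W k \<noteq> 0}" by (rule finite_subset[OF F(2,1)])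
  have d: "((\<lambda>t. (cmod (a t k))\<^sup>2) has_real_derivative - 2 * Re (cnj (a t k) * ?n k)) (at t)" for k
  proof -
    have re: "((\<lambda>t. Re (a t k)) has_real_derivative Re (da t k)) (at t)"
      using bounded_linear.has_vector_derivative[OF bounded_linear_Re a_has_derivative[OF t, of k]]
      by (simp add: has_real_derivative_iff_has_vector_derivative)
    have im: "((\<lambda>t. Im (a t k)) has_real_derivative Im (da t k)) (at t)"
      using bounded_linear.has_vector_derivative[OF bounded_linear_Im a_has_derivative[OF t, of k]]
      by (simp add: has_real_derivative_iff_has_vector_derivative)
    have "((\<lambda>t. (Re (a t k))\<^sup>2 + (Im (a t k))\<^sup>2) has_real_derivative
       2 * Re (cnj (a t k) * da t k)) (at t)"
      using DERIV_add[OF DERIV_power[OF re, of 2] DERIV_power[OF im, of 2]] by (simp add: algebra_simps)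
    moreover have "2 * Re (cnj (a t k) * da t k) = - 2 * Re (cnj (a t k) * ?n k)"
    proof -
      have "cnj (a t k) * b t k = of_real ((cmod (a t k))\<^sup>2) / (\<i> * of_real (2 * pi * of_int k))"
        unfolding b_def complex_norm_square by (simp add: mult_ac)
      moreover have "Re (of_real X / (\<i> * of_real y)) = 0" for X y by (simp add: Re_divide)
      ultimately have "Re (cnj (a t k) * b t k) = 0" by metis
      moreover have "cnj (a t k) * da t k = \<gamma> * (cnj (a t k) * b t k) - cnj (a t k) * ?n k"
        unfolding da_eq[OF t] by (simp add: algebra_simps)
      moreover have "Re (of_real \<gamma> * z) = \<gamma> * Re z" for z by simp
      ultimately show ?thesis by (simp only: minus_complex.sel) simp
    qed
    ultimately show ?thesis by (simp add: cmod_power2)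
  qed
  have sum: "((\<lambda>t. \<Sum>k\<in>F. W k * (cmod (a t k))\<^sup>2) has_real_derivative (\<Sum>k\<in>F. W k * (- 2 * Re (cnj (a t k) * ?n k)))) (at t)"
    by (intro DERIV_sum DERIV_cmult d)
  have "((\<lambda>k. of_real (W k) * cnj (a t k) * ?n k) has_sum infsum (triad W t) UNIV) UNIV"
  proof (rule has_sum_SigmaD[where f = "triad W t" and A = UNIV and B = "\<lambda>_. UNIV"])
    show "(triad W t has_sum infsum (triad W t) UNIV) (UNIV \<times> UNIV)"
      using has_sum_infsum[OF triad_summable[OF t' Wf]] by simp
    show "((\<lambda>l. triad W t (k, l)) has_sum of_real (W k) * cnj (a t k) * ?n k) UNIV" for k
      unfolding triad_def prod.case by (intro has_sum_cmult_right nonlinearity_has_sum t')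
  qed
  moreover have "((\<lambda>k. of_real (W k) * cnj (a t k) * ?n k) has_sum (\<Sum>k\<in>F. of_real (W k) * cnj (a t k) * ?n k)) UNIV"
    by (rule has_sum_finite_neutralI[OF F(1)]) (use F(2) in auto)
  ultimately have "infsum (triad W t) UNIV = (\<Sum>k\<in>F. of_real (W k) * cnj (a t k) * ?n k)" by (rule has_sum_unique)
  hence "- (2 * Re (infsum (triad W t) UNIV)) = (\<Sum>k\<in>F. W k * (- 2 * Re (cnj (a t k) * ?n k)))"
    by (simp add: mult.assoc Re_sum sum_distrib_left sum_negf[symmetric] del: times_complex.sel)
       (simp add: algebra_simps)
  with sum show ?thesis by simp
qed

text \<open>Gronwall with the truncated energies as approximations from below. Their rate
  \<open>K\<close> involves \<open>s\<close> and the bound of \<open>slope_l1\<close>, but not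
  \<open>N\<close>; the price is the full energy on the right-hand side, which the Gronwall lemma
  allows.\<close>

lemma energy_s_bounded:
  assumes t0: "0 < t0" "t0 < T" and C: "\<And>t. t \<in> {t0..<T} \<Longrightarrow> energy 2 t \<le> C"
  obtains B where "\<And>t. t \<in> {t0..<T} \<Longrightarrow> energy s t \<le> B"
proof -
  define A where "A = sob_const * sqrt ((1 + (2 * pi)\<^sup>2) powr 2 * C)"
  have A: "slope_l1 t \<le> A" if "t \<in> {t0..<T}" for t
  proof -
    have "slope_l1 t \<le> sob_const * sqrt ((1 + (2 * pi)\<^sup>2) powr 2 * energy 2 t)" using that t0 by (intro slope_l1_le) auto
    also have "\<dots> \<le> A" unfolding A_def
      by (intro mult_left_mono real_sqrt_le_mono C that sob_const_nonneg) auto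
    finally show ?thesis .
  qed
  define K where "K = 6 * pi * (s * 2 powr s) * A"
  have A0: "0 \<le> A"
    using A[of t0] t0 infsum_nonneg[of UNIV "\<lambda>k. \<bar>of_int k\<bar> * cmod (a t0 k)"] by (auto simp: slope_l1_def)
  have K0: "0 \<le> K" using A0 s_ge_2 by (simp add: K_def)
  define W where "W = (\<lambda>N::nat. cutoff_weight s (real N))"
  define F where "F = (\<lambda>N t. \<Sum>k\<in>{- int N..int N}. W N k * (cmod (a t k))\<^sup>2)"
  have W_le: "W N k \<le> \<bar>of_int k\<bar> powr (2 * s)" and W_ge: "0 \<le> W N k" for N k
    using mult_left_le[of "max 0 (1 - \<bar>real_of_int k\<bar> / real N)" "\<bar>of_int k\<bar> powr (2 * s)"]
    by (auto simp: W_def cutoff_weight_def)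
  have bound: "energy s t \<le> (energy s t0 + 1) * exp ((K + 1) * (T - t0))" if t: "t \<in> {t0..<T}" for t
  proof -
    have "energy s t < (energy s t0 + 1) * exp ((K + 1) * (t - t0))"
    \<comment> \<open>The index set starts above \<open>N = 0\<close>, where division by zero would
      turn the cutoff into the constant 1.\<close>
    proof (rule gronwall_from_below[where J = "{0<..}" and ?t1.0 = t and F = F and D = "\<lambda>N t. - (2 * Re (infsum (triad (W N) t) UNIV))"])
      show "continuous_on {t0..t} (energy s)"
        by (rule continuous_on_subset[OF continuous_energy]) (use t t0 s_ge_2 in auto)
      show "F N t0 \<le> energy s t0" for N
      proof -
        have "F N t0 \<le> (\<Sum>k\<in>{- int N..int N}. \<bar>of_int k\<bar> powr (2 * s) * (cmod (a t0 k))\<^sup>2)"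
          unfolding F_def by (intro sum_mono mult_right_mono W_le) auto
        also have "\<dots> \<le> energy s t0"
          unfolding energy_def by (intro finite_sum_le_infsum energy_summable) (use t0 s_ge_2 in auto)
        finally show ?thesis .
      qed
      show "\<exists>N\<in>{0<..}. energy s r - \<delta> < F N r" if r: "r \<in> {t0..t}" and \<delta>: "0 < \<delta>" for r \<delta>
      proof -
        have r': "r \<in> {0..<T}" using r t t0 by auto
        have es: "(\<lambda>k. \<bar>of_int k\<bar> powr (2 * s) * (cmod (a r k))\<^sup>2) summable_on UNIV"
          by (intro energy_summable r') (use s_ge_2 in auto)
        have "\<forall>\<^sub>F N in sequentially. (\<Sum>\<^sub>\<infinity>k. \<bar>of_int k\<bar> powr (2 * s) * (cmod (a r k))\<^sup>2) - \<delta> < (\<Sum>\<^sub>\<infinity>k. W N k * (cmod (a r k))\<^sup>2)"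
        proof (rule infsum_approx_from_below[OF _ _ _ es \<delta>])
          show "((\<lambda>N. W N k * (cmod (a r k))\<^sup>2) \<longlongrightarrow> \<bar>of_int k\<bar> powr (2 * s) * (cmod (a r k))\<^sup>2) sequentially" for k
          proof -
            have "(\<lambda>N. \<bar>real_of_int k\<bar> / real N) \<longlonglongrightarrow> 0" by (rule lim_const_over_n)
            hence "(\<lambda>N. \<bar>of_int k\<bar> powr (2 * s) * max 0 (1 - \<bar>real_of_int k\<bar> / real N) * (cmod (a r k))\<^sup>2) \<longlonglongrightarrow>
               \<bar>of_int k\<bar> powr (2 * s) * max 0 (1 - 0) * (cmod (a r k))\<^sup>2"
              by (intro tendsto_intros)
            thus ?thesis by (simp add: W_def cutoff_weight_def)
          qed
          show "(\<lambda>k. W N k * (cmod (a r k))\<^sup>2) summable_on UNIV" for N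
            by (rule summable_on_comparison_test[OF es]) (use W_le W_ge in \<open>auto intro: mult_right_mono\<close>)
        qed (use W_ge in auto)
        hence "\<forall>\<^sub>F N in sequentially. 0 < N \<and> (\<Sum>\<^sub>\<infinity>k. \<bar>of_int k\<bar> powr (2 * s) * (cmod (a r k))\<^sup>2) - \<delta> < (\<Sum>\<^sub>\<infinity>k. W N k * (cmod (a r k))\<^sup>2)"
          using eventually_gt_at_top[of "0 :: nat"] by eventually_elim auto
        then obtain N where N: "0 < N" "energy s r - \<delta> < (\<Sum>\<^sub>\<infinity>k. W N k * (cmod (a r k))\<^sup>2)"
          unfolding energy_def using eventually_happens'[OF sequentially_bot] by blast
        moreover have "((\<lambda>k. W N k * (cmod (a r k))\<^sup>2) has_sum F N r) UNIV"
          unfolding F_def by (rule has_sum_finite_neutralI[of "{- int N..int N}"])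
            (use cutoff_weight_support[OF N(1)] in \<open>auto simp: W_def\<close>)
        ultimately show ?thesis by (auto simp: infsumI)
      qed
      show "(F N has_real_derivative - (2 * Re (infsum (triad (W N) r) UNIV))) (at r)"
        if "N \<in> {0<..}" "r \<in> {t0..t}" for N r
        unfolding F_def by (rule cutoff_energy_derivative) (use that t t0 cutoff_weight_support[of N] in \<open>auto simp: W_def\<close>)
      show "- (2 * Re (infsum (triad (W N) r) UNIV)) \<le> K * energy s r"
        if N: "N \<in> {0<..}" and r: "r \<in> {t0..t}" for N r
      proof -
        have "\<bar>2 * Re (infsum (triad (W N) r) UNIV)\<bar> \<le> 6 * pi * (s * 2 powr s) * (slope_l1 r * energy s r)"
          by (rule triad_bound[where N = "real N"])
             (use N r t t0 finite_subset[OF cutoff_weight_support[of N]] in \<open>auto simp: W_def\<close>)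
        also have "\<dots> \<le> 6 * pi * (s * 2 powr s) * (A * energy s r)"
          using r t s_ge_2 by (intro mult_left_mono mult_right_mono A energy_nonneg) auto
        finally have "\<bar>2 * Re (infsum (triad (W N) r) UNIV)\<bar> \<le> K * energy s r"
          unfolding K_def by (simp only: mult.assoc)
        thus ?thesis by linarith
      qed
    qed (use K0 t in \<open>auto simp: energy_nonneg\<close>)
    also have "\<dots> \<le> (energy s t0 + 1) * exp ((K + 1) * (T - t0))"
      using t K0 energy_nonneg[of s t0] by (intro mult_left_mono) auto
    finally show ?thesis by simp
  qed
  thus thesis by (rule that)
qed

lemma sobolev_norm_bounded:
  assumes freq: "\<exists>\<^sub>F t in at_left T. \<forall>x. - M \<le> ux t x"
  obtains t0 B where "0 < t0" "t0 < T" "\<And>t. t \<in> {t0..<T} \<Longrightarrow> sobolev_norm s (u t) \<le> B"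
proof -
  obtain t0 L where t0: "0 < t0" "t0 < T" and L: "\<And>t x. t \<in> {t0..<T} \<Longrightarrow> \<bar>ux t x\<bar> \<le> L"
    using slope_bounded[OF freq] by blast
  obtain C where C: "\<And>t. t \<in> {t0..<T} \<Longrightarrow> energy 2 t \<le> C"
    using energy_2_bounded[OF t0 L] by blast
  obtain B where B: "\<And>t. t \<in> {t0..<T} \<Longrightarrow> energy s t \<le> B"
    using energy_s_bounded[OF t0 C] by blast
  have "sobolev_norm s (u t) \<le> sqrt ((1 + (2 * pi)\<^sup>2) powr s * B)" if "t \<in> {t0..<T}" for t
  proof -
    have "sobolev_norm s (u t) \<le> sqrt ((1 + (2 * pi)\<^sup>2) powr s * energy s t)"
      by (rule sobolev_norm_le_energy) (use that t0 s_ge_2 in auto)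
    also have "\<dots> \<le> sqrt ((1 + (2 * pi)\<^sup>2) powr s * B)"
      by (intro real_sqrt_le_mono mult_left_mono B that) auto
    finally show ?thesis .
  qed
  with t0 that show thesis by blast
qed

end

section \<open>Blow-up\<close>

lemma sobolev_norm_nonneg: "0 \<le> sobolev_norm s f"
  unfolding sobolev_norm_eq by (intro real_sqrt_ge_zero infsum_nonneg) auto

lemma abs_deriv_le_sobolev_norm:
  assumes "f \<in> sobolev s" "2 \<le> s" "continuous_on UNIV f"
  shows "\<bar>deriv f x\<bar> \<le> 2 * pi * sob_const * sobolev_norm s f"
proof -
  have "\<bar>deriv f x\<bar> \<le> 2 * pi * sob_const * sobolev_norm 2 f"
    by (rule continuous_sobolev_2_deriv(3)[OF sobolev_mono(1)[OF assms(1,2)] assms(3)])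
  also have "\<dots> \<le> 2 * pi * sob_const * sobolev_norm s f"
    by (intro mult_left_mono sobolev_mono(2)[OF assms(1,2)]) (simp add: sob_const_nonneg)
  finally show ?thesis .
qed

lemma solution_locale:
  assumes "0 < \<gamma>" "2 \<le> s" "is_solution \<gamma> s u0 Tmax u" "0 < T" "ereal T \<le> Tmax"
  obtains v where "ostrovsky_hunter \<gamma> s T u v"
proof -
  obtain v where v: "has_sobolev_time_derivative (s - 1) (time_interval Tmax) u v"
    "\<And>t. t \<in> time_interval Tmax \<Longrightarrow> 0 < t \<Longrightarrow>
      distributional_derivative (\<lambda>x. v t x + u t x * deriv (u t) x) (\<lambda>x. \<gamma> * u t x)"
    using assms(3) unfolding is_solution_def by blast
  have u: "\<And>t. t \<in> time_interval Tmax \<Longrightarrow> continuous_on UNIV (u t)" "continuous_in_sobolev s (time_interval Tmax) u"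
    using assms(3) unfolding is_solution_def by blast+
  have "ereal t < Tmax" if "t < T" for t
    using that assms(5) by (meson ereal_less(2) less_ereal.simps(1) less_le_trans)
  hence sub: "{0..<T} \<subseteq> time_interval Tmax" by (auto simp: time_interval_def)
  have "ostrovsky_hunter \<gamma> s T u v"
  proof
    fix t assume t: "t \<in> {0..<T}"
    hence t': "t \<in> time_interval Tmax" using sub by blast
    show "continuous_on UNIV (u t)" by (rule u(1)[OF t'])
    show "u t \<in> sobolev s" using u(2) t' by (simp add: continuous_in_sobolev_def)
    show "((\<lambda>r. sobolev_norm s (\<lambda>x. u r x - u t x)) \<longlongrightarrow> 0) (at t within {0..<T})"
      using u(2) t' by (intro tendsto_within_subset[OF _ sub]) (simp add: continuous_in_sobolev_def)
    show "v t \<in> sobolev (s - 1)" using v(1) t' by (simp add: has_sobolev_time_derivative_def)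
    show "((\<lambda>r. sobolev_norm (s - 1) (\<lambda>x. (u r x - u t x) / (r - t) - v t x)) \<longlongrightarrow> 0) (at t within {0..<T})"
      using v(1) t' by (intro tendsto_within_subset[OF _ sub]) (simp add: has_sobolev_time_derivative_def)
  next
    fix t assume "t \<in> {0<..<T}"
    thus "distributional_derivative (\<lambda>x. v t x + u t x * deriv (u t) x) (\<lambda>x. \<gamma> * u t x)"
      using sub by (intro v(2)) auto
  qed (use assms in auto)
  thus thesis by (rule that)
qed

text \<open>At an interior time \<open>u\<close> is continuous in \<open>H^s\<close>, so just before
  \<open>T\<close> it lies within distance 1 of \<open>u T\<close>; the embedding into
  \<open>C^1\<close> turns this into a slope bound that is uniform near \<open>T\<close>.\<close>

lemma slope_lower_bound_near_interior_time:
  assumes s: "2 \<le> s" and T: "0 < T" "ereal T < Tmax" and sol: "is_solution \<gamma> s u0 Tmax u"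
  obtains B where "\<forall>\<^sub>F t in at_left T. \<forall>x. - B \<le> deriv (u t) x"
proof -
  define C where "C = 2 * pi * sob_const"
  have C0: "0 \<le> C" by (simp add: C_def sob_const_nonneg)
  have "ereal t < Tmax" if "t \<le> T" for t
    using that T(2) by (meson ereal_less_eq(3) le_less_trans)
  hence sub: "{0..T} \<subseteq> time_interval Tmax" by (auto simp: time_interval_def)
  have cont: "continuous_on UNIV (u t)" and sob: "u t \<in> sobolev s" if "t \<in> {0..T}" for t
    using sol sub that unfolding is_solution_def continuous_in_sobolev_def by blast+
  have "T \<in> time_interval Tmax" using sub T(1) by auto
  hence "((\<lambda>r. sobolev_norm s (\<lambda>x. u r x - u T x)) \<longlongrightarrow> 0) (at T within time_interval Tmax)"
    using sol unfolding is_solution_def continuous_in_sobolev_def by blast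
  from tendsto_within_subset[OF this sub]
  have "((\<lambda>r. sobolev_norm s (\<lambda>x. u r x - u T x)) \<longlongrightarrow> 0) (at_left T)"
    using T(1) by (simp add: at_within_Icc_at_left)
  hence ev: "\<forall>\<^sub>F r in at_left T. sobolev_norm s (\<lambda>x. u r x - u T x) < 1"
    by (rule order_tendstoD) simp
  have TT: "T \<in> {0..T}" using T by simp
  show thesis
  proof (rule that[of "C + C * sobolev_norm s (u T)"])
    show "\<forall>\<^sub>F t in at_left T. \<forall>x. - (C + C * sobolev_norm s (u T)) \<le> deriv (u t) x"
      using ev eventually_at_left_real[OF T(1)]
    proof eventually_elim
      case (elim t)
      hence t: "t \<in> {0..T}" by auto
      show ?case
      proof
        fix x
        have der: "(u r has_real_derivative deriv (u r) x) (at x)" if "r \<in> {0..T}" for r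
          using continuous_sobolev_2_deriv(1)[OF sobolev_mono(1)[OF sob[OF that] s] cont[OF that], of x]
            DERIV_imp_deriv by metis
        have d: "((\<lambda>x. u t x - u T x) has_real_derivative deriv (u t) x - deriv (u T) x) (at x)"
          by (intro DERIV_diff der t TT)
        have "\<bar>deriv (\<lambda>x. u t x - u T x) x\<bar> \<le> C * sobolev_norm s (\<lambda>x. u t x - u T x)"
          unfolding C_def using t TT
          by (intro abs_deriv_le_sobolev_norm sobolev_diff(1) sob s continuous_intros cont)
        also have "\<dots> \<le> C * 1" using elim C0 by (intro mult_left_mono) auto
        finally have "\<bar>deriv (u t) x - deriv (u T) x\<bar> \<le> C" by (simp add: DERIV_imp_deriv[OF d])
        moreover have "\<bar>deriv (u T) x\<bar> \<le> C * sobolev_norm s (u T)"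
          unfolding C_def by (intro abs_deriv_le_sobolev_norm sob s cont TT)
        ultimately show "- (C + C * sobolev_norm s (u T)) \<le> deriv (u t) x" by linarith
      qed
    qed
  qed
qed

theorem lemma2:
  fixes \<gamma> s T :: real and u0 :: "real \<Rightarrow> real" and u :: "real \<Rightarrow> real \<Rightarrow> real" and Tmax :: ereal
  assumes "\<gamma> > 0"
    and "s \<ge> 2"
    and "u0 \<in> sobolev s"
    and "(LBINT x:{0..1}. u0 x) = 0"
    and "is_maximal_solution \<gamma> s u0 Tmax u"
    and "0 < T" and "ereal T \<le> Tmax"
  shows "(Tmax = ereal T \<and> filterlim (\<lambda>t. sobolev_norm s (u t)) at_top (at_left T))
     \<longleftrightarrow> filterlim (\<lambda>t. INF x. deriv (u t) x) at_bot (at_left T)"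
proof -
  have sol: "is_solution \<gamma> s u0 Tmax u" using assms(5) by (simp add: is_maximal_solution_def)
  obtain v where "ostrovsky_hunter \<gamma> s T u v"
    using solution_locale[OF assms(1,2) sol assms(6,7)] by blast
  then interpret ostrovsky_hunter \<gamma> s T u v .
  define C where "C = 2 * pi * sob_const"
  have C0: "0 \<le> C" by (simp add: C_def sob_const_nonneg)
  have slope: "\<bar>deriv (u t) x\<bar> \<le> C * sobolev_norm s (u t)" if "t \<in> {0<..<T}" for t x
    unfolding C_def using that by (intro abs_deriv_le_sobolev_norm u_sob s_ge_2 u_cont) auto
  have near: "\<forall>\<^sub>F t in at_left T. t \<in> {0<..<T}" by (rule eventually_at_left_real[OF assms(6)])
  \<comment> \<open>A real infimum is meaningful only for a set that is bounded below; the embedding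
    supplies the bound.\<close>
  have INF_le: "(INF x. deriv (u t) x) \<le> deriv (u t) x" if "t \<in> {0<..<T}" for t x
  proof (rule cINF_lower)
    show "bdd_below (range (deriv (u t)))"
      by (rule bdd_belowI[of _ "- (C * sobolev_norm s (u t))"]) (use slope[OF that] in \<open>auto simp: abs_le_iff minus_le_iff\<close>)
  qed simp
  show ?thesis
  proof
    assume L: "Tmax = ereal T \<and> filterlim (\<lambda>t. sobolev_norm s (u t)) at_top (at_left T)"
    show "filterlim (\<lambda>t. INF x. deriv (u t) x) at_bot (at_left T)"
    proof (rule ccontr)
      assume "\<not> ?thesis"
      \<comment> \<open>Failure of the limit bounds the slope only frequently, not eventually; this
        dictates the hypothesis of \<open>sobolev_norm_bounded\<close>.\<close>
      then obtain Z where "\<not> (\<forall>\<^sub>F t in at_left T. (INF x. deriv (u t) x) \<le> Z)"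
        by (auto simp: filterlim_at_bot)
      hence "\<exists>\<^sub>F t in at_left T. \<not> (INF x. deriv (u t) x) \<le> Z" by (simp add: not_eventually)
      from frequently_eventually_frequently[OF this near]
      have "\<exists>\<^sub>F t in at_left T. \<forall>x. - (- Z) \<le> ux t x"
      proof (rule frequently_elim1)
        fix t assume t: "\<not> (INF x. deriv (u t) x) \<le> Z \<and> t \<in> {0<..<T}"
        show "\<forall>x. - (- Z) \<le> ux t x"
        proof
          fix x show "- (- Z) \<le> ux t x" using INF_le[of t x] t by (simp add: ux_def)
        qed
      qed
      then obtain t0 B where t0: "0 < t0" "t0 < T" and B: "\<And>t. t \<in> {t0..<T} \<Longrightarrow> sobolev_norm s (u t) \<le> B"
        using sobolev_norm_bounded by blast
      have "\<forall>\<^sub>F t in at_left T. B + 1 \<le> sobolev_norm s (u t)" using L by (simp add: filterlim_at_top)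
      moreover have "\<forall>\<^sub>F t in at_left T. t \<in> {t0<..<T}" by (rule eventually_at_left_real[OF t0(2)])
      ultimately have "\<forall>\<^sub>F t in at_left T. False"
      proof eventually_elim
        case (elim t)
        with B[of t] show ?case by auto
      qed
      thus False by simp
    qed
  next
    assume R: "filterlim (\<lambda>t. INF x. deriv (u t) x) at_bot (at_left T)"
    have "filterlim (\<lambda>t. sobolev_norm s (u t)) at_top (at_left T)"
      unfolding filterlim_at_top
    proof
      \<comment> \<open>The threshold for the slope uses \<open>C + 1\<close>, since
        \<open>C\<close> is only known to be nonnegative and the factor has to be cancelled.\<close>
      fix Z :: real
      have "\<forall>\<^sub>F t in at_left T. (INF x. deriv (u t) x) \<le> - ((C + 1) * Z)" using R by (simp add: filterlim_at_bot)
      with near show "\<forall>\<^sub>F t in at_left T. Z \<le> sobolev_norm s (u t)"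
      proof eventually_elim
        case (elim t)
        have "- (C * sobolev_norm s (u t)) \<le> (INF x. deriv (u t) x)"
          using slope[OF elim(1)] by (intro cINF_greatest) (auto simp: abs_le_iff minus_le_iff)
        hence "(C + 1) * Z \<le> (C + 1) * sobolev_norm s (u t)"
          using elim(2) sobolev_norm_nonneg[of s "u t"] by (simp add: distrib_right)
        thus ?case using C0 by simp
      qed
    qed
    moreover have "Tmax = ereal T"
    proof (rule ccontr)
      assume "Tmax \<noteq> ereal T"
      hence "ereal T < Tmax" using assms(7) by simp
      then obtain B where "\<forall>\<^sub>F t in at_left T. \<forall>x. - B \<le> deriv (u t) x"
        using slope_lower_bound_near_interior_time[OF assms(2,6) _ sol] by blast
      moreover have "\<forall>\<^sub>F t in at_left T. (INF x. deriv (u t) x) \<le> - B - 1" using R by (simp add: filterlim_at_bot)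
      ultimately have "\<forall>\<^sub>F t in at_left T. False"
      proof eventually_elim
        case (elim t)
        have "- B \<le> (INF x. deriv (u t) x)" using elim(1) by (intro cINF_greatest) auto
        with elim(2) show ?case by simp
      qed
      thus False by simp
    qed
    ultimately show "Tmax = ereal T \<and> filterlim (\<lambda>t. sobolev_norm s (u t)) at_top (at_left T)" by simp
  qed
qed

end
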